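(* Let $G$ be a finite group, let $V$ be a finite-dimensional linear representation of $G$ over $k$, and let $\mathsf{q}$ be a non-degenerate $G$-invariant quadratic form on $V$. Let $$X=\{\mathsf{q}=0\}\subset \mathbb{P}(V)$$ and assume $\dim(X)>0$. Let $0\neq W\subset V$ be an isotropic subspace for $\mathsf{q}$, and let $H_W\simeq W\oplus W^{\vee}\subseteq V$ be a hyperbolic subspace containing $W$ as its first isotropic summand (such a subspace exists). Let $H_W^{\perp}$ be the orthogonal complement of $H_W$ in $V$ with respect to $\mathsf{q}$. (1) If $G$ acts generically freely on $\mathbb{P}(W^{\vee}\oplus H_W^{\perp})$, then $X$ is linearizable. (2) If $G$ acts generically freely on $X$, then $X$ is stably linearizable.
   Context: The base field $k$ is algebraically closed of characteristic zero. For a finite group $G$, a smooth variety $X$ over $k$ with a generically free regular action of $G$ is called linearizable if there is a $G$-equivariant birational map $\mathbb{P}(V')\dashrightarrow X$ for some linear representation $V'$ of $G$. It is called stably linearizable if $X\times\mathbb{P}^m$, with trivial action on the second factor, is linearizable for some $m$. Given a non-degenerate $G$-invariant quadratic form $\mathsf{q}$ on a representation $V$ (with associated symmetric bilinear form also denoted $\mathsf{q}(\cdot,\cdot)$): an isotropic subspace is a $G$-invariant subspace $W\subseteq V$ with $\mathsf{q}|_W=0$. A hyperbolic subspace is given by a pair of $G$-invariant isotropic subspaces $W,W^{\vee}\subset V$, the second identified with the dual representation of $W$, such that $\mathsf{q}(w,f)=f(w)$ for all $w\in W$, $f\in W^{\vee}$; one writes $H_W:=W\oplus W^{\vee}$,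 so the form on $H_W$ has matrix $\begin{pmatrix}0&I\\ I&0\end{pmatrix}$. *)

theory Defs
  imports
    "HOL-Analysis.Abstract_Topology"
    "HOL-Library.Extended_Nat"
    "HOL-Library.Function_Algebras"
    "HOL-Computational_Algebra.Polynomial"
    "HOL-Algebra.Group"
begin

text \<open>
  Varieties over the algebraically closed field \<open>'k\<close> are treated classically, as spaces with
  functions in the sense of Serre: a topological space of closed points together with the
  \<open>'k\<close>-valued regular functions on its open subsets. In \<open>reg X U f\<close> only the values
  of \<open>f\<close> on \<open>U\<close> matter.
\<close>

record ('a, 'k) fspace =
  ztop :: "'a topology"
  reg :: "'a set \<Rightarrow> ('a \<Rightarrow> 'k) \<Rightarrow> bool"

abbreviation points :: "('a, 'k) fspace \<Rightarrow> 'a set"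
  where "points X \<equiv> topspace (ztop X)"

definition dense_open :: "('a, 'k) fspace \<Rightarrow> 'a set \<Rightarrow> bool"
  where "dense_open X U \<longleftrightarrow> openin (ztop X) U \<and> ztop X closure_of U = points X"

text \<open>\<open>\<phi>\<close> is a morphism from the open subspace \<open>U\<close> of \<open>X\<close> to the open subspace \<open>V\<close> of \<open>Y\<close>.\<close>

definition regular_map ::
  "('a, 'k) fspace \<Rightarrow> 'a set \<Rightarrow> ('b, 'k) fspace \<Rightarrow> 'b set \<Rightarrow> ('a \<Rightarrow> 'b) \<Rightarrow> bool"
  where "regular_map X U Y V \<phi> \<longleftrightarrow>
    \<phi> ` U \<subseteq> V \<and>
    (\<forall>O'. openin (ztop Y) O' \<and> O' \<subseteq> V \<longrightarrow>
      openin (ztop X) {x \<in> U. \<phi> x \<in> O'} \<and>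
      (\<forall>f. reg Y O' f \<longrightarrow> reg X {x \<in> U. \<phi> x \<in> O'} (f \<circ> \<phi>)))"

definition irreducible_closed :: "'a topology \<Rightarrow> 'a set \<Rightarrow> bool"
  where "irreducible_closed T Z \<longleftrightarrow>
    closedin T Z \<and> Z \<noteq> {} \<and>
    (\<forall>A B. closedin T A \<and> closedin T B \<and> Z = A \<union> B \<longrightarrow> Z = A \<or> Z = B)"

text \<open>Krull dimension, by lengths of chains of irreducible closed subsets; the empty space gets
  dimension \<open>0\<close> here instead of the usual \<open>-\<infinity>\<close>.\<close>

definition krull_dim :: "'a topology \<Rightarrow> enat"
  where "krull_dim T =
    Sup {enat n | n. \<exists>Z :: nat \<Rightarrow> 'a set.
      (\<forall>i\<le>n. irreducible_closed T (Z i)) \<and> (\<forall>i<n. Z i \<subset> Z (Suc i))}"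

definition regular_action ::
  "('g, 'm) monoid_scheme \<Rightarrow> ('g \<Rightarrow> 'a \<Rightarrow> 'a) \<Rightarrow> ('a, 'k) fspace \<Rightarrow> bool"
  where "regular_action G act X \<longleftrightarrow>
    (\<forall>g\<in>carrier G. regular_map X (points X) X (points X) (act g)) \<and>
    (\<forall>x\<in>points X. act \<one>\<^bsub>G\<^esub> x = x) \<and>
    (\<forall>g\<in>carrier G. \<forall>h\<in>carrier G. \<forall>x\<in>points X. act (g \<otimes>\<^bsub>G\<^esub> h) x = act g (act h x))"

definition generically_free ::
  "('g, 'm) monoid_scheme \<Rightarrow> ('g \<Rightarrow> 'a \<Rightarrow> 'a) \<Rightarrow> ('a, 'k) fspace \<Rightarrow> bool"
  where "generically_free G act X \<longleftrightarrow>
    (\<exists>U. dense_open X U \<and> (\<forall>x\<in>U. \<forall>g\<in>carrier G. act g x = x \<longrightarrow> g = \<one>\<^bsub>G\<^esub>))"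

text \<open>A birational map is represented by an isomorphism between dense open subsets. Equivariance is
  equality of the rational maps \<open>\<phi> \<circ> g\<close> and \<open>g \<circ> \<phi>\<close>, tested on
  \<open>U \<inter> g\<inverse>U\<close>, which is dense for a regular action.\<close>

definition equivariantly_birational ::
  "('g, 'm) monoid_scheme \<Rightarrow> ('g \<Rightarrow> 'a \<Rightarrow> 'a) \<Rightarrow> ('a, 'k) fspace \<Rightarrow>
    ('g \<Rightarrow> 'b \<Rightarrow> 'b) \<Rightarrow> ('b, 'k) fspace \<Rightarrow> bool"
  where "equivariantly_birational G actX X actY Y \<longleftrightarrow>
    (\<exists>U V \<phi> \<psi>. dense_open X U \<and> dense_open Y V \<and>
      regular_map X U Y V \<phi> \<and> regular_map Y V X U \<psi> \<and>
      (\<forall>x\<in>U. \<psi> (\<phi> x) = x) \<and> (\<forall>y\<in>V. \<phi> (\<psi> y) = y) \<and>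
      (\<forall>g\<in>carrier G. \<forall>x\<in>U. actX g x \<in> U \<longrightarrow> \<phi> (actX g x) = actY g (\<phi> x)))"

text \<open>
  The product in the category of spaces with functions. It has the product topology of varieties,
  which is finer than the topological product: the basic open sets are the loci
  in \<open>U \<times> V\<close> where some \<open>\<Sum>i. a\<^sub>i(x) b\<^sub>i(y)\<close> is nonzero, with \<open>a\<^sub>i\<close>, \<open>b\<^sub>i\<close> regular on
  \<open>U\<close>, \<open>V\<close>. Regular functions are locally quotients of such sums.
\<close>

definition tensor_functions ::
  "('a, 'k::field) fspace \<Rightarrow> 'a set \<Rightarrow> ('b, 'k) fspace \<Rightarrow> 'b set \<Rightarrow> ('a \<times> 'b \<Rightarrow> 'k) set"
  where "tensor_functions X U Y V =
    {(\<lambda>(x, y). \<Sum>i<n. a i x * b i y) | n a b.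
      \<forall>i<(n::nat). reg X U (a i) \<and> reg Y V (b i)}"

definition product_ztop :: "('a, 'k::field) fspace \<Rightarrow> ('b, 'k) fspace \<Rightarrow> ('a \<times> 'b) topology"
  where "product_ztop X Y = topology_generated_by
    {{p \<in> U \<times> V. t p \<noteq> 0} | U V t.
      openin (ztop X) U \<and> openin (ztop Y) V \<and> t \<in> tensor_functions X U Y V}"

definition product_fspace ::
  "('a, 'k::field) fspace \<Rightarrow> ('b, 'k) fspace \<Rightarrow> ('a \<times> 'b, 'k) fspace"
  where "product_fspace X Y =
    \<lparr>ztop = product_ztop X Y,
     reg = (\<lambda>O' F. \<forall>p\<in>O'. \<exists>N U V s t.
       openin (product_ztop X Y) N \<and> p \<in> N \<and> N \<subseteq> O' \<inter> (U \<times> V) \<and>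
       openin (ztop X) U \<and> openin (ztop Y) V \<and>
       s \<in> tensor_functions X U Y V \<and> t \<in> tensor_functions X U Y V \<and>
       (\<forall>r\<in>N. t r \<noteq> 0 \<and> F r = s r / t r))\<rparr>"

text \<open>
  Projective geometry in a vector space with scalar multiplication \<open>scale\<close>. Homogeneous
  polynomial functions are generated by the linear functionals, so no basis is chosen; as the field
  is infinite, they are the same as homogeneous polynomials.
\<close>

inductive homogeneous_poly ::
  "('k::field \<Rightarrow> 'v::ab_group_add \<Rightarrow> 'v) \<Rightarrow> nat \<Rightarrow> ('v \<Rightarrow> 'k) \<Rightarrow> bool"
  for scale
  where
    const: "homogeneous_poly scale 0 (\<lambda>_. c)"
  | linear: "Vector_Spaces.linear scale (*) f \<Longrightarrow> homogeneous_poly scale 1 f"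
  | add: "\<lbrakk>homogeneous_poly scale d f; homogeneous_poly scale d g\<rbrakk>
      \<Longrightarrow> homogeneous_poly scale d (\<lambda>v. f v + g v)"
  | mult: "\<lbrakk>homogeneous_poly scale d f; homogeneous_poly scale e g\<rbrakk>
      \<Longrightarrow> homogeneous_poly scale (d + e) (\<lambda>v. f v * g v)"

text \<open>A point of projective space is a line through the origin, as a set of vectors.\<close>

definition proj_points :: "('k::field \<Rightarrow> 'v::ab_group_add \<Rightarrow> 'v) \<Rightarrow> 'v set \<Rightarrow> 'v set set"
  where "proj_points scale S = {range (\<lambda>c. scale c v) | v. v \<in> S \<and> v \<noteq> 0}"

definition zariski_proj :: "('k::field \<Rightarrow> 'v::ab_group_add \<Rightarrow> 'v) \<Rightarrow> 'v set topology"
  where "zariski_proj scale = topology_generated_by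
    {{l \<in> proj_points scale UNIV. \<exists>v\<in>l. f v \<noteq> 0} | f. \<exists>d. homogeneous_poly scale d f}"

text \<open>The subvariety with the given set \<open>Z\<close> of points: regular functions are locally
  quotients of homogeneous polynomials of the same degree. Linear functionals on a subspace extend
  to the ambient space, so for \<open>Z = proj_points scale S\<close> with a subspace \<open>S\<close> this is the
  usual structure of the projective space of \<open>S\<close>, even if the ambient space is
  infinite-dimensional.\<close>

definition proj_subvariety ::
  "('k::field \<Rightarrow> 'v::ab_group_add \<Rightarrow> 'v) \<Rightarrow> 'v set set \<Rightarrow> ('v set, 'k) fspace"
  where "proj_subvariety scale Z =
    \<lparr>ztop = subtopology (zariski_proj scale) Z,
     reg = (\<lambda>U f. \<forall>l\<in>U. \<exists>N d g h.
       openin (subtopology (zariski_proj scale) Z) N \<and> l \<in> N \<and> N \<subseteq> U \<and>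
       homogeneous_poly scale d g \<and> homogeneous_poly scale d h \<and>
       (\<forall>m\<in>N. \<forall>v\<in>m - {0}. h v \<noteq> 0 \<and> f m = g v / h v))\<rparr>"

abbreviation proj_space ::
  "('k::field \<Rightarrow> 'v::ab_group_add \<Rightarrow> 'v) \<Rightarrow> 'v set \<Rightarrow> ('v set, 'k) fspace"
  where "proj_space scale S \<equiv> proj_subvariety scale (proj_points scale S)"

definition proj_action :: "('g \<Rightarrow> 'v \<Rightarrow> 'v) \<Rightarrow> 'g \<Rightarrow> 'v set \<Rightarrow> 'v set"
  where "proj_action \<rho> g l = \<rho> g ` l"

definition linear_representation ::
  "('g, 'm) monoid_scheme \<Rightarrow> ('k::field \<Rightarrow> 'v::ab_group_add \<Rightarrow> 'v) \<Rightarrow> 'v set \<Rightarrow>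
    ('g \<Rightarrow> 'v \<Rightarrow> 'v) \<Rightarrow> bool"
  where "linear_representation G scale S \<rho> \<longleftrightarrow>
    module.subspace scale S \<and>
    (\<forall>g\<in>carrier G. \<rho> g ` S \<subseteq> S \<and>
      (\<forall>v\<in>S. \<forall>w\<in>S. \<rho> g (v + w) = \<rho> g v + \<rho> g w) \<and>
      (\<forall>c. \<forall>v\<in>S. \<rho> g (scale c v) = scale c (\<rho> g v))) \<and>
    (\<forall>v\<in>S. \<rho> \<one>\<^bsub>G\<^esub> v = v) \<and>
    (\<forall>g\<in>carrier G. \<forall>h\<in>carrier G. \<forall>v\<in>S. \<rho> (g \<otimes>\<^bsub>G\<^esub> h) v = \<rho> g (\<rho> h v))"

text \<open>The standard space \<open>k\<^sup>n\<close>, as the sequences that vanish from index \<open>n\<close> on.\<close>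

definition coord_scale :: "'k::field \<Rightarrow> (nat \<Rightarrow> 'k) \<Rightarrow> nat \<Rightarrow> 'k"
  where "coord_scale c x = (\<lambda>i. c * x i)"

definition coord_space :: "nat \<Rightarrow> (nat \<Rightarrow> 'k::field) set"
  where "coord_space n = {x. \<forall>i\<ge>n. x i = 0}"

text \<open>Every finite-dimensional representation is isomorphic to one on some \<open>k\<^sup>n\<close>, so
  the linear representation \<open>V'\<close> is taken there; quantifying over the type of its vectors
  is not possible.\<close>

definition linearizable ::
  "('g, 'm) monoid_scheme \<Rightarrow> ('g \<Rightarrow> 'a \<Rightarrow> 'a) \<Rightarrow> ('a, 'k::field) fspace \<Rightarrow> bool"
  where "linearizable G act X \<longleftrightarrow>
    regular_action G act X \<and> generically_free G act X \<and>
    (\<exists>n \<rho>'. linear_representation G (coord_scale :: 'k \<Rightarrow> _) (coord_space n) \<rho>' \<and>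
      equivariantly_birational G
        (proj_action \<rho>') (proj_space (coord_scale :: 'k \<Rightarrow> _) (coord_space n)) act X)"

definition stably_linearizable ::
  "('g, 'm) monoid_scheme \<Rightarrow> ('g \<Rightarrow> 'a \<Rightarrow> 'a) \<Rightarrow> ('a, 'k::field) fspace \<Rightarrow> bool"
  where "stably_linearizable G act X \<longleftrightarrow>
    (\<exists>m. linearizable G (\<lambda>g (x, y). (act g x, y))
      (product_fspace X (proj_space (coord_scale :: 'k \<Rightarrow> _) (coord_space (m + 1)))))"

text \<open>The symmetric bilinear form with \<open>q v = polar q v v\<close>. With this normalization the
  quadratic form \<open>q\<close> on a hyperbolic subspace has the matrix with identity blocks off the
  diagonal.\<close>

definition polar :: "('v::ab_group_add \<Rightarrow> 'k::field) \<Rightarrow> 'v \<Rightarrow> 'v \<Rightarrow> 'k"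
  where "polar q v w = (q (v + w) - q v - q w) / 2"

definition quadratic_form ::
  "('k::field \<Rightarrow> 'v::ab_group_add \<Rightarrow> 'v) \<Rightarrow> ('v \<Rightarrow> 'k) \<Rightarrow> bool"
  where "quadratic_form scale q \<longleftrightarrow>
    (\<forall>c v. q (scale c v) = c\<^sup>2 * q v) \<and>
    (\<forall>v. Vector_Spaces.linear scale (*) (polar q v))"

definition nondegenerate :: "('v::ab_group_add \<Rightarrow> 'k::field) \<Rightarrow> bool"
  where "nondegenerate q \<longleftrightarrow> (\<forall>v. (\<forall>w. polar q v w = 0) \<longrightarrow> v = 0)"

definition invariant_form ::
  "('g, 'm) monoid_scheme \<Rightarrow> ('g \<Rightarrow> 'v \<Rightarrow> 'v) \<Rightarrow> ('v \<Rightarrow> 'k) \<Rightarrow> bool"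
  where "invariant_form G \<rho> q \<longleftrightarrow> (\<forall>g\<in>carrier G. \<forall>v. q (\<rho> g v) = q v)"

definition isotropic_subspace ::
  "('g, 'm) monoid_scheme \<Rightarrow> ('k::field \<Rightarrow> 'v::ab_group_add \<Rightarrow> 'v) \<Rightarrow>
    ('g \<Rightarrow> 'v \<Rightarrow> 'v) \<Rightarrow> ('v \<Rightarrow> 'k) \<Rightarrow> 'v set \<Rightarrow> bool"
  where "isotropic_subspace G scale \<rho> q W \<longleftrightarrow>
    module.subspace scale W \<and> (\<forall>g\<in>carrier G. \<rho> g ` W \<subseteq> W) \<and> (\<forall>w\<in>W. q w = 0)"

definition dual_space ::
  "('k::field \<Rightarrow> 'v::ab_group_add \<Rightarrow> 'v) \<Rightarrow> 'v set \<Rightarrow> ('v \<Rightarrow> 'k) set"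
  where "dual_space scale W =
    {\<alpha> \<in> extensional W. (\<forall>v\<in>W. \<forall>w\<in>W. \<alpha> (v + w) = \<alpha> v + \<alpha> w) \<and>
      (\<forall>c. \<forall>w\<in>W. \<alpha> (scale c w) = c * \<alpha> w)}"

definition dual_action ::
  "('g, 'm) monoid_scheme \<Rightarrow> ('g \<Rightarrow> 'v \<Rightarrow> 'v) \<Rightarrow> 'v set \<Rightarrow> 'g \<Rightarrow> ('v \<Rightarrow> 'k) \<Rightarrow> 'v \<Rightarrow> 'k"
  where "dual_action G \<rho> W g \<alpha> = restrict (\<lambda>w. \<alpha> (\<rho> (inv\<^bsub>G\<^esub> g) w)) W"

text \<open>The identification of \<open>W'\<close> with the dual representation of \<open>W\<close> is \<open>\<theta>\<close>; it
  is linear because it is given by the bilinear form.\<close>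

definition hyperbolic_pair ::
  "('g, 'm) monoid_scheme \<Rightarrow> ('k::field \<Rightarrow> 'v::ab_group_add \<Rightarrow> 'v) \<Rightarrow>
    ('g \<Rightarrow> 'v \<Rightarrow> 'v) \<Rightarrow> ('v \<Rightarrow> 'k) \<Rightarrow> 'v set \<Rightarrow> 'v set \<Rightarrow> bool"
  where "hyperbolic_pair G scale \<rho> q W W' \<longleftrightarrow>
    isotropic_subspace G scale \<rho> q W \<and> isotropic_subspace G scale \<rho> q W' \<and>
    (\<exists>\<theta>. bij_betw \<theta> W' (dual_space scale W) \<and>
      (\<forall>g\<in>carrier G. \<forall>f\<in>W'. \<theta> (\<rho> g f) = dual_action G \<rho> W g (\<theta> f)) \<and>
      (\<forall>w\<in>W. \<forall>f\<in>W'. polar q w f = \<theta> f w))"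

definition sum_subspace :: "'v::ab_group_add set \<Rightarrow> 'v set \<Rightarrow> 'v set"
  where "sum_subspace A B = {a + b | a b. a \<in> A \<and> b \<in> B}"

definition orthogonal_complement :: "('v::ab_group_add \<Rightarrow> 'k::field) \<Rightarrow> 'v set \<Rightarrow> 'v set"
  where "orthogonal_complement q A = {v. \<forall>a\<in>A. polar q v a = 0}"

definition quadric ::
  "('k::field \<Rightarrow> 'v::ab_group_add \<Rightarrow> 'v) \<Rightarrow> ('v \<Rightarrow> 'k) \<Rightarrow> ('v set, 'k) fspace"
  where "quadric scale q =
    proj_subvariety scale {l \<in> proj_points scale UNIV. \<forall>v\<in>l. q v = 0}"

end

theory Submission
  imports Defs "HOL-Library.Product_Plus" "Jordan_Normal_Form.Determinant"
begin

text \<open>Let \<open>U = W' \<oplus> H\<^sub>W\<^sup>\<bottom>\<close>; this is the orthogonal complement of \<open>W'\<close>, and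
\<open>V = W \<oplus> U\<close>. On \<open>w + u\<close> the form has the value \<open>2 q(w, u) + q(u)\<close>, so the projection of the quadric
\<open>X\<close> from \<open>P(W)\<close> to \<open>P(U)\<close> has affine hyperplanes of \<open>W\<close> as its general fibres. If \<open>G\<close> acts
generically freely on \<open>P(U)\<close>, this affine bundle can be trivialized equivariantly. This is an instance of
the no-name lemma, and it has an explicit form. Take a polynomial \<open>f\<close> with \<open>f(v\<^sub>0) = 1\<close> that vanishes
at \<open>g v\<^sub>0\<close> for all \<open>g \<noteq> 1\<close>, where \<open>v\<^sub>0\<close> has trivial stabilizer in projective space, and put
\<open>A\<^sub>v = (\<Sum>g. f(g\<inverse>v) g) / (\<Sum>g. f(g\<inverse>v))\<close>. This operator on \<open>V\<close> depends only on the line of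
\<open>v\<close>, preserves all invariant subspaces, is invertible for general \<open>v\<close> because it is the identity at
\<open>v\<^sub>0\<close>, and satisfies \<open>A\<^bsub>gv\<^esub> = g A\<^sub>v\<close> (\<open>frame_rho\<close>, \<open>frame_exists\<close>).

For the first claim, substitute \<open>w = A\<^sub>u y\<close> in the equation of \<open>X\<close>. It becomes a linear equation for
\<open>y \<in> W\<close> with \<open>G\<close>-invariant coefficients. Fix \<open>w\<^sub>0 \<in> W\<close> and a complement \<open>C\<close> of its line in \<open>W\<close>; the
equation determines the coefficient of \<open>w\<^sub>0\<close> in \<open>y\<close> from the component \<open>c \<in> C\<close> and from \<open>u\<close>. This is a
birational map from \<open>P(C \<oplus> U)\<close> to \<open>X\<close>, equivariant for the trivial action on \<open>C\<close>
(\<open>linearizable_quadric\<close>).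

For the second claim, \<open>v\<^sub>0\<close> can be taken in \<open>X\<close>, so \<open>A\<close> is invertible at
general points of \<open>X\<close> and of \<open>P(V)\<close>. The map
\<open>(x, y) \<mapsto> (x, A\<^sub>x y)\<close> identifies \<open>X \<times> P(V)\<close> with trivial action on \<open>P(V)\<close> and the same product with the
diagonal action. Over \<open>v \<in> P(V)\<close>, the operator \<open>A\<^sub>v\<close> in turn identifies \<open>X\<close> with the
quadric \<open>q(A\<^sub>v y) = 0\<close>, and the resulting family of quadrics has \<open>G\<close> acting on the base only. Every member
passes through the constant point \<open>w\<^sub>0\<close>, because \<open>A\<^sub>v w\<^sub>0\<close> lies in \<open>W\<close>. Stereographic projection from
\<open>w\<^sub>0\<close> makes the family birational to \<open>P(C \<oplus> V)\<close>, where now \<open>C\<close> is a complement of a hyperbolic plane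
containing \<open>w\<^sub>0\<close>, with trivial action (\<open>stably_linearizable_quadric\<close>).

A space \<open>W'\<close> exists because \<open>W\<close> has an equivariant projection \<open>p\<close>: if \<open>p\<^sup>T\<close> is its adjoint, the range of
\<open>p\<^sup>T - p p\<^sup>T / 2\<close> is isotropic and dual to \<open>W\<close> (\<open>hyperbolic_pair_exists\<close>). Positive dimension of \<open>X\<close>
enters through irreducibility, which makes nonempty open sets dense (\<open>irreducible_quadric\<close>,
\<open>tangent_of_positive_dimension\<close>).

The geometric foundations are these. The regular functions of a subvariety of projective space, or of a
product, form a sheaf of rings in which nonvanishing functions are invertible (\<open>fspace_ring\<close>). A map into
projective space is regular if it lifts locally to a vector with regular coordinates
(\<open>regular_map_to_projective\<close>). By Cramer's rule, inverting a regular family of operators gives a regular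
family (\<open>vreg_inv\<close>). With these facts, formulas in \<open>A\<^sub>v\<close> and its inverse define regular maps by inspection.\<close>

section \<open>Spaces with functions\<close>

text \<open>The axioms that both projective subvarieties and products satisfy. They suffice to check that maps given by
formulas are regular.\<close>

locale fspace_ring =
  fixes X :: "('a, 'k::field) fspace"
  assumes reg_cong: "\<lbrakk>reg X U f; \<And>x. x \<in> U \<Longrightarrow> f x = g x\<rbrakk> \<Longrightarrow> reg X U g"
    and reg_restrict: "\<lbrakk>reg X U f; openin (ztop X) U'; U' \<subseteq> U\<rbrakk> \<Longrightarrow> reg X U' f"
    and reg_local: "(\<And>x. x \<in> U \<Longrightarrow> \<exists>N. openin (ztop X) N \<and> x \<in> N \<and> N \<subseteq> U \<and> reg X N f) \<Longrightarrow> reg X U f"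
    and reg_const: "openin (ztop X) U \<Longrightarrow> reg X U (\<lambda>_. c)"
    and reg_add: "\<lbrakk>reg X U f; reg X U g\<rbrakk> \<Longrightarrow> reg X U (\<lambda>x. f x + g x)"
    and reg_mult: "\<lbrakk>reg X U f; reg X U g\<rbrakk> \<Longrightarrow> reg X U (\<lambda>x. f x * g x)"
    and reg_inverse: "\<lbrakk>reg X U f; \<And>x. x \<in> U \<Longrightarrow> f x \<noteq> 0\<rbrakk> \<Longrightarrow> reg X U (\<lambda>x. inverse (f x))"
    and open_nonzero: "\<lbrakk>openin (ztop X) U; reg X U f\<rbrakk> \<Longrightarrow> openin (ztop X) {x \<in> U. f x \<noteq> 0}"
begin

lemma reg_sum:
  assumes "openin (ztop X) U" "\<And>i. i \<in> I \<Longrightarrow> reg X U (f i)"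
  shows "reg X U (\<lambda>x. \<Sum>i\<in>I. f i x)"
  using assms(2) by (induction I rule: infinite_finite_induct) (auto intro: reg_const assms(1) reg_add)

lemma reg_prod:
  assumes "openin (ztop X) U" "\<And>i. i \<in> I \<Longrightarrow> reg X U (f i)"
  shows "reg X U (\<lambda>x. \<Prod>i\<in>I. f i x)"
  using assms(2) by (induction I rule: infinite_finite_induct) (auto intro: reg_const assms(1) reg_mult)

lemma reg_cmult: "\<lbrakk>openin (ztop X) U; reg X U f\<rbrakk> \<Longrightarrow> reg X U (\<lambda>x. c * f x)"
  by (intro reg_mult reg_const)

lemma reg_minus: "\<lbrakk>openin (ztop X) U; reg X U f\<rbrakk> \<Longrightarrow> reg X U (\<lambda>x. - f x)"
  using reg_cmult[of U f "-1"] by simp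

lemma reg_diff: "\<lbrakk>openin (ztop X) U; reg X U f; reg X U g\<rbrakk> \<Longrightarrow> reg X U (\<lambda>x. f x - g x)"
  using reg_add[of U f "\<lambda>x. - g x"] reg_minus[of U g] by simp

lemma reg_divide:
  "\<lbrakk>reg X U f; reg X U g; \<And>x. x \<in> U \<Longrightarrow> g x \<noteq> 0\<rbrakk> \<Longrightarrow> reg X U (\<lambda>x. f x / g x)"
  unfolding divide_inverse by (intro reg_mult reg_inverse)

end

subsection \<open>Linear maps and vector-valued regular functions\<close>

lemma linear_addD: "Vector_Spaces.linear s1 s2 f \<Longrightarrow> f (x + y) = f x + f y"
  by (simp add: Vector_Spaces.linear_iff)

lemma linear_scaleD: "Vector_Spaces.linear s1 s2 f \<Longrightarrow> f (s1 c x) = s2 c (f x)"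
  by (simp add: Vector_Spaces.linear_iff)

lemma linear_zeroD: "Vector_Spaces.linear s1 s2 f \<Longrightarrow> f 0 = 0"
  using linear_addD[of s1 s2 f 0 0] by simp

lemma linear_diffD: "Vector_Spaces.linear s1 s2 f \<Longrightarrow> f (x - y) = f x - f y"
  using linear_addD[of s1 s2 f "x - y" y] by (simp add: algebra_simps)

lemma linear_uminusD: "Vector_Spaces.linear s1 s2 f \<Longrightarrow> f (- x) = - f x"
  using linear_diffD[of s1 s2 f 0 x] by (simp add: linear_zeroD)

lemma linear_sumD: "Vector_Spaces.linear s1 s2 f \<Longrightarrow> f (\<Sum>i\<in>I. x i) = (\<Sum>i\<in>I. f (x i))"
  by (induction I rule: infinite_finite_induct) (auto simp: linear_zeroD linear_addD)

lemmas linear_simps = linear_addD linear_scaleD linear_zeroD linear_diffD linear_uminusD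

lemma linear_composeD:
  "\<lbrakk>Vector_Spaces.linear s1 s2 f; Vector_Spaces.linear s2 s3 g\<rbrakk> \<Longrightarrow> Vector_Spaces.linear s1 s3 (\<lambda>x. g (f x))"
  by (simp add: Vector_Spaces.linear_iff)

text \<open>A vector-valued function is regular if all its linear coordinates are; testing with all functionals avoids the
choice of a basis and makes sense in infinite dimension as well.\<close>

definition vreg ::
  "('a, 'k::field) fspace \<Rightarrow> ('k \<Rightarrow> 'v::ab_group_add \<Rightarrow> 'v) \<Rightarrow> 'a set \<Rightarrow> ('a \<Rightarrow> 'v) \<Rightarrow> bool"
  where "vreg X scale N Y \<longleftrightarrow> (\<forall>\<alpha>. Vector_Spaces.linear scale (*) \<alpha> \<longrightarrow> reg X N (\<lambda>x. \<alpha> (Y x)))"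

lemma vregD: "\<lbrakk>vreg X scale N Y; Vector_Spaces.linear scale (*) \<alpha>\<rbrakk> \<Longrightarrow> reg X N (\<lambda>x. \<alpha> (Y x))"
  by (simp add: vreg_def)

lemma vreg_linear:
  "\<lbrakk>vreg X s1 N Y; Vector_Spaces.linear s1 s2 L\<rbrakk> \<Longrightarrow> vreg X s2 N (\<lambda>x. L (Y x))"
  unfolding vreg_def by (auto dest: linear_composeD)

context fspace_ring
begin

lemma vreg_cong: "\<lbrakk>vreg X scale N Y; \<And>x. x \<in> N \<Longrightarrow> Y x = Y' x\<rbrakk> \<Longrightarrow> vreg X scale N Y'"
  unfolding vreg_def by (auto intro: reg_cong)

lemma vreg_restrict: "\<lbrakk>vreg X scale N Y; openin (ztop X) N'; N' \<subseteq> N\<rbrakk> \<Longrightarrow> vreg X scale N' Y"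
  unfolding vreg_def by (auto intro: reg_restrict)

lemma vreg_const: "openin (ztop X) N \<Longrightarrow> vreg X scale N (\<lambda>_. y)"
  unfolding vreg_def by (auto intro: reg_const)

lemma vreg_add:
  "\<lbrakk>vreg X scale N Y; vreg X scale N Y'\<rbrakk> \<Longrightarrow> vreg X scale N (\<lambda>x. Y x + Y' x)"
  unfolding vreg_def by (auto simp: linear_addD intro: reg_add)

lemma vreg_scale:
  "\<lbrakk>reg X N f; vreg X scale N Y\<rbrakk> \<Longrightarrow> vreg X scale N (\<lambda>x. scale (f x) (Y x))"
  unfolding vreg_def by (auto simp: linear_scaleD intro: reg_mult)

lemma vreg_diff:
  "\<lbrakk>openin (ztop X) N; vreg X scale N Y; vreg X scale N Y'\<rbrakk> \<Longrightarrow> vreg X scale N (\<lambda>x. Y x - Y' x)"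
  unfolding vreg_def by (auto simp: linear_diffD intro: reg_diff)

lemma vreg_sum:
  assumes "openin (ztop X) N" "\<And>i. i \<in> I \<Longrightarrow> vreg X scale N (Y i)"
  shows "vreg X scale N (\<lambda>x. \<Sum>i\<in>I. Y i x)"
  using assms(2)
  by (induction I rule: infinite_finite_induct) (auto intro: vreg_const assms(1) vreg_add)

text \<open>Homogeneous polynomial functions are generated by the linear functionals, so regularity propagates along
their inductive definition.\<close>

lemma reg_homogeneous_poly:
  assumes "homogeneous_poly scale d p" "openin (ztop X) N" "vreg X scale N Y"
  shows "reg X N (\<lambda>x. p (Y x))"
  using assms(1)
  by induction (auto intro: reg_const reg_add reg_mult vregD assms(2,3))

end

subsection \<open>Regular maps\<close>

lemma regular_mapI:
  assumes "\<phi> ` U \<subseteq> V"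
    "\<And>O'. \<lbrakk>openin (ztop Y) O'; O' \<subseteq> V\<rbrakk> \<Longrightarrow> openin (ztop X) {x \<in> U. \<phi> x \<in> O'}"
    "\<And>O' f. \<lbrakk>openin (ztop Y) O'; O' \<subseteq> V; reg Y O' f\<rbrakk> \<Longrightarrow> reg X {x \<in> U. \<phi> x \<in> O'} (\<lambda>x. f (\<phi> x))"
  shows "regular_map X U Y V \<phi>"
  using assms unfolding regular_map_def comp_def by blast

lemma regular_map_open:
  "\<lbrakk>regular_map X U Y V \<phi>; openin (ztop Y) O'; O' \<subseteq> V\<rbrakk> \<Longrightarrow> openin (ztop X) {x \<in> U. \<phi> x \<in> O'}"
  unfolding regular_map_def by blast

lemma regular_map_reg:
  "\<lbrakk>regular_map X U Y V \<phi>; openin (ztop Y) O'; O' \<subseteq> V; reg Y O' f\<rbrakk>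
    \<Longrightarrow> reg X {x \<in> U. \<phi> x \<in> O'} (\<lambda>x. f (\<phi> x))"
  unfolding regular_map_def comp_def by blast

lemma regular_map_vreg:
  "\<lbrakk>regular_map X U Y V \<phi>; openin (ztop Y) O'; O' \<subseteq> V; vreg Y scale O' \<sigma>\<rbrakk>
    \<Longrightarrow> vreg X scale {x \<in> U. \<phi> x \<in> O'} (\<lambda>x. \<sigma> (\<phi> x))"
  unfolding vreg_def using regular_map_reg[of X U Y V \<phi> O'] by blast

lemma regular_map_compose:
  assumes "regular_map X U Y V \<phi>" "regular_map Y V Z W \<psi>"
  shows "regular_map X U Z W (\<lambda>x. \<psi> (\<phi> x))"
proof (rule regular_mapI)
  have im: "\<phi> ` U \<subseteq> V" "\<psi> ` V \<subseteq> W" using assms by (auto simp: regular_map_def)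
  then show "(\<lambda>x. \<psi> (\<phi> x)) ` U \<subseteq> W" by blast
  fix O' assume O': "openin (ztop Z) O'" "O' \<subseteq> W"
  have eq: "{x \<in> U. \<phi> x \<in> {y \<in> V. \<psi> y \<in> O'}} = {x \<in> U. \<psi> (\<phi> x) \<in> O'}" using im by auto
  have op: "openin (ztop Y) {y \<in> V. \<psi> y \<in> O'}" using regular_map_open[OF assms(2) O'] .
  show "openin (ztop X) {x \<in> U. \<psi> (\<phi> x) \<in> O'}"
    using regular_map_open[OF assms(1) op] eq by auto
  fix f assume f: "reg Z O' f"
  show "reg X {x \<in> U. \<psi> (\<phi> x) \<in> O'} (\<lambda>x. f (\<psi> (\<phi> x)))"
    using regular_map_reg[OF assms(1) op _ regular_map_reg[OF assms(2) O' f]] eq by auto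
qed

lemma regular_map_codomain:
  "\<lbrakk>regular_map X U Y V \<phi>; V' \<subseteq> V; \<phi> ` U \<subseteq> V'\<rbrakk> \<Longrightarrow> regular_map X U Y V' \<phi>"
  unfolding regular_map_def by blast

lemma (in fspace_ring) regular_map_restrict:
  assumes "regular_map X U Y V \<phi>" "openin (ztop X) U'" "U' \<subseteq> U"
  shows "regular_map X U' Y V \<phi>"
proof (rule regular_mapI)
  show "\<phi> ` U' \<subseteq> V" using assms by (auto simp: regular_map_def)
  fix O' assume O': "openin (ztop Y) O'" "O' \<subseteq> V"
  have eq: "{x \<in> U'. \<phi> x \<in> O'} = {x \<in> U. \<phi> x \<in> O'} \<inter> U'" using assms(3) by auto
  show op: "openin (ztop X) {x \<in> U'. \<phi> x \<in> O'}"
    unfolding eq using regular_map_open[OF assms(1) O'] assms(2) by (rule openin_Int)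
  fix f assume "reg Y O' f"
  from regular_map_reg[OF assms(1) O' this] op
  show "reg X {x \<in> U'. \<phi> x \<in> O'} (\<lambda>x. f (\<phi> x))"
    by (rule reg_restrict) (use assms(3) in auto)
qed

section \<open>Projective varieties\<close>

definition line :: "('k::field \<Rightarrow> 'v::ab_group_add \<Rightarrow> 'v) \<Rightarrow> 'v \<Rightarrow> 'v set"
  where "line scale v = range (\<lambda>c. scale c v)"

lemma proj_pointsE:
  assumes "l \<in> proj_points scale S"
  obtains v where "l = line scale v" "v \<in> S" "v \<noteq> 0"
  using assms by (auto simp: proj_points_def line_def)

lemma line_in_proj_points: "\<lbrakk>v \<in> S; v \<noteq> 0\<rbrakk> \<Longrightarrow> line scale v \<in> proj_points scale S"
  by (auto simp: proj_points_def line_def)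

lemma proj_points_mono: "S \<subseteq> T \<Longrightarrow> proj_points scale S \<subseteq> proj_points scale T"
  by (auto simp: proj_points_def)

context vector_space
begin

lemma line_self: "v \<in> line scale v"
  unfolding line_def by (metis rangeI scale_one)

lemma line_scale:
  assumes "c \<noteq> 0"
  shows "line scale (scale c v) = line scale v"
proof -
  have "(\<lambda>a. scale a (scale c v)) = (\<lambda>a. scale a v) \<circ> (\<lambda>a. a * c)" by (simp add: fun_eq_iff)
  moreover have "surj (\<lambda>a. a * c)"
    by (rule surjI[of _ "\<lambda>a. a / c"]) (use assms in simp)
  ultimately show ?thesis unfolding line_def by (metis image_comp)
qed

lemma line_eq_iff:
  assumes v: "v \<noteq> 0"
  shows "line scale v = line scale w \<longleftrightarrow> (\<exists>c. c \<noteq> 0 \<and> v = scale c w)"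
proof
  assume "line scale v = line scale w"
  then obtain c where "v = scale c w" using line_self[of v] by (auto simp: line_def)
  moreover from this v have "c \<noteq> 0" by auto
  ultimately show "\<exists>c. c \<noteq> 0 \<and> v = scale c w" by (intro exI[of _ c]) simp
next
  assume "\<exists>c. c \<noteq> 0 \<and> v = scale c w"
  then obtain c where c: "c \<noteq> 0" "v = scale c w" by (elim exE conjE)
  from line_scale[OF c(1)] show "line scale v = line scale w" by (simp add: c(2))
qed

lemma proj_pointD:
  assumes "l \<in> proj_points scale S" "v \<in> l" "v \<noteq> 0"
  shows "l = line scale v"
proof -
  obtain u where u: "l = line scale u" "u \<noteq> 0" using assms(1) by (rule proj_pointsE)
  then obtain c where c: "v = scale c u" using assms(2) by (auto simp: line_def)
  with assms(3) have "c \<noteq> 0" by auto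
  from line_scale[OF this, of u] show ?thesis by (simp only: c u)
qed

lemma proj_point_rep:
  assumes "l \<in> proj_points scale S"
  obtains v where "v \<in> l" "v \<noteq> 0"
proof -
  obtain v where "l = line scale v" "v \<noteq> 0" using assms by (rule proj_pointsE)
  then show ?thesis using line_self[of v] by (intro that[of v]) auto
qed

lemma line_in_subspace_points:
  assumes "subspace S" "v \<noteq> 0"
  shows "line scale v \<in> proj_points scale S \<longleftrightarrow> v \<in> S"
proof
  assume "line scale v \<in> proj_points scale S"
  then obtain u where "line scale v = line scale u" "u \<in> S" by (auto elim: proj_pointsE)
  with assms show "v \<in> S" by (auto simp: line_eq_iff intro: subspace_scale)
qed (use assms in \<open>auto intro: line_in_proj_points\<close>)

lemma vector_space_pair_field: "vector_space_pair scale ((*) :: 'a \<Rightarrow> 'a \<Rightarrow> 'a)"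
  by unfold_locales (auto simp: algebra_simps)

lemma separating_functional:
  assumes "v \<noteq> 0"
  obtains \<alpha> where "Vector_Spaces.linear scale (*) \<alpha>" "\<alpha> v = 1"
proof -
  interpret vector_space_pair scale "(*) :: 'a \<Rightarrow> 'a \<Rightarrow> 'a" by (rule vector_space_pair_field)
  have "\<exists>\<alpha>. Vector_Spaces.linear scale (*) \<alpha> \<and> (\<forall>x\<in>{v}. \<alpha> x = 1)"
    by (rule linear_independent_extend) (use assms in auto)
  then show ?thesis using that by auto
qed

lemma homogeneous_poly_scale:
  assumes "homogeneous_poly scale d p"
  shows "p (scale c v) = c ^ d * p v"
  using assms by induction (auto simp: linear_scaleD algebra_simps power_add)

text \<open>By homogeneity, vanishing at one nonzero vector of a line is vanishing on the whole line.\<close>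

lemma homogeneous_poly_line:
  assumes "homogeneous_poly scale d p" "l \<in> proj_points scale S" "v \<in> l" "v \<noteq> 0"
  shows "(\<exists>w\<in>l. p w \<noteq> 0) \<longleftrightarrow> p v \<noteq> 0"
proof -
  have l: "l = line scale v" by (rule proj_pointD[OF assms(2-4)])
  show ?thesis using assms(3) unfolding l line_def
    by (auto simp: homogeneous_poly_scale[OF assms(1)])
qed

lemma homogeneous_poly_prod:
  assumes "finite I" "\<And>i. i \<in> I \<Longrightarrow> homogeneous_poly scale 1 (f i)"
  shows "homogeneous_poly scale (card I) (\<lambda>v. \<Prod>i\<in>I. f i v)"
  using assms
proof (induction I rule: finite_induct)
  case empty
  show ?case using homogeneous_poly.const[of scale 1] by simp
next
  case (insert i I)
  then show ?case using homogeneous_poly.mult[of scale 1 "f i" "card I" "\<lambda>v. \<Prod>i\<in>I. f i v"] by auto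
qed

lemma topspace_zariski: "topspace (zariski_proj scale) = proj_points scale UNIV"
proof -
  have "\<exists>p. (\<exists>d. homogeneous_poly scale d p) \<and> (\<exists>v\<in>l. p v \<noteq> 0)"
    if l: "l \<in> proj_points scale UNIV" for l
  proof -
    have "homogeneous_poly scale 0 (\<lambda>_. 1)" by (rule homogeneous_poly.const)
    moreover obtain v where "v \<in> l" "v \<noteq> 0" using l by (rule proj_point_rep)
    ultimately show ?thesis by (intro exI[of _ "\<lambda>_. 1"]) auto
  qed
  note nonvanishing = this
  show ?thesis unfolding zariski_proj_def topology_generated_by_topspace
  proof (intro equalityI subsetI)
    fix l assume "l \<in> proj_points scale UNIV"
    moreover from nonvanishing[OF this] obtain p where "(\<exists>d. homogeneous_poly scale d p) \<and> (\<exists>v\<in>l. p v \<noteq> 0)"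
      by (rule exE)
    ultimately show "l \<in> \<Union> {{l \<in> proj_points scale UNIV. \<exists>v\<in>l. f v \<noteq> 0} |f. \<exists>d. homogeneous_poly scale d f}"
      by (intro UnionI[of "{l \<in> proj_points scale UNIV. \<exists>v\<in>l. p v \<noteq> 0}"] CollectI exI[of _ p] conjI) simp_all
  qed auto
qed

lemma open_basic:
  assumes "homogeneous_poly scale d p"
  shows "openin (zariski_proj scale) {l \<in> proj_points scale UNIV. \<exists>v\<in>l. p v \<noteq> 0}"
  unfolding zariski_proj_def by (rule topology_generated_by_Basis) (use assms in blast)

text \<open>The nonvanishing loci are closed under intersection, since those of two polynomials meet in that of their
product. So the subbase that defines the topology is a base.\<close>

lemma zariski_basis:
  assumes "openin (zariski_proj scale) T" "l \<in> T"
  obtains d p where "homogeneous_poly scale d p" "\<exists>v\<in>l. p v \<noteq> 0"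
    "{m \<in> proj_points scale UNIV. \<exists>v\<in>m. p v \<noteq> 0} \<subseteq> T"
proof -
  let ?D = "\<lambda>p. {m \<in> proj_points scale UNIV. \<exists>v\<in>m. p v \<noteq> 0}"
  have "\<exists>d p. homogeneous_poly scale d p \<and> l \<in> ?D p \<and> ?D p \<subseteq> T"
    if "generate_topology_on {?D p | p. \<exists>d. homogeneous_poly scale d p} T" "l \<in> T" for T
    using that
  proof induction
    case (Int A B)
    then obtain d p e r where *: "homogeneous_poly scale d p" "l \<in> ?D p" "?D p \<subseteq> A"
      "homogeneous_poly scale e r" "l \<in> ?D r" "?D r \<subseteq> B" by blast
    have "?D (\<lambda>v. p v * r v) \<subseteq> ?D p \<inter> ?D r" by auto
    moreover have "l \<in> ?D (\<lambda>v. p v * r v)"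
    proof -
      have l: "l \<in> proj_points scale UNIV" using * by auto
      then obtain v where v: "v \<in> l" "v \<noteq> 0" by (rule proj_point_rep)
      then have "p v \<noteq> 0" "r v \<noteq> 0"
        using homogeneous_poly_line[OF *(1) l v] homogeneous_poly_line[OF *(4) l v] * by auto
      then show ?thesis using l v by auto
    qed
    ultimately show ?case using homogeneous_poly.mult[OF *(1,4)] * by blast
  next
    case (UN K)
    then show ?case by blast
  qed auto
  then show ?thesis
    using assms that unfolding zariski_proj_def openin_topology_generated_by_iff by blast
qed

end

locale subvariety = vector_space scale
  for scale :: "'k::field \<Rightarrow> 'v::ab_group_add \<Rightarrow> 'v" +
  fixes Z :: "'v set set"
  assumes Z_points: "Z \<subseteq> proj_points scale UNIV"
begin

abbreviation "PZ \<equiv> proj_subvariety scale Z"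

lemma ztop_PZ: "ztop PZ = subtopology (zariski_proj scale) Z"
  by (simp add: proj_subvariety_def)

lemma points_PZ: "points PZ = Z"
  using Z_points by (auto simp: ztop_PZ topspace_zariski)

lemma reg_PZ:
  "reg PZ U f \<longleftrightarrow> (\<forall>l\<in>U. \<exists>N d g h. openin (ztop PZ) N \<and> l \<in> N \<and> N \<subseteq> U \<and>
       homogeneous_poly scale d g \<and> homogeneous_poly scale d h \<and>
       (\<forall>m\<in>N. \<forall>v\<in>m - {0}. h v \<noteq> 0 \<and> f m = g v / h v))"
  by (simp add: proj_subvariety_def)

lemma reg_PZE:
  assumes "reg PZ U f" "l \<in> U"
  obtains N d g h where "openin (ztop PZ) N" "l \<in> N" "N \<subseteq> U"
    "homogeneous_poly scale d g" "homogeneous_poly scale d h"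
    "\<forall>m\<in>N. \<forall>v\<in>m - {0}. h v \<noteq> 0 \<and> f m = g v / h v"
proof -
  from assms have "\<exists>N d g h. openin (ztop PZ) N \<and> l \<in> N \<and> N \<subseteq> U \<and>
       homogeneous_poly scale d g \<and> homogeneous_poly scale d h \<and>
       (\<forall>m\<in>N. \<forall>v\<in>m - {0}. h v \<noteq> 0 \<and> f m = g v / h v)"
    unfolding reg_PZ by (rule bspec)
  then show ?thesis by (elim exE conjE) (rule that)
qed

lemma open_nonvanishing:
  assumes "homogeneous_poly scale d p"
  shows "openin (ztop PZ) {l \<in> Z. \<exists>v\<in>l. p v \<noteq> 0}"
proof -
  have "{l \<in> Z. \<exists>v\<in>l. p v \<noteq> 0} = {l \<in> proj_points scale UNIV. \<exists>v\<in>l. p v \<noteq> 0} \<inter> Z"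
    using Z_points by auto
  then show ?thesis using open_basic[OF assms] unfolding ztop_PZ openin_subtopology by blast
qed

text \<open>A common neighbourhood for two regular functions.\<close>

lemma reg_PZE2:
  assumes f: "reg PZ U f" and f': "reg PZ U f'" and l: "l \<in> U"
  obtains N d a b d' a' b' where "openin (ztop PZ) N" "l \<in> N" "N \<subseteq> U"
    "homogeneous_poly scale d a" "homogeneous_poly scale d b"
    "homogeneous_poly scale d' a'" "homogeneous_poly scale d' b'"
    "\<forall>m\<in>N. \<forall>v\<in>m - {0}. b v \<noteq> 0 \<and> f m = a v / b v"
    "\<forall>m\<in>N. \<forall>v\<in>m - {0}. b' v \<noteq> 0 \<and> f' m = a' v / b' v"
proof -
  from f l obtain N d a b where n: "openin (ztop PZ) N" "l \<in> N" "N \<subseteq> U"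
    "homogeneous_poly scale d a" "homogeneous_poly scale d b"
    "\<forall>m\<in>N. \<forall>v\<in>m - {0}. b v \<noteq> 0 \<and> f m = a v / b v" by (rule reg_PZE)
  from f' l obtain N' d' a' b' where n': "openin (ztop PZ) N'" "l \<in> N'" "N' \<subseteq> U"
    "homogeneous_poly scale d' a'" "homogeneous_poly scale d' b'"
    "\<forall>m\<in>N'. \<forall>v\<in>m - {0}. b' v \<noteq> 0 \<and> f' m = a' v / b' v" by (rule reg_PZE)
  show ?thesis
    by (rule that[OF openin_Int[OF n(1) n'(1)] _ _ n(4,5) n'(4,5)])
      (use n(2,3,6) n'(2,6) in blast)+
qed

sublocale PZ: fspace_ring PZ
proof
  fix U f and g :: "'v set \<Rightarrow> 'k"
  assume f: "reg PZ U f" and eq: "\<And>x. x \<in> U \<Longrightarrow> f x = g x"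
  show "reg PZ U g" unfolding reg_PZ
  proof
    fix l assume "l \<in> U"
    with f obtain N d a b where *: "openin (ztop PZ) N" "l \<in> N" "N \<subseteq> U"
      "homogeneous_poly scale d a" "homogeneous_poly scale d b"
      "\<forall>m\<in>N. \<forall>v\<in>m - {0}. b v \<noteq> 0 \<and> f m = a v / b v" by (rule reg_PZE)
    have "\<forall>m\<in>N. \<forall>v\<in>m - {0}. b v \<noteq> 0 \<and> g m = a v / b v"
    proof (intro ballI)
      fix m v assume mv: "m \<in> N" "v \<in> m - {0}"
      then have "g m = f m" using *(3) eq[of m] by auto
      with *(6) mv show "b v \<noteq> 0 \<and> g m = a v / b v" by simp
    qed
    with * show "\<exists>N d a b. openin (ztop PZ) N \<and> l \<in> N \<and> N \<subseteq> U \<and> homogeneous_poly scale d a \<and>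
      homogeneous_poly scale d b \<and> (\<forall>m\<in>N. \<forall>v\<in>m - {0}. b v \<noteq> 0 \<and> g m = a v / b v)"
      by (intro exI[of _ N] exI[of _ d] exI[of _ a] exI[of _ b]) simp
  qed
next
  fix U U' f assume f: "reg PZ U f" and U': "openin (ztop PZ) U'" "U' \<subseteq> U"
  show "reg PZ U' f" unfolding reg_PZ
  proof
    fix l assume l: "l \<in> U'"
    from l U'(2) have "l \<in> U" by blast
    with f obtain N d a b where *: "openin (ztop PZ) N" "l \<in> N" "N \<subseteq> U"
      "homogeneous_poly scale d a" "homogeneous_poly scale d b"
      "\<forall>m\<in>N. \<forall>v\<in>m - {0}. b v \<noteq> 0 \<and> f m = a v / b v" by (rule reg_PZE)
    have "openin (ztop PZ) (N \<inter> U')" using *(1) U'(1) by (rule openin_Int)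
    with * l show "\<exists>N d a b. openin (ztop PZ) N \<and> l \<in> N \<and> N \<subseteq> U' \<and> homogeneous_poly scale d a \<and>
      homogeneous_poly scale d b \<and> (\<forall>m\<in>N. \<forall>v\<in>m - {0}. b v \<noteq> 0 \<and> f m = a v / b v)"
      by (intro exI[of _ "N \<inter> U'"] exI[of _ d] exI[of _ a] exI[of _ b]) auto
  qed
next
  fix U f
  assume loc: "\<And>x. x \<in> U \<Longrightarrow> \<exists>N. openin (ztop PZ) N \<and> x \<in> N \<and> N \<subseteq> U \<and> reg PZ N f"
  show "reg PZ U f" unfolding reg_PZ
  proof
    fix l assume "l \<in> U"
    with loc obtain M where M: "l \<in> M" "M \<subseteq> U" "reg PZ M f" by blast
    from M(3,1) obtain N d a b where *: "openin (ztop PZ) N" "l \<in> N" "N \<subseteq> M"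
      "homogeneous_poly scale d a" "homogeneous_poly scale d b"
      "\<forall>m\<in>N. \<forall>v\<in>m - {0}. b v \<noteq> 0 \<and> f m = a v / b v" by (rule reg_PZE)
    then show "\<exists>N d a b. openin (ztop PZ) N \<and> l \<in> N \<and> N \<subseteq> U \<and> homogeneous_poly scale d a \<and>
      homogeneous_poly scale d b \<and> (\<forall>m\<in>N. \<forall>v\<in>m - {0}. b v \<noteq> 0 \<and> f m = a v / b v)"
      using M(2) by (intro exI[of _ N] exI[of _ d] exI[of _ a] exI[of _ b]) auto
  qed
next
  fix U and c :: 'k assume "openin (ztop PZ) U"
  then show "reg PZ U (\<lambda>_. c)" unfolding reg_PZ
    using homogeneous_poly.const[of scale c] homogeneous_poly.const[of scale 1]
    by (intro ballI exI[of _ U] exI[of _ 0] exI[of _ "\<lambda>_. c"] exI[of _ "\<lambda>_. 1"]) auto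
next
  fix U f f' assume f: "reg PZ U f" and f': "reg PZ U f'"
  show "reg PZ U (\<lambda>x. f x + f' x)" unfolding reg_PZ
  proof
    fix l assume l: "l \<in> U"
    from f f' l obtain N d a b d' a' b' where *: "openin (ztop PZ) N" "l \<in> N" "N \<subseteq> U"
      "homogeneous_poly scale d a" "homogeneous_poly scale d b"
      "homogeneous_poly scale d' a'" "homogeneous_poly scale d' b'"
      "\<forall>m\<in>N. \<forall>v\<in>m - {0}. b v \<noteq> 0 \<and> f m = a v / b v"
      "\<forall>m\<in>N. \<forall>v\<in>m - {0}. b' v \<noteq> 0 \<and> f' m = a' v / b' v" by (rule reg_PZE2)
    have "homogeneous_poly scale (d + d') (\<lambda>v. b v * a' v)"
      "homogeneous_poly scale (d + d') (\<lambda>v. a v * b' v)"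
      by (intro homogeneous_poly.mult *)+
    then have "homogeneous_poly scale (d + d') (\<lambda>v. a v * b' v + b v * a' v)"
      by (intro homogeneous_poly.add)
    moreover have "homogeneous_poly scale (d + d') (\<lambda>v. b v * b' v)"
      by (intro homogeneous_poly.mult *)
    moreover have "b v * b' v \<noteq> 0 \<and> f m + f' m = (a v * b' v + b v * a' v) / (b v * b' v)"
      if "m \<in> N" "v \<in> m - {0}" for m v
    proof -
      have "b v \<noteq> 0" "f m = a v / b v" "b' v \<noteq> 0" "f' m = a' v / b' v" using *(8,9) that by simp_all
      then show ?thesis by (simp add: add_frac_eq mult.commute)
    qed
    ultimately show "\<exists>N d g h. openin (ztop PZ) N \<and> l \<in> N \<and> N \<subseteq> U \<and> homogeneous_poly scale d g \<and>
      homogeneous_poly scale d h \<and> (\<forall>m\<in>N. \<forall>v\<in>m - {0}. h v \<noteq> 0 \<and> f m + f' m = g v / h v)"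
      by (intro exI[of _ N] exI[of _ "d + d'"] exI[of _ "\<lambda>v. a v * b' v + b v * a' v"]
        exI[of _ "\<lambda>v. b v * b' v"] conjI ballI *(1-3)) simp_all
  qed
  show "reg PZ U (\<lambda>x. f x * f' x)" unfolding reg_PZ
  proof
    fix l assume l: "l \<in> U"
    from f f' l obtain N d a b d' a' b' where *: "openin (ztop PZ) N" "l \<in> N" "N \<subseteq> U"
      "homogeneous_poly scale d a" "homogeneous_poly scale d b"
      "homogeneous_poly scale d' a'" "homogeneous_poly scale d' b'"
      "\<forall>m\<in>N. \<forall>v\<in>m - {0}. b v \<noteq> 0 \<and> f m = a v / b v"
      "\<forall>m\<in>N. \<forall>v\<in>m - {0}. b' v \<noteq> 0 \<and> f' m = a' v / b' v" by (rule reg_PZE2)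
    have "b v * b' v \<noteq> 0 \<and> f m * f' m = (a v * a' v) / (b v * b' v)"
      if "m \<in> N" "v \<in> m - {0}" for m v
      using *(8,9) that by simp
    then show "\<exists>N d g h. openin (ztop PZ) N \<and> l \<in> N \<and> N \<subseteq> U \<and> homogeneous_poly scale d g \<and>
      homogeneous_poly scale d h \<and> (\<forall>m\<in>N. \<forall>v\<in>m - {0}. h v \<noteq> 0 \<and> f m * f' m = g v / h v)"
      by (intro exI[of _ N] exI[of _ "d + d'"] exI[of _ "\<lambda>v. a v * a' v"] exI[of _ "\<lambda>v. b v * b' v"]
        conjI ballI homogeneous_poly.mult *(1-7)) simp_all
  qed
next
  fix U f assume f: "reg PZ U f" and nz: "\<And>x. x \<in> U \<Longrightarrow> f x \<noteq> 0"
  show "reg PZ U (\<lambda>x. inverse (f x))" unfolding reg_PZ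
  proof
    fix l assume "l \<in> U"
    with f obtain N d a b where *: "openin (ztop PZ) N" "l \<in> N" "N \<subseteq> U"
      "homogeneous_poly scale d a" "homogeneous_poly scale d b"
      "\<forall>m\<in>N. \<forall>v\<in>m - {0}. b v \<noteq> 0 \<and> f m = a v / b v" by (rule reg_PZE)
    have "a v \<noteq> 0 \<and> inverse (f m) = b v / a v" if "m \<in> N" "v \<in> m - {0}" for m v
    proof -
      have "f m \<noteq> 0" using nz *(3) that(1) by blast
      moreover have "b v \<noteq> 0" "f m = a v / b v" using *(6) that by simp_all
      ultimately show ?thesis by simp
    qed
    with * show "\<exists>N d g h. openin (ztop PZ) N \<and> l \<in> N \<and> N \<subseteq> U \<and> homogeneous_poly scale d g \<and>
      homogeneous_poly scale d h \<and> (\<forall>m\<in>N. \<forall>v\<in>m - {0}. h v \<noteq> 0 \<and> inverse (f m) = g v / h v)"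
      by (intro exI[of _ N] exI[of _ d] exI[of _ b] exI[of _ a]) simp
  qed
next
  fix U f assume U: "openin (ztop PZ) U" and f: "reg PZ U f"
  show "openin (ztop PZ) {x \<in> U. f x \<noteq> 0}"
  proof (subst openin_subopen, safe)
    fix l assume l: "l \<in> U" "f l \<noteq> 0"
    from f l(1) obtain N d a b where *: "openin (ztop PZ) N" "l \<in> N" "N \<subseteq> U"
      "homogeneous_poly scale d a" "homogeneous_poly scale d b"
      "\<forall>m\<in>N. \<forall>v\<in>m - {0}. b v \<noteq> 0 \<and> f m = a v / b v" by (rule reg_PZE)
    have "N \<subseteq> Z" using openin_subset[OF *(1)] points_PZ by simp
    have iff: "f m \<noteq> 0 \<longleftrightarrow> (\<exists>v\<in>m. a v \<noteq> 0)" if "m \<in> N" for m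
    proof -
      have m: "m \<in> proj_points scale UNIV" using that \<open>N \<subseteq> Z\<close> Z_points by auto
      then obtain v where v: "v \<in> m" "v \<noteq> 0" by (rule proj_point_rep)
      show ?thesis using homogeneous_poly_line[OF *(4) m v] *(6) that v by auto
    qed
    have "openin (ztop PZ) (N \<inter> {l \<in> Z. \<exists>v\<in>l. a v \<noteq> 0})"
      using *(1) open_nonvanishing[OF *(4)] by (rule openin_Int)
    then show "\<exists>T. openin (ztop PZ) T \<and> l \<in> T \<and> T \<subseteq> {x \<in> U. f x \<noteq> 0}"
      using iff l * \<open>N \<subseteq> Z\<close> by (intro exI[of _ "N \<inter> {l \<in> Z. \<exists>v\<in>l. a v \<noteq> 0}"]) auto
  qed
qed

text \<open>On the chart where a functional \<open>\<alpha>\<close> does not vanish, pick in each line the vector on which \<open>\<alpha>\<close> is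
\<open>1\<close>. Its coordinates are the fractions \<open>\<beta> / \<alpha>\<close>.\<close>

lemma local_lift:
  assumes "l \<in> Z"
  obtains N \<sigma> where "openin (ztop PZ) N" "l \<in> N" "vreg PZ scale N \<sigma>"
    "\<And>m. m \<in> N \<Longrightarrow> \<sigma> m \<in> m \<and> \<sigma> m \<noteq> 0"
proof -
  have "l \<in> proj_points scale UNIV" using assms Z_points by auto
  then obtain v where v: "v \<in> l" "v \<noteq> 0" by (rule proj_point_rep)
  obtain \<alpha> where \<alpha>: "Vector_Spaces.linear scale (*) \<alpha>" "\<alpha> v = 1" using v(2) by (rule separating_functional)
  have h\<alpha>: "homogeneous_poly scale 1 \<alpha>" using \<alpha>(1) by (rule homogeneous_poly.linear)
  define N where "N = {l \<in> Z. \<exists>v\<in>l. \<alpha> v \<noteq> 0}"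
  define \<sigma> where "\<sigma> m = (SOME u. u \<in> m \<and> \<alpha> u = 1)" for m
  have Npt: "m \<in> proj_points scale UNIV" if "m \<in> N" for m using that Z_points by (auto simp: N_def)
  have \<sigma>: "\<sigma> m \<in> m \<and> \<alpha> (\<sigma> m) = 1" if m: "m \<in> N" for m
  proof -
    from m obtain u where u: "u \<in> m" "\<alpha> u \<noteq> 0" by (auto simp: N_def)
    then have "u \<noteq> 0" using linear_zeroD[OF \<alpha>(1)] by auto
    then have "m = line scale u" using proj_pointD[OF Npt[OF m]] u by blast
    then have "scale (inverse (\<alpha> u)) u \<in> m" by (auto simp: line_def)
    moreover have "\<alpha> (scale (inverse (\<alpha> u)) u) = 1" using u \<alpha>(1) by (simp add: linear_scaleD)
    ultimately show ?thesis unfolding \<sigma>_def by (rule_tac someI) blast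
  qed
  have \<sigma>0: "\<sigma> m \<noteq> 0" if "m \<in> N" for m using \<sigma>[OF that] linear_zeroD[OF \<alpha>(1)] by auto
  have op: "openin (ztop PZ) N" unfolding N_def by (rule open_nonvanishing[OF h\<alpha>])
  have quot: "\<alpha> u \<noteq> 0 \<and> \<beta> (\<sigma> m) = \<beta> u / \<alpha> u"
    if \<beta>: "Vector_Spaces.linear scale (*) \<beta>" and m: "m \<in> N" "u \<in> m - {0}" for \<beta> m u
  proof -
    have "m = line scale (\<sigma> m)" using proj_pointD[OF Npt[OF m(1)]] \<sigma>[OF m(1)] \<sigma>0[OF m(1)] by blast
    then have "u \<in> line scale (\<sigma> m)" "u \<noteq> 0" using m(2) by simp_all
    then obtain c where c: "u = scale c (\<sigma> m)" "c \<noteq> 0" unfolding line_def by auto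
    then show ?thesis using \<sigma>[OF m(1)] linear_scaleD[OF \<alpha>(1)] linear_scaleD[OF \<beta>] by simp
  qed
  have "vreg PZ scale N \<sigma>"
    unfolding vreg_def reg_PZ
  proof (intro allI impI ballI)
    fix \<beta> m assume \<beta>: "Vector_Spaces.linear scale (*) \<beta>" and "m \<in> N"
    with op quot[OF \<beta>] h\<alpha> homogeneous_poly.linear[OF \<beta>]
    show "\<exists>M d g h. openin (ztop PZ) M \<and> m \<in> M \<and> M \<subseteq> N \<and> homogeneous_poly scale d g \<and>
      homogeneous_poly scale d h \<and> (\<forall>m\<in>M. \<forall>v\<in>m - {0}. h v \<noteq> 0 \<and> \<beta> (\<sigma> m) = g v / h v)"
      by (intro exI[of _ N] exI[of _ 1] exI[of _ \<beta>] exI[of _ \<alpha>]) auto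
  qed
  moreover have "l \<in> N" unfolding N_def using assms v(1) \<alpha>(2) by (intro CollectI conjI bexI[of _ v]) simp_all
  ultimately show ?thesis using op \<sigma> \<sigma>0 by (intro that[of N \<sigma>]) auto
qed

end

text \<open>A homogeneous polynomial of the lifted vector is a regular function on the source. Its nonvanishing locus is
therefore open, and quotients of two such functions are regular.\<close>

lemma (in fspace_ring) regular_map_to_projective:
  assumes sub: "subvariety scale Z" and U: "openin (ztop X) U" and img: "\<phi> ` U \<subseteq> V" and VZ: "V \<subseteq> Z"
    and lift: "\<And>x. x \<in> U \<Longrightarrow> \<exists>N Y. openin (ztop X) N \<and> x \<in> N \<and> N \<subseteq> U \<and> vreg X scale N Y \<and>
      (\<forall>z\<in>N. Y z \<noteq> 0 \<and> \<phi> z = line scale (Y z))"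
  shows "regular_map X U (proj_subvariety scale Z) V \<phi>"
proof -
  interpret subvariety scale Z by fact
  have cont: "openin (ztop X) {x \<in> U. \<phi> x \<in> T}" if T: "openin (zariski_proj scale) T" for T
  proof -
    have "continuous_map (subtopology (ztop X) U) (zariski_proj scale) \<phi>"
      unfolding zariski_proj_def
    proof (rule continuous_on_generated_topo)
      show "\<phi> ` topspace (subtopology (ztop X) U) \<subseteq>
        \<Union> {{l \<in> proj_points scale UNIV. \<exists>v\<in>l. f v \<noteq> 0} |f. \<exists>d. homogeneous_poly scale d f}"
        unfolding topology_generated_by_topspace[symmetric] zariski_proj_def[symmetric] topspace_zariski
        using img VZ Z_points by auto
      fix D assume "D \<in> {{l \<in> proj_points scale UNIV. \<exists>v\<in>l. f v \<noteq> 0} |f. \<exists>d. homogeneous_poly scale d f}"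
      then obtain p d where p: "homogeneous_poly scale d p"
        and D: "D = {l \<in> proj_points scale UNIV. \<exists>v\<in>l. p v \<noteq> 0}" by blast
      have "openin (ztop X) {x \<in> U. \<phi> x \<in> D}"
      proof (subst openin_subopen, safe)
        fix x assume x: "x \<in> U" "\<phi> x \<in> D"
        obtain N Y where N: "openin (ztop X) N" "x \<in> N" "N \<subseteq> U" "vreg X scale N Y"
          "\<And>z. z \<in> N \<Longrightarrow> Y z \<noteq> 0 \<and> \<phi> z = line scale (Y z)" using lift[OF x(1)] by blast
        have iff: "\<phi> z \<in> D \<longleftrightarrow> p (Y z) \<noteq> 0" if z: "z \<in> N" for z
        proof -
          have "\<phi> z \<in> proj_points scale UNIV" using z N(3) img VZ Z_points by auto
          then show ?thesis using homogeneous_poly_line[OF p, of "\<phi> z" UNIV "Y z"] N(5)[OF z] line_self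
            by (auto simp: D)
        qed
        have "openin (ztop X) {z \<in> N. p (Y z) \<noteq> 0}"
          by (intro open_nonzero reg_homogeneous_poly[OF p] N)
        then show "\<exists>T. openin (ztop X) T \<and> x \<in> T \<and> T \<subseteq> {x \<in> U. \<phi> x \<in> D}"
          using iff x N by (intro exI[of _ "{z \<in> N. p (Y z) \<noteq> 0}"]) auto
      qed
      moreover have "{x \<in> U. \<phi> x \<in> D} \<subseteq> U" by auto
      ultimately have "openin (subtopology (ztop X) U) {x \<in> U. \<phi> x \<in> D}"
        by (simp add: openin_open_subtopology[OF U])
      moreover have "\<phi> -` D \<inter> topspace (subtopology (ztop X) U) = {x \<in> U. \<phi> x \<in> D}"
        using openin_subset[OF U] by auto
      ultimately show "openin (subtopology (ztop X) U) (\<phi> -` D \<inter> topspace (subtopology (ztop X) U))"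
        by simp
    qed
    from openin_continuous_map_preimage[OF this T]
    have "openin (ztop X) {x \<in> topspace (ztop X) \<inter> U. \<phi> x \<in> T}"
      by (simp add: openin_open_subtopology[OF U])
    moreover have "{x \<in> topspace (ztop X) \<inter> U. \<phi> x \<in> T} = {x \<in> U. \<phi> x \<in> T}"
      using openin_subset[OF U] by auto
    ultimately show ?thesis by simp
  qed
  have cont': "openin (ztop X) {x \<in> U. \<phi> x \<in> O'}" if "openin (ztop PZ) O'" for O'
  proof -
    from that obtain T where T: "openin (zariski_proj scale) T" "O' = T \<inter> Z"
      unfolding ztop_PZ openin_subtopology by blast
    then have "{x \<in> U. \<phi> x \<in> O'} = {x \<in> U. \<phi> x \<in> T}" using img VZ by auto
    then show ?thesis using cont[OF T(1)] by simp
  qed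
  show ?thesis
  proof (rule regular_mapI[OF img cont'])
    fix O' f assume O': "openin (ztop PZ) O'" and f: "reg PZ O' f"
    show "reg X {x \<in> U. \<phi> x \<in> O'} (\<lambda>x. f (\<phi> x))"
    proof (rule reg_local)
      fix x assume x: "x \<in> {x \<in> U. \<phi> x \<in> O'}"
      obtain N Y where N: "openin (ztop X) N" "x \<in> N" "N \<subseteq> U" "vreg X scale N Y"
        "\<And>z. z \<in> N \<Longrightarrow> Y z \<noteq> 0 \<and> \<phi> z = line scale (Y z)" using lift[of x] x by blast
      from x have "\<phi> x \<in> O'" by blast
      with f obtain M d g h where M: "openin (ztop PZ) M" "\<phi> x \<in> M" "M \<subseteq> O'"
        "homogeneous_poly scale d g" "homogeneous_poly scale d h"
        "\<forall>m\<in>M. \<forall>v\<in>m - {0}. h v \<noteq> 0 \<and> f m = g v / h v"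
        by (rule reg_PZE)
      define N' where "N' = N \<inter> {x \<in> U. \<phi> x \<in> M}"
      have N': "openin (ztop X) N'" unfolding N'_def by (intro openin_Int N cont' M)
      have val: "h (Y z) \<noteq> 0 \<and> f (\<phi> z) = g (Y z) / h (Y z)" if "z \<in> N'" for z
        using that M(6) N(5)[of z] line_self by (auto simp: N'_def)
      have vr: "vreg X scale N' Y" by (rule vreg_restrict[OF N(4) N']) (simp add: N'_def)
      have "reg X N' (\<lambda>z. g (Y z) / h (Y z))"
        by (intro reg_divide reg_homogeneous_poly[OF M(4)] reg_homogeneous_poly[OF M(5)] N' vr)
          (use val in auto)
      then have "reg X N' (\<lambda>z. f (\<phi> z))" by (rule reg_cong) (use val in auto)
      with N' x N(2) M(2,3) show "\<exists>N. openin (ztop X) N \<and> x \<in> N \<and> N \<subseteq> {x \<in> U. \<phi> x \<in> O'} \<and>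
        reg X N (\<lambda>x. f (\<phi> x))" by (intro exI[of _ N']) (auto simp: N'_def)
    qed
  qed
qed

section \<open>Irreducibility\<close>

text \<open>The empty space is irreducible in this sense; what matters is that nonempty open sets are dense.\<close>

definition irreducible_top :: "'a topology \<Rightarrow> bool"
  where "irreducible_top T \<longleftrightarrow>
    (\<forall>A B. openin T A \<and> openin T B \<and> A \<noteq> {} \<and> B \<noteq> {} \<longrightarrow> A \<inter> B \<noteq> {})"

lemma irreducible_topD:
  "\<lbrakk>irreducible_top T; openin T A; openin T B; A \<noteq> {}; B \<noteq> {}\<rbrakk> \<Longrightarrow> A \<inter> B \<noteq> {}"
  unfolding irreducible_top_def by blast

lemma dense_open_irreducible:
  assumes "irreducible_top (ztop X)" "openin (ztop X) U" "U \<noteq> {}"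
  shows "dense_open X U"
proof -
  have "x \<in> ztop X closure_of U" if "x \<in> points X" for x
    unfolding in_closure_of
  proof (intro conjI allI impI that)
    fix T assume "x \<in> T \<and> openin (ztop X) T"
    then have "U \<inter> T \<noteq> {}" using irreducible_topD[OF assms(1,2), of T] assms(3) by blast
    then show "\<exists>y. y \<in> U \<and> y \<in> T" by blast
  qed
  then show ?thesis unfolding dense_open_def
    using assms(2) closure_of_subset_topspace[of "ztop X" U] by blast
qed

lemma dense_open_meets:
  assumes "dense_open X U" "openin (ztop X) A" "A \<noteq> {}"
  shows "U \<inter> A \<noteq> {}"
proof -
  from assms(3) obtain x where x: "x \<in> A" by blast
  then have "x \<in> ztop X closure_of U" using openin_subset[OF assms(2)] assms(1) by (auto simp: dense_open_def)
  then have "\<exists>y. y \<in> U \<and> y \<in> A" using x assms(2) unfolding in_closure_of by simp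
  then show ?thesis by blast
qed

lemma dense_open_openin: "dense_open X U \<Longrightarrow> openin (ztop X) U"
  by (simp add: dense_open_def)

section \<open>Products\<close>

text \<open>A tensor is a finite sum of products \<open>a(x) b(y)\<close> of regular functions. The tensors on an open rectangle form
a ring, and the regular functions on the product are their local fractions.\<close>

locale fspace_product = X: fspace_ring X + Y: fspace_ring Y
  for X :: "('a, 'k::field) fspace" and Y :: "('b, 'k) fspace"
begin

abbreviation "tensor U V \<equiv> tensor_functions X U Y V"

lemma tensorE:
  assumes "t \<in> tensor U V"
  obtains n :: nat and a b where "t = (\<lambda>(x, y). \<Sum>i<n. a i x * b i y)"
    "\<forall>i<n. reg X U (a i)" "\<forall>i<n. reg Y V (b i)"
  using assms unfolding tensor_functions_def by blast

lemma tensorI: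
  assumes "\<And>i. i < n \<Longrightarrow> reg X U (a i)" "\<And>i. i < n \<Longrightarrow> reg Y V (b i)"
  shows "(\<lambda>(x, y). \<Sum>i<(n::nat). a i x * b i y) \<in> tensor U V"
  using assms unfolding tensor_functions_def by blast

lemma tensor_zero: "(\<lambda>_. 0) \<in> tensor U V"
  using tensorI[of 0 U "\<lambda>_ _. 0" V "\<lambda>_ _. 0"] by (simp add: case_prod_beta')

lemma tensor_add_term:
  assumes "t \<in> tensor U V" "reg X U c" "reg Y V d"
  shows "(\<lambda>p. t p + c (fst p) * d (snd p)) \<in> tensor U V"
proof -
  obtain n :: nat and a b where t: "t = (\<lambda>(x, y). \<Sum>i<n. a i x * b i y)"
    "\<forall>i<n. reg X U (a i)" "\<forall>i<n. reg Y V (b i)"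
    using assms(1) by (rule tensorE)
  have "(\<lambda>(x, y). \<Sum>i<Suc n. (a(n := c)) i x * (b(n := d)) i y) \<in> tensor U V"
    by (rule tensorI) (use t assms in \<open>auto simp: less_Suc_eq\<close>)
  moreover have "(\<Sum>i<Suc n. (a(n := c)) i x * (b(n := d)) i y) = (\<Sum>i<n. a i x * b i y) + c x * d y" for x y
    by simp
  ultimately show ?thesis by (simp add: t(1) case_prod_beta')
qed

lemma tensor_term: "\<lbrakk>reg X U c; reg Y V d\<rbrakk> \<Longrightarrow> (\<lambda>p. c (fst p) * d (snd p)) \<in> tensor U V"
  using tensor_add_term[OF tensor_zero] by simp

lemma tensor_add:
  assumes "t \<in> tensor U V" "t' \<in> tensor U V"
  shows "(\<lambda>p. t p + t' p) \<in> tensor U V"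
proof -
  obtain n :: nat and a b where t: "t' = (\<lambda>(x, y). \<Sum>i<n. a i x * b i y)"
    "\<forall>i<n. reg X U (a i)" "\<forall>i<n. reg Y V (b i)"
    using assms(2) by (rule tensorE)
  have "(\<lambda>p. t p + (\<Sum>i<m. a i (fst p) * b i (snd p))) \<in> tensor U V" if "m \<le> n" for m
    using that
  proof (induction m)
    case (Suc m)
    then have "(\<lambda>p. (t p + (\<Sum>i<m. a i (fst p) * b i (snd p))) + a m (fst p) * b m (snd p)) \<in> tensor U V"
      by (intro tensor_add_term t[rule_format]) auto
    then show ?case by (simp add: add.assoc)
  qed (use assms in simp)
  from this[of n] show ?thesis by (simp add: t(1) case_prod_beta')
qed

lemma tensor_mult:
  assumes "t \<in> tensor U V" "t' \<in> tensor U V"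
  shows "(\<lambda>p. t p * t' p) \<in> tensor U V"
proof -
  obtain n :: nat and a b where t: "t = (\<lambda>(x, y). \<Sum>i<n. a i x * b i y)"
    "\<forall>i<n. reg X U (a i)" "\<forall>i<n. reg Y V (b i)"
    using assms(1) by (rule tensorE)
  obtain n' :: nat and a' b' where t': "t' = (\<lambda>(x, y). \<Sum>i<n'. a' i x * b' i y)"
    "\<forall>i<n'. reg X U (a' i)" "\<forall>i<n'. reg Y V (b' i)"
    using assms(2) by (rule tensorE)
  have summand: "(\<lambda>p. (a m (fst p) * b m (snd p)) * t' p) \<in> tensor U V" if m: "m < n" for m
  proof -
    have "(\<lambda>(x, y). \<Sum>i<n'. (a m x * a' i x) * (b m y * b' i y)) \<in> tensor U V"
      by (rule tensorI[of n' U "\<lambda>i x. a m x * a' i x" V "\<lambda>i y. b m y * b' i y"])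
        (auto intro!: X.reg_mult Y.reg_mult simp: t(2,3) t'(2,3) m)
    then show ?thesis by (simp add: t'(1) case_prod_beta' sum_distrib_left mult_ac)
  qed
  have "(\<lambda>p. (\<Sum>i<m. a i (fst p) * b i (snd p)) * t' p) \<in> tensor U V" if "m \<le> n" for m
    using that
  proof (induction m)
    case (Suc m)
    then have "(\<lambda>p. (\<Sum>i<m. a i (fst p) * b i (snd p)) * t' p + (a m (fst p) * b m (snd p)) * t' p) \<in> tensor U V"
      by (intro tensor_add summand) auto
    then show ?case by (simp add: algebra_simps)
  qed (simp add: tensor_zero)
  from this[of n] show ?thesis by (simp add: t(1) case_prod_beta')
qed

lemma tensor_restrict:
  assumes "t \<in> tensor U V" "openin (ztop X) U'" "U' \<subseteq> U" "openin (ztop Y) V'" "V' \<subseteq> V"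
  shows "t \<in> tensor U' V'"
proof -
  obtain n :: nat and a b where t: "t = (\<lambda>(x, y). \<Sum>i<n. a i x * b i y)"
    "\<forall>i<n. reg X U (a i)" "\<forall>i<n. reg Y V (b i)"
    using assms(1) by (rule tensorE)
  show ?thesis unfolding t(1)
    by (rule tensorI) (auto intro: X.reg_restrict[OF _ assms(2,3)] Y.reg_restrict[OF _ assms(4,5)] simp: t(2,3))
qed

lemma tensor_const:
  assumes "openin (ztop X) U" "openin (ztop Y) V"
  shows "(\<lambda>_. c) \<in> tensor U V"
  using tensor_term[OF X.reg_const[OF assms(1), of c] Y.reg_const[OF assms(2), of 1]] by simp

abbreviation "XY \<equiv> product_fspace X Y"

lemma ztop_XY: "ztop XY = product_ztop X Y"
  by (simp add: product_fspace_def)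

lemma open_tensor_nonzero:
  assumes "openin (ztop X) U" "openin (ztop Y) V" "t \<in> tensor U V"
  shows "openin (ztop XY) {p \<in> U \<times> V. t p \<noteq> 0}"
  unfolding ztop_XY product_ztop_def
  by (rule topology_generated_by_Basis) (use assms in blast)

lemma open_Times:
  assumes "openin (ztop X) U" "openin (ztop Y) V"
  shows "openin (ztop XY) (U \<times> V)"
  using open_tensor_nonzero[OF assms tensor_const[OF assms, of 1]] by simp

lemma points_XY: "points XY = points X \<times> points Y"
proof
  show "points XY \<subseteq> points X \<times> points Y"
    unfolding ztop_XY product_ztop_def topology_generated_by_topspace
    using openin_subset[of "ztop X"] openin_subset[of "ztop Y"] by fast
  show "points X \<times> points Y \<subseteq> points XY"
    using openin_subset[OF open_Times[of "points X" "points Y"]] by simp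
qed

lemma reg_XY:
  "reg XY O' F \<longleftrightarrow> (\<forall>p\<in>O'. \<exists>N U V s t.
       openin (ztop XY) N \<and> p \<in> N \<and> N \<subseteq> O' \<inter> (U \<times> V) \<and>
       openin (ztop X) U \<and> openin (ztop Y) V \<and>
       s \<in> tensor U V \<and> t \<in> tensor U V \<and>
       (\<forall>r\<in>N. t r \<noteq> 0 \<and> F r = s r / t r))"
  by (simp add: product_fspace_def)

lemma reg_XYI:
  assumes "\<And>p. p \<in> O' \<Longrightarrow> \<exists>N U V s t.
       openin (ztop XY) N \<and> p \<in> N \<and> N \<subseteq> O' \<and> N \<subseteq> U \<times> V \<and>
       openin (ztop X) U \<and> openin (ztop Y) V \<and>
       s \<in> tensor U V \<and> t \<in> tensor U V \<and>
       (\<forall>r\<in>N. t r \<noteq> 0 \<and> F r = s r / t r)"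
  shows "reg XY O' F"
  unfolding reg_XY Int_subset_iff le_inf_iff using assms by simp

lemma reg_XYE:
  assumes "reg XY O' F" "p \<in> O'"
  obtains N U V s t where "openin (ztop XY) N" "p \<in> N" "N \<subseteq> O'" "N \<subseteq> U \<times> V"
       "openin (ztop X) U" "openin (ztop Y) V" "s \<in> tensor U V" "t \<in> tensor U V"
       "\<forall>r\<in>N. t r \<noteq> 0 \<and> F r = s r / t r"
proof -
  from assms have "\<exists>N U V s t.
       openin (ztop XY) N \<and> p \<in> N \<and> N \<subseteq> O' \<inter> (U \<times> V) \<and>
       openin (ztop X) U \<and> openin (ztop Y) V \<and>
       s \<in> tensor U V \<and> t \<in> tensor U V \<and>
       (\<forall>r\<in>N. t r \<noteq> 0 \<and> F r = s r / t r)"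
    unfolding reg_XY by (rule bspec)
  then show ?thesis unfolding le_inf_iff by (elim exE conjE) (rule that)
qed

lemma reg_XYE2:
  assumes f: "reg XY O' F" and f': "reg XY O' F'" and p: "p \<in> O'"
  obtains N U V s t s' t' where "openin (ztop XY) N" "p \<in> N" "N \<subseteq> O'" "N \<subseteq> U \<times> V"
       "openin (ztop X) U" "openin (ztop Y) V" "s \<in> tensor U V" "t \<in> tensor U V"
       "s' \<in> tensor U V" "t' \<in> tensor U V"
       "\<forall>r\<in>N. t r \<noteq> 0 \<and> F r = s r / t r" "\<forall>r\<in>N. t' r \<noteq> 0 \<and> F' r = s' r / t' r"
proof -
  from f p obtain N U V s t where n: "openin (ztop XY) N" "p \<in> N" "N \<subseteq> O'" "N \<subseteq> U \<times> V"
       "openin (ztop X) U" "openin (ztop Y) V" "s \<in> tensor U V" "t \<in> tensor U V"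
       "\<forall>r\<in>N. t r \<noteq> 0 \<and> F r = s r / t r" by (rule reg_XYE)
  from f' p obtain N' U' V' s' t' where n': "openin (ztop XY) N'" "p \<in> N'" "N' \<subseteq> O'" "N' \<subseteq> U' \<times> V'"
       "openin (ztop X) U'" "openin (ztop Y) V'" "s' \<in> tensor U' V'" "t' \<in> tensor U' V'"
       "\<forall>r\<in>N'. t' r \<noteq> 0 \<and> F' r = s' r / t' r" by (rule reg_XYE)
  note o = openin_Int[OF n(5) n'(5)] openin_Int[OF n(6) n'(6)]
  have "N \<inter> N' \<subseteq> (U \<inter> U') \<times> (V \<inter> V')" using n(4) n'(4) by blast
  then show ?thesis
    by (rule that[OF openin_Int[OF n(1) n'(1)] _ _ _ o
        tensor_restrict[OF n(7) o(1) Int_lower1 o(2) Int_lower1]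
        tensor_restrict[OF n(8) o(1) Int_lower1 o(2) Int_lower1]
        tensor_restrict[OF n'(7) o(1) Int_lower2 o(2) Int_lower2]
        tensor_restrict[OF n'(8) o(1) Int_lower2 o(2) Int_lower2], rotated 2])
      (use n(2,3,9) n'(2,9) in blast)+
qed

sublocale XY: fspace_ring XY
proof
  fix U f and g :: "'a \<times> 'b \<Rightarrow> 'k"
  assume f: "reg XY U f" and eq: "\<And>x. x \<in> U \<Longrightarrow> f x = g x"
  show "reg XY U g"
  proof (rule reg_XYI)
    fix p assume "p \<in> U"
    with f obtain N A B s t where n: "openin (ztop XY) N" "p \<in> N" "N \<subseteq> U" "N \<subseteq> A \<times> B"
       "openin (ztop X) A" "openin (ztop Y) B" "s \<in> tensor A B" "t \<in> tensor A B"
       "\<forall>r\<in>N. t r \<noteq> 0 \<and> f r = s r / t r" by (rule reg_XYE)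
    have "\<forall>r\<in>N. t r \<noteq> 0 \<and> g r = s r / t r"
    proof
      fix r assume r: "r \<in> N"
      with n(3) eq have "f r = g r" by blast
      with n(9) r show "t r \<noteq> 0 \<and> g r = s r / t r" by simp
    qed
    then show "\<exists>N A B s t. openin (ztop XY) N \<and> p \<in> N \<and> N \<subseteq> U \<and> N \<subseteq> A \<times> B \<and>
       openin (ztop X) A \<and> openin (ztop Y) B \<and> s \<in> tensor A B \<and> t \<in> tensor A B \<and>
       (\<forall>r\<in>N. t r \<noteq> 0 \<and> g r = s r / t r)"
      by (intro exI[of _ N] exI[of _ A] exI[of _ B] exI[of _ s] exI[of _ t] conjI n)
  qed
next
  fix U U' f assume f: "reg XY U f" and U': "openin (ztop XY) U'" "U' \<subseteq> U"
  show "reg XY U' f"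
  proof (rule reg_XYI)
    fix p assume p: "p \<in> U'"
    with U' have "p \<in> U" by blast
    with f obtain N A B s t where n: "openin (ztop XY) N" "p \<in> N" "N \<subseteq> U" "N \<subseteq> A \<times> B"
       "openin (ztop X) A" "openin (ztop Y) B" "s \<in> tensor A B" "t \<in> tensor A B"
       "\<forall>r\<in>N. t r \<noteq> 0 \<and> f r = s r / t r" by (rule reg_XYE)
    show "\<exists>N A B s t. openin (ztop XY) N \<and> p \<in> N \<and> N \<subseteq> U' \<and> N \<subseteq> A \<times> B \<and>
       openin (ztop X) A \<and> openin (ztop Y) B \<and> s \<in> tensor A B \<and> t \<in> tensor A B \<and>
       (\<forall>r\<in>N. t r \<noteq> 0 \<and> f r = s r / t r)"
      by (intro exI[of _ "N \<inter> U'"] exI[of _ A] exI[of _ B] exI[of _ s] exI[of _ t] conjI n(5-8)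
          openin_Int n(1) U'(1) IntI n(2) p Int_lower2 subset_trans[OF Int_lower1 n(4)]) (use n(9) in simp)
  qed
next
  fix U f
  assume loc: "\<And>x. x \<in> U \<Longrightarrow> \<exists>N. openin (ztop XY) N \<and> x \<in> N \<and> N \<subseteq> U \<and> reg XY N f"
  show "reg XY U f"
  proof (rule reg_XYI)
    fix p assume p: "p \<in> U"
    with loc obtain M where M: "p \<in> M" "M \<subseteq> U" "reg XY M f" by blast
    from M(3,1) obtain N A B s t where n: "openin (ztop XY) N" "p \<in> N" "N \<subseteq> M" "N \<subseteq> A \<times> B"
       "openin (ztop X) A" "openin (ztop Y) B" "s \<in> tensor A B" "t \<in> tensor A B"
       "\<forall>r\<in>N. t r \<noteq> 0 \<and> f r = s r / t r" by (rule reg_XYE)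
    show "\<exists>N A B s t. openin (ztop XY) N \<and> p \<in> N \<and> N \<subseteq> U \<and> N \<subseteq> A \<times> B \<and>
       openin (ztop X) A \<and> openin (ztop Y) B \<and> s \<in> tensor A B \<and> t \<in> tensor A B \<and>
       (\<forall>r\<in>N. t r \<noteq> 0 \<and> f r = s r / t r)"
      by (intro exI[of _ N] exI[of _ A] exI[of _ B] exI[of _ s] exI[of _ t] conjI n
          subset_trans[OF n(3) M(2)])
  qed
next
  fix U and c :: 'k assume U: "openin (ztop XY) U"
  show "reg XY U (\<lambda>_. c)"
  proof (rule reg_XYI)
    fix p assume p: "p \<in> U"
    have o: "openin (ztop X) (points X)" "openin (ztop Y) (points Y)" by simp_all
    show "\<exists>N A B s t. openin (ztop XY) N \<and> p \<in> N \<and> N \<subseteq> U \<and> N \<subseteq> A \<times> B \<and>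
       openin (ztop X) A \<and> openin (ztop Y) B \<and> s \<in> tensor A B \<and> t \<in> tensor A B \<and>
       (\<forall>r\<in>N. t r \<noteq> 0 \<and> c = s r / t r)"
      by (rule exI[of _ U], rule exI[of _ "points X"], rule exI[of _ "points Y"],
          rule exI[of _ "\<lambda>_. c"], rule exI[of _ "\<lambda>_. 1"], intro conjI tensor_const o U p)
        (use openin_subset[OF U] points_XY in simp_all)
  qed
next
  fix U f f' assume f: "reg XY U f" and f': "reg XY U f'"
  show "reg XY U (\<lambda>x. f x + f' x)"
  proof (rule reg_XYI)
    fix p assume p: "p \<in> U"
    from f f' p obtain N A B s t s' t' where n: "openin (ztop XY) N" "p \<in> N" "N \<subseteq> U" "N \<subseteq> A \<times> B"
       "openin (ztop X) A" "openin (ztop Y) B" "s \<in> tensor A B" "t \<in> tensor A B"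
       "s' \<in> tensor A B" "t' \<in> tensor A B"
       "\<forall>r\<in>N. t r \<noteq> 0 \<and> f r = s r / t r" "\<forall>r\<in>N. t' r \<noteq> 0 \<and> f' r = s' r / t' r" by (rule reg_XYE2)
    have "\<forall>r\<in>N. t r * t' r \<noteq> 0 \<and> f r + f' r = (s r * t' r + s' r * t r) / (t r * t' r)"
      using n(11,12) by (simp add: add_frac_eq)
    then show "\<exists>N A B s t. openin (ztop XY) N \<and> p \<in> N \<and> N \<subseteq> U \<and> N \<subseteq> A \<times> B \<and>
       openin (ztop X) A \<and> openin (ztop Y) B \<and> s \<in> tensor A B \<and> t \<in> tensor A B \<and>
       (\<forall>r\<in>N. t r \<noteq> 0 \<and> f r + f' r = s r / t r)"
      by (intro exI[of _ N] exI[of _ A] exI[of _ B] exI[of _ "\<lambda>r. s r * t' r + s' r * t r"]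
          exI[of _ "\<lambda>r. t r * t' r"] conjI n tensor_add tensor_mult)
  qed
  show "reg XY U (\<lambda>x. f x * f' x)"
  proof (rule reg_XYI)
    fix p assume p: "p \<in> U"
    from f f' p obtain N A B s t s' t' where n: "openin (ztop XY) N" "p \<in> N" "N \<subseteq> U" "N \<subseteq> A \<times> B"
       "openin (ztop X) A" "openin (ztop Y) B" "s \<in> tensor A B" "t \<in> tensor A B"
       "s' \<in> tensor A B" "t' \<in> tensor A B"
       "\<forall>r\<in>N. t r \<noteq> 0 \<and> f r = s r / t r" "\<forall>r\<in>N. t' r \<noteq> 0 \<and> f' r = s' r / t' r" by (rule reg_XYE2)
    have "\<forall>r\<in>N. t r * t' r \<noteq> 0 \<and> f r * f' r = (s r * s' r) / (t r * t' r)"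
      using n(11,12) by simp
    then show "\<exists>N A B s t. openin (ztop XY) N \<and> p \<in> N \<and> N \<subseteq> U \<and> N \<subseteq> A \<times> B \<and>
       openin (ztop X) A \<and> openin (ztop Y) B \<and> s \<in> tensor A B \<and> t \<in> tensor A B \<and>
       (\<forall>r\<in>N. t r \<noteq> 0 \<and> f r * f' r = s r / t r)"
      by (intro exI[of _ N] exI[of _ A] exI[of _ B] exI[of _ "\<lambda>r. s r * s' r"]
          exI[of _ "\<lambda>r. t r * t' r"] conjI n tensor_mult)
  qed
next
  fix U f assume f: "reg XY U f" and nz: "\<And>x. x \<in> U \<Longrightarrow> f x \<noteq> 0"
  show "reg XY U (\<lambda>x. inverse (f x))"
  proof (rule reg_XYI)
    fix p assume "p \<in> U"
    with f obtain N A B s t where n: "openin (ztop XY) N" "p \<in> N" "N \<subseteq> U" "N \<subseteq> A \<times> B"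
       "openin (ztop X) A" "openin (ztop Y) B" "s \<in> tensor A B" "t \<in> tensor A B"
       "\<forall>r\<in>N. t r \<noteq> 0 \<and> f r = s r / t r" by (rule reg_XYE)
    have "\<forall>r\<in>N. s r \<noteq> 0 \<and> inverse (f r) = t r / s r"
    proof
      fix r assume r: "r \<in> N"
      then have "f r \<noteq> 0" using n(3) nz by blast
      moreover have "t r \<noteq> 0" "f r = s r / t r" using n(9) r by simp_all
      ultimately show "s r \<noteq> 0 \<and> inverse (f r) = t r / s r" by simp
    qed
    then show "\<exists>N A B s t. openin (ztop XY) N \<and> p \<in> N \<and> N \<subseteq> U \<and> N \<subseteq> A \<times> B \<and>
       openin (ztop X) A \<and> openin (ztop Y) B \<and> s \<in> tensor A B \<and> t \<in> tensor A B \<and>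
       (\<forall>r\<in>N. t r \<noteq> 0 \<and> inverse (f r) = s r / t r)"
      by (intro exI[of _ N] exI[of _ A] exI[of _ B] exI[of _ t] exI[of _ s] conjI n)
  qed
next
  fix U f assume U: "openin (ztop XY) U" and f: "reg XY U f"
  show "openin (ztop XY) {x \<in> U. f x \<noteq> 0}"
  proof (subst openin_subopen, intro ballI)
    fix p assume "p \<in> {x \<in> U. f x \<noteq> 0}"
    then have p: "p \<in> U" "f p \<noteq> 0" by simp_all
    from f p(1) obtain N A B s t where n: "openin (ztop XY) N" "p \<in> N" "N \<subseteq> U" "N \<subseteq> A \<times> B"
       "openin (ztop X) A" "openin (ztop Y) B" "s \<in> tensor A B" "t \<in> tensor A B"
       "\<forall>r\<in>N. t r \<noteq> 0 \<and> f r = s r / t r" by (rule reg_XYE)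
    have iff: "\<forall>r\<in>N. f r \<noteq> 0 \<longleftrightarrow> s r \<noteq> 0" using n(9) by simp
    have "openin (ztop XY) (N \<inter> {r \<in> A \<times> B. s r \<noteq> 0})"
      using n(1) open_tensor_nonzero[OF n(5-7)] by (rule openin_Int)
    then show "\<exists>T. openin (ztop XY) T \<and> p \<in> T \<and> T \<subseteq> {x \<in> U. f x \<noteq> 0}"
      using iff n(2-4) p by (intro exI[of _ "N \<inter> {r \<in> A \<times> B. s r \<noteq> 0}"]) blast
  qed
qed

lemma reg_fst:
  assumes "openin (ztop X) U" "reg X U f"
  shows "reg XY (U \<times> points Y) (\<lambda>p. f (fst p))"
proof (rule reg_XYI)
  fix p assume p: "p \<in> U \<times> points Y"
  have o: "openin (ztop Y) (points Y)" by simp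
  have "(\<lambda>p. f (fst p) * 1) \<in> tensor U (points Y)"
    using tensor_term[OF assms(2) Y.reg_const[OF o, of 1]] by simp
  then show "\<exists>N A B s t. openin (ztop XY) N \<and> p \<in> N \<and> N \<subseteq> U \<times> points Y \<and> N \<subseteq> A \<times> B \<and>
       openin (ztop X) A \<and> openin (ztop Y) B \<and> s \<in> tensor A B \<and> t \<in> tensor A B \<and>
       (\<forall>r\<in>N. t r \<noteq> 0 \<and> f (fst r) = s r / t r)"
    by (intro exI[of _ "U \<times> points Y"] exI[of _ U] exI[of _ "points Y"] exI[of _ "\<lambda>p. f (fst p)"]
        exI[of _ "\<lambda>_. 1"] conjI open_Times tensor_const assms o p) simp_all
qed

lemma reg_snd:
  assumes "openin (ztop Y) V" "reg Y V f"
  shows "reg XY (points X \<times> V) (\<lambda>p. f (snd p))"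
proof (rule reg_XYI)
  fix p assume p: "p \<in> points X \<times> V"
  have o: "openin (ztop X) (points X)" by simp
  have "(\<lambda>p. 1 * f (snd p)) \<in> tensor (points X) V"
    using tensor_term[OF X.reg_const[OF o, of 1] assms(2)] by simp
  then show "\<exists>N A B s t. openin (ztop XY) N \<and> p \<in> N \<and> N \<subseteq> points X \<times> V \<and> N \<subseteq> A \<times> B \<and>
       openin (ztop X) A \<and> openin (ztop Y) B \<and> s \<in> tensor A B \<and> t \<in> tensor A B \<and>
       (\<forall>r\<in>N. t r \<noteq> 0 \<and> f (snd r) = s r / t r)"
    by (intro exI[of _ "points X \<times> V"] exI[of _ "points X"] exI[of _ V] exI[of _ "\<lambda>p. f (snd p)"]
        exI[of _ "\<lambda>_. 1"] conjI open_Times tensor_const assms o p) simp_all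
qed

lemma regular_map_fst: "regular_map XY (points XY) X (points X) fst"
proof (rule regular_mapI)
  show "fst ` points XY \<subseteq> points X" by (auto simp: points_XY)
  fix O' assume O': "openin (ztop X) O'" "O' \<subseteq> points X"
  then have eq: "{x \<in> points XY. fst x \<in> O'} = O' \<times> points Y" by (auto simp: points_XY)
  show "openin (ztop XY) {x \<in> points XY. fst x \<in> O'}" unfolding eq by (intro open_Times O') simp
  fix f assume "reg X O' f"
  then show "reg XY {x \<in> points XY. fst x \<in> O'} (\<lambda>x. f (fst x))" unfolding eq by (rule reg_fst[OF O'(1)])
qed

lemma regular_map_snd: "regular_map XY (points XY) Y (points Y) snd"
proof (rule regular_mapI)
  show "snd ` points XY \<subseteq> points Y" by (auto simp: points_XY)
  fix O' assume O': "openin (ztop Y) O'" "O' \<subseteq> points Y"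
  then have eq: "{x \<in> points XY. snd x \<in> O'} = points X \<times> O'" by (auto simp: points_XY)
  show "openin (ztop XY) {x \<in> points XY. snd x \<in> O'}" unfolding eq by (intro open_Times O') simp
  fix f assume "reg Y O' f"
  then show "reg XY {x \<in> points XY. snd x \<in> O'} (\<lambda>x. f (snd x))" unfolding eq by (rule reg_snd[OF O'(1)])
qed

lemma reg_tensor_pullback:
  assumes Z: "fspace_ring Z" and A: "openin (ztop Z) A"
    and \<phi>: "regular_map Z A X (points X) \<phi>" and \<psi>: "regular_map Z A Y (points Y) \<psi>"
    and U: "openin (ztop X) U" and V: "openin (ztop Y) V" and t: "t \<in> tensor U V"
  shows "openin (ztop Z) {z \<in> A. \<phi> z \<in> U \<and> \<psi> z \<in> V}"
    and "reg Z {z \<in> A. \<phi> z \<in> U \<and> \<psi> z \<in> V} (\<lambda>z. t (\<phi> z, \<psi> z))"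
proof -
  interpret Z: fspace_ring Z by fact
  let ?N = "{z \<in> A. \<phi> z \<in> U \<and> \<psi> z \<in> V}"
  have UV: "U \<subseteq> points X" "V \<subseteq> points Y" using U V openin_subset by blast+
  have "?N = {z \<in> A. \<phi> z \<in> U} \<inter> {z \<in> A. \<psi> z \<in> V}" by blast
  then show op: "openin (ztop Z) ?N"
    using regular_map_open[OF \<phi> U UV(1)] regular_map_open[OF \<psi> V UV(2)] by (simp add: openin_Int)
  obtain n :: nat and a b where t: "t = (\<lambda>(x, y). \<Sum>i<n. a i x * b i y)"
    "\<forall>i<n. reg X U (a i)" "\<forall>i<n. reg Y V (b i)"
    using t by (rule tensorE)
  have "reg Z ?N (\<lambda>z. a i (\<phi> z))" "reg Z ?N (\<lambda>z. b i (\<psi> z))" if "i < n" for i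
    using Z.reg_restrict[OF regular_map_reg[OF \<phi> U UV(1) t(2)[rule_format, OF that]] op]
      Z.reg_restrict[OF regular_map_reg[OF \<psi> V UV(2) t(3)[rule_format, OF that]] op] by blast+
  then have "reg Z ?N (\<lambda>z. \<Sum>i<n. a i (\<phi> z) * b i (\<psi> z))"
    by (intro Z.reg_sum[OF op] Z.reg_mult) auto
  then show "reg Z ?N (\<lambda>z. t (\<phi> z, \<psi> z))" by (simp add: t(1))
qed

text \<open>The universal property of the product: pulled back along a pair of regular maps, a tensor is a sum of products
of regular functions.\<close>

lemma regular_map_pair:
  assumes Z: "fspace_ring Z" and A: "openin (ztop Z) A"
    and \<phi>: "regular_map Z A X (points X) \<phi>" and \<psi>: "regular_map Z A Y (points Y) \<psi>"
  shows "regular_map Z A XY (points XY) (\<lambda>z. (\<phi> z, \<psi> z))"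
proof (rule regular_mapI)
  interpret Z: fspace_ring Z by fact
  show img: "(\<lambda>z. (\<phi> z, \<psi> z)) ` A \<subseteq> points XY"
    using \<phi> \<psi> unfolding regular_map_def points_XY by blast
  have pre: "openin (ztop Z) {z \<in> A. (\<phi> z, \<psi> z) \<in> O'}" if "openin (ztop XY) O'" for O'
  proof -
    have "generate_topology_on {{p \<in> U \<times> V. t p \<noteq> 0} | U V t.
        openin (ztop X) U \<and> openin (ztop Y) V \<and> t \<in> tensor U V} O'"
      using that unfolding ztop_XY product_ztop_def openin_topology_generated_by_iff .
    then show ?thesis
    proof induction
      case Empty
      show ?case by simp
    next
      case (Int a b)
      have "{z \<in> A. (\<phi> z, \<psi> z) \<in> a \<inter> b} = {z \<in> A. (\<phi> z, \<psi> z) \<in> a} \<inter> {z \<in> A. (\<phi> z, \<psi> z) \<in> b}" by blast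
      then show ?case using Int by (simp add: openin_Int)
    next
      case (UN K)
      have "{z \<in> A. (\<phi> z, \<psi> z) \<in> \<Union>K} = (\<Union>k\<in>K. {z \<in> A. (\<phi> z, \<psi> z) \<in> k})" by blast
      then show ?case using UN by auto
    next
      case (Basis s)
      then obtain U V t where s: "s = {p \<in> U \<times> V. t p \<noteq> 0}" and
        *: "openin (ztop X) U" "openin (ztop Y) V" "t \<in> tensor U V" by blast
      note pb = reg_tensor_pullback[OF Z A \<phi> \<psi> *]
      have "{z \<in> A. (\<phi> z, \<psi> z) \<in> s} = {z \<in> {z \<in> A. \<phi> z \<in> U \<and> \<psi> z \<in> V}. t (\<phi> z, \<psi> z) \<noteq> 0}"
        unfolding s by blast
      then show ?case using Z.open_nonzero[OF pb] by simp
    qed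
  qed
  fix O' assume O': "openin (ztop XY) O'" "O' \<subseteq> points XY"
  from pre[OF O'(1)] show "openin (ztop Z) {z \<in> A. (\<phi> z, \<psi> z) \<in> O'}" .
  fix f assume f: "reg XY O' f"
  show "reg Z {z \<in> A. (\<phi> z, \<psi> z) \<in> O'} (\<lambda>z. f (\<phi> z, \<psi> z))"
  proof (rule Z.reg_local)
    fix z assume z: "z \<in> {z \<in> A. (\<phi> z, \<psi> z) \<in> O'}"
    then have "(\<phi> z, \<psi> z) \<in> O'" by blast
    with f obtain N U V s t where n: "openin (ztop XY) N" "(\<phi> z, \<psi> z) \<in> N" "N \<subseteq> O'" "N \<subseteq> U \<times> V"
       "openin (ztop X) U" "openin (ztop Y) V" "s \<in> tensor U V" "t \<in> tensor U V"
       "\<forall>r\<in>N. t r \<noteq> 0 \<and> f r = s r / t r" by (rule reg_XYE)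
    let ?M = "{z \<in> A. (\<phi> z, \<psi> z) \<in> N}"
    have M: "openin (ztop Z) ?M" by (rule pre[OF n(1)])
    have sub: "?M \<subseteq> {z \<in> A. \<phi> z \<in> U \<and> \<psi> z \<in> V}" using n(4) by blast
    have "reg Z ?M (\<lambda>z. s (\<phi> z, \<psi> z) / t (\<phi> z, \<psi> z))"
      using Z.reg_restrict[OF reg_tensor_pullback(2)[OF Z A \<phi> \<psi> n(5-7)] M sub]
        Z.reg_restrict[OF reg_tensor_pullback(2)[OF Z A \<phi> \<psi> n(5,6,8)] M sub]
      by (rule Z.reg_divide) (use n(9) in simp)
    then have "reg Z ?M (\<lambda>z. f (\<phi> z, \<psi> z))" by (rule Z.reg_cong) (use n(9) in simp)
    then show "\<exists>N. openin (ztop Z) N \<and> z \<in> N \<and> N \<subseteq> {z \<in> A. (\<phi> z, \<psi> z) \<in> O'} \<and>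
      reg Z N (\<lambda>z. f (\<phi> z, \<psi> z))"
      using M n(2,3) z by (intro exI[of _ ?M]) auto
  qed
qed

lemma regular_map_const:
  assumes "fspace_ring Z" "openin (ztop Z) A" "c \<in> points X"
  shows "regular_map Z A X (points X) (\<lambda>_. c)"
proof (rule regular_mapI)
  interpret Z: fspace_ring Z by fact
  show "(\<lambda>_. c) ` A \<subseteq> points X" using assms by auto
  fix O' assume O': "openin (ztop X) O'" "O' \<subseteq> points X"
  have "{x \<in> A. c \<in> O'} = (if c \<in> O' then A else {})" by auto
  then show op: "openin (ztop Z) {x \<in> A. c \<in> O'}" using assms(2) by simp
  fix f show "reg Z {x \<in> A. c \<in> O'} (\<lambda>x. f c)" by (rule Z.reg_const[OF op])
qed

end

lemma (in fspace_ring) regular_map_id: "regular_map X (points X) X (points X) (\<lambda>x. x)"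
proof (rule regular_mapI)
  fix O' assume O': "openin (ztop X) O'" "O' \<subseteq> points X"
  then have eq: "{x \<in> points X. x \<in> O'} = O'" by blast
  then show "openin (ztop X) {x \<in> points X. x \<in> O'}" using O' by simp
  show "reg X {x \<in> points X. x \<in> O'} f" if "reg X O' f" for f using eq that by simp
qed simp

context fspace_product
begin

text \<open>Given nonempty open sets \<open>A\<close> and \<open>B\<close>, choose a vertical slice that meets \<open>A\<close> and one that meets \<open>B\<close>. By
irreducibility of the second factor some height \<open>y\<close> occurs in both, so the horizontal slices of \<open>A\<close> and \<open>B\<close>
at height \<open>y\<close> are nonempty, and they meet by irreducibility of the first factor.\<close>

lemma irreducible_product:
  assumes irrX: "irreducible_top (ztop X)" and irrY: "irreducible_top (ztop Y)"
  shows "irreducible_top (ztop XY)"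
  unfolding irreducible_top_def
proof (intro allI impI, elim conjE)
  interpret YX: fspace_product Y X by unfold_locales
  fix A B assume A: "openin (ztop XY) A" "A \<noteq> {}" and B: "openin (ztop XY) B" "B \<noteq> {}"
  obtain x1 y1 where a: "(x1, y1) \<in> A" using A(2) by auto
  obtain x2 y2 where b: "(x2, y2) \<in> B" using B(2) by auto
  have pts: "x1 \<in> points X" "x2 \<in> points X" "y1 \<in> points Y" "y2 \<in> points Y"
    using a b openin_subset[OF A(1)] openin_subset[OF B(1)] points_XY by auto
  have vertical: "openin (ztop Y) {y \<in> points Y. (x, y) \<in> C}"
    if "openin (ztop XY) C" "x \<in> points X" for C x
    using regular_map_open[OF regular_map_pair[OF Y.fspace_ring_axioms openin_topspace
        regular_map_const[OF Y.fspace_ring_axioms openin_topspace that(2)] Y.regular_map_id] that(1)]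
      openin_subset[OF that(1)] by blast
  have horizontal: "openin (ztop X) {x \<in> points X. (x, y) \<in> C}"
    if "openin (ztop XY) C" "y \<in> points Y" for C y
    using regular_map_open[OF regular_map_pair[OF X.fspace_ring_axioms openin_topspace
        X.regular_map_id YX.regular_map_const[OF X.fspace_ring_axioms openin_topspace that(2)]] that(1)]
      openin_subset[OF that(1)] by blast
  have "{y \<in> points Y. (x1, y) \<in> A} \<inter> {y \<in> points Y. (x2, y) \<in> B} \<noteq> {}"
    by (rule irreducible_topD[OF irrY vertical[OF A(1) pts(1)] vertical[OF B(1) pts(2)]])
      (use a b pts in blast)+
  then obtain y where y: "y \<in> points Y" "(x1, y) \<in> A" "(x2, y) \<in> B" by blast
  have "{x \<in> points X. (x, y) \<in> A} \<inter> {x \<in> points X. (x, y) \<in> B} \<noteq> {}"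
    by (rule irreducible_topD[OF irrX horizontal[OF A(1) y(1)] horizontal[OF B(1) y(1)]])
      (use y pts in blast)+
  then show "A \<inter> B \<noteq> {}" by blast
qed

end

section \<open>Irreducible projective varieties\<close>

text \<open>Functions that restrict to polynomials on all affine lines. Unlike homogeneous polynomials, they are closed under
inhomogeneous substitutions, and this is enough for the identity principle for products
(\<open>line_poly_nonzero_product\<close>).\<close>

definition line_poly :: "('k::field \<Rightarrow> 'v::ab_group_add \<Rightarrow> 'v) \<Rightarrow> ('v \<Rightarrow> 'k) \<Rightarrow> bool"
  where "line_poly scale f \<longleftrightarrow> (\<forall>v w. \<exists>P. \<forall>t. f (v + scale t w) = poly P t)"

lemma line_polyI:
  assumes "\<And>v w t. f (v + scale t w) = poly (P v w) t"
  shows "line_poly scale f"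
  using assms unfolding line_poly_def by blast

lemma line_poly_const: "line_poly scale (\<lambda>_. c)"
  by (rule line_polyI[where P = "\<lambda>_ _. [:c:]"]) simp

lemma line_poly_add:
  assumes "line_poly scale f" "line_poly scale g"
  shows "line_poly scale (\<lambda>v. f v + g v)"
  unfolding line_poly_def
proof (intro allI)
  fix v w
  obtain P Q where "\<forall>t. f (v + scale t w) = poly P t" "\<forall>t. g (v + scale t w) = poly Q t"
    using assms unfolding line_poly_def by meson
  then have "\<forall>t. f (v + scale t w) + g (v + scale t w) = poly (P + Q) t" by simp
  then show "\<exists>R. \<forall>t. f (v + scale t w) + g (v + scale t w) = poly R t" by (rule exI)
qed

lemma line_poly_mult:
  assumes "line_poly scale f" "line_poly scale g"
  shows "line_poly scale (\<lambda>v. f v * g v)"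
  unfolding line_poly_def
proof (intro allI)
  fix v w
  obtain P Q where "\<forall>t. f (v + scale t w) = poly P t" "\<forall>t. g (v + scale t w) = poly Q t"
    using assms unfolding line_poly_def by meson
  then have "\<forall>t. f (v + scale t w) * g (v + scale t w) = poly (P * Q) t" by simp
  then show "\<exists>R. \<forall>t. f (v + scale t w) * g (v + scale t w) = poly R t" by (rule exI)
qed

lemma line_poly_linear:
  assumes "Vector_Spaces.linear scale (*) f"
  shows "line_poly scale f"
  by (rule line_polyI[where P = "\<lambda>v w. [:f v, f w:]"]) (simp add: linear_addD[OF assms] linear_scaleD[OF assms])

lemma line_poly_compose:
  assumes "homogeneous_poly s2 d F"
    and "\<And>\<alpha>. Vector_Spaces.linear s2 (*) \<alpha> \<Longrightarrow> line_poly scale (\<lambda>v. \<alpha> (R v))"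
  shows "line_poly scale (\<lambda>v. F (R v))"
  using assms(1)
  by induction (auto intro: line_poly_const line_poly_add line_poly_mult assms(2))

text \<open>On the line through \<open>v\<close> and \<open>w\<close>, both functions are nonzero polynomials in one variable, hence so is their
product, and it has only finitely many zeros in an infinite field.\<close>

lemma line_poly_nonzero_product:
  fixes scale :: "'k::field_char_0 \<Rightarrow> 'v::ab_group_add \<Rightarrow> 'v"
  assumes vs: "vector_space scale" and S: "module.subspace scale S"
    and f: "line_poly scale f" "v \<in> S" "f v \<noteq> 0" and g: "line_poly scale g" "w \<in> S" "g w \<noteq> 0"
  obtains u where "u \<in> S" "f u \<noteq> 0" "g u \<noteq> 0"
proof -
  interpret vector_space scale by fact
  obtain P where P: "\<forall>t. f (v + scale t (w - v)) = poly P t" using f(1) unfolding line_poly_def by meson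
  obtain Q where Q: "\<forall>t. g (v + scale t (w - v)) = poly Q t" using g(1) unfolding line_poly_def by meson
  have "poly P 0 \<noteq> 0" using P[rule_format, of 0] f(3) by simp
  moreover have "poly Q 1 \<noteq> 0" using Q[rule_format, of 1] g(3) by simp
  ultimately have "P * Q \<noteq> 0" by auto
  then have "finite {t. poly (P * Q) t = 0}" by (rule poly_roots_finite)
  then have "\<exists>t. poly (P * Q) t \<noteq> 0"
    using ex_new_if_finite[OF infinite_UNIV_char_0] by blast
  then obtain t where "poly P t \<noteq> 0" "poly Q t \<noteq> 0" by auto
  moreover have "v + scale t (w - v) \<in> S"
    using S f(2) g(2) by (intro subspace_add subspace_scale subspace_diff)
  ultimately show ?thesis using P Q by (intro that[of "v + scale t (w - v)"]) simp_all
qed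

text \<open>By \<open>zariski_basis\<close> it is enough to intersect the nonvanishing loci of two polynomials.\<close>

lemma (in subvariety) irreducible_criterion:
  assumes prod: "\<And>d p e r u v. \<lbrakk>homogeneous_poly scale d p; homogeneous_poly scale e r;
      u \<noteq> 0; line scale u \<in> Z; p u \<noteq> 0; v \<noteq> 0; line scale v \<in> Z; r v \<noteq> 0\<rbrakk>
      \<Longrightarrow> \<exists>w. w \<noteq> 0 \<and> line scale w \<in> Z \<and> p w \<noteq> 0 \<and> r w \<noteq> 0"
  shows "irreducible_top (ztop PZ)"
  unfolding irreducible_top_def
proof (intro allI impI, elim conjE)
  fix A B assume "openin (ztop PZ) A" "openin (ztop PZ) B" "A \<noteq> {}" "B \<noteq> {}"
  have basic: "\<exists>d p u. homogeneous_poly scale d p \<and> u \<noteq> 0 \<and> line scale u \<in> Z \<and> p u \<noteq> 0 \<and>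
    (\<forall>w. w \<noteq> 0 \<and> line scale w \<in> Z \<and> p w \<noteq> 0 \<longrightarrow> line scale w \<in> A)"
    if A: "openin (ztop PZ) A" "A \<noteq> {}" for A
  proof -
    obtain T where T: "openin (zariski_proj scale) T" "A = T \<inter> Z"
      using A(1) unfolding ztop_PZ openin_subtopology by blast
    obtain l where l: "l \<in> T" "l \<in> Z" using A(2) T(2) by blast
    obtain d p where p: "homogeneous_poly scale d p" "\<exists>v\<in>l. p v \<noteq> 0"
      "{m \<in> proj_points scale UNIV. \<exists>v\<in>m. p v \<noteq> 0} \<subseteq> T"
      using zariski_basis[OF T(1) l(1)] .
    have lp: "l \<in> proj_points scale UNIV" using l(2) Z_points by blast
    obtain u where u: "u \<in> l" "u \<noteq> 0" using lp by (rule proj_point_rep)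
    have lu: "l = line scale u" using proj_pointD[OF lp u] .
    have "p u \<noteq> 0" using homogeneous_poly_line[OF p(1) lp u] p(2) by blast
    moreover have "line scale w \<in> A" if w: "w \<noteq> 0" "line scale w \<in> Z" "p w \<noteq> 0" for w
    proof -
      have "line scale w \<in> {m \<in> proj_points scale UNIV. \<exists>v\<in>m. p v \<noteq> 0}"
        using w Z_points line_self[of w] by (intro CollectI conjI bexI[of _ w]) auto
      with p(3) T(2) w(2) show ?thesis by blast
    qed
    ultimately show ?thesis using p(1) u(2) l(2) lu by (intro exI[of _ d] exI[of _ p] exI[of _ u]) simp
  qed
  obtain d p u where p: "homogeneous_poly scale d p" "u \<noteq> 0" "line scale u \<in> Z" "p u \<noteq> 0"
    "\<forall>w. w \<noteq> 0 \<and> line scale w \<in> Z \<and> p w \<noteq> 0 \<longrightarrow> line scale w \<in> A"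
    using basic[OF \<open>openin (ztop PZ) A\<close> \<open>A \<noteq> {}\<close>] by (elim exE conjE)
  obtain e r v where r: "homogeneous_poly scale e r" "v \<noteq> 0" "line scale v \<in> Z" "r v \<noteq> 0"
    "\<forall>w. w \<noteq> 0 \<and> line scale w \<in> Z \<and> r w \<noteq> 0 \<longrightarrow> line scale w \<in> B"
    using basic[OF \<open>openin (ztop PZ) B\<close> \<open>B \<noteq> {}\<close>] by (elim exE conjE)
  obtain w where w: "w \<noteq> 0" "line scale w \<in> Z" "p w \<noteq> 0" "r w \<noteq> 0"
    using prod[OF p(1) r(1) p(2-4) r(2-4)] by (elim exE conjE)
  then have "line scale w \<in> A \<inter> B" using p(5) r(5) by simp
  then show "A \<inter> B \<noteq> {}" by blast
qed

lemma irreducible_proj_space: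
  fixes scale :: "'k::field_char_0 \<Rightarrow> 'v::ab_group_add \<Rightarrow> 'v"
  assumes vs: "vector_space scale" and S: "module.subspace scale S"
  shows "irreducible_top (ztop (proj_space scale S))"
proof -
  interpret vector_space scale by fact
  interpret subvariety scale "proj_points scale S"
    by unfold_locales (rule proj_points_mono, simp)
  show ?thesis
  proof (rule irreducible_criterion)
    fix d p e r u v
    assume p: "homogeneous_poly scale d p" and r: "homogeneous_poly scale e r"
      and u: "u \<noteq> 0" "line scale u \<in> proj_points scale S" "p u \<noteq> 0"
      and v: "v \<noteq> 0" "line scale v \<in> proj_points scale S" "r v \<noteq> 0"
    obtain \<alpha> where \<alpha>: "Vector_Spaces.linear scale (*) \<alpha>" "\<alpha> u = 1" using u(1) by (rule separating_functional)
    have lp: "line_poly scale f" if "homogeneous_poly scale d f" for f d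
      using line_poly_compose[OF that line_poly_linear] .
    have "u \<in> S" "v \<in> S" using u v line_in_subspace_points[OF S] by simp_all
    moreover have "line_poly scale (\<lambda>w. \<alpha> w * p w)"
      by (intro line_poly_mult line_poly_linear \<alpha>(1) lp[OF p])
    ultimately obtain w where w: "w \<in> S" "\<alpha> w * p w \<noteq> 0" "r w \<noteq> 0"
      using line_poly_nonzero_product[OF vs S, of "\<lambda>w. \<alpha> w * p w" u r v] lp[OF r] u(3) v(3) \<alpha>(2)
      by auto
    then have "w \<noteq> 0" using linear_zeroD[OF \<alpha>(1)] by auto
    with w show "\<exists>w. w \<noteq> 0 \<and> line scale w \<in> proj_points scale S \<and> p w \<noteq> 0 \<and> r w \<noteq> 0"
      by (intro exI[of _ w]) (simp add: line_in_proj_points)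
  qed
qed

section \<open>Regular families of operators\<close>

context finite_dimensional_vector_space
begin

lemma linear_coordinate: "Vector_Spaces.linear scale (*) (\<lambda>v. representation Basis v b)"
proof -
  have "vector_space ((*) :: 'a \<Rightarrow> 'a \<Rightarrow> 'a)" by unfold_locales (auto simp: algebra_simps)
  then show ?thesis unfolding Vector_Spaces.linear_iff
    using vector_space_axioms representation_add[OF independent_Basis] representation_scale[OF independent_Basis]
    by (simp add: span_Basis)
qed

lemma coordinate_expansion: "(\<Sum>b\<in>Basis. scale (representation Basis v b) b) = v"
  by (rule sum_representation_eq[OF independent_Basis _ finite_Basis]) (simp_all add: span_Basis)

lemma linear_expansion:
  assumes "Vector_Spaces.linear scale s2 L"
  shows "L v = (\<Sum>b\<in>Basis. s2 (representation Basis v b) (L b))"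
proof -
  have "L v = L (\<Sum>b\<in>Basis. scale (representation Basis v b) b)" by (simp add: coordinate_expansion)
  also have "\<dots> = (\<Sum>b\<in>Basis. s2 (representation Basis v b) (L b))"
    by (simp add: linear_sumD[OF assms] linear_scaleD[OF assms])
  finally show ?thesis .
qed

lemma vreg_operator:
  assumes X: "fspace_ring X" and N: "openin (ztop X) N"
    and T: "\<And>x. x \<in> N \<Longrightarrow> Vector_Spaces.linear scale s2 (T x)" "\<And>y. vreg X s2 N (\<lambda>x. T x y)"
    and E: "vreg X scale N E"
  shows "vreg X s2 N (\<lambda>x. T x (E x))"
proof -
  interpret X: fspace_ring X by fact
  have "vreg X s2 N (\<lambda>x. \<Sum>b\<in>Basis. s2 (representation Basis (E x) b) (T x b))"
    by (intro X.vreg_sum X.vreg_scale N T(2) vregD[OF E linear_coordinate])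
  then show ?thesis by (rule X.vreg_cong) (simp add: linear_expansion[OF T(1), symmetric])
qed

text \<open>Expand the second argument in the basis; the coefficients are values of the first argument under fixed
functionals.\<close>

lemma reg_bilinear:
  assumes X: "fspace_ring X" and N: "openin (ztop X) N"
    and B: "\<And>v. Vector_Spaces.linear scale (*) (B v)" "\<And>w. Vector_Spaces.linear scale (*) (\<lambda>v. B v w)"
    and E: "vreg X scale N E" and F: "vreg X scale N F"
  shows "reg X N (\<lambda>x. B (E x) (F x))"
proof -
  interpret X: fspace_ring X by fact
  have "reg X N (\<lambda>x. \<Sum>b\<in>Basis. representation Basis (F x) b * B (E x) b)"
    by (intro X.reg_sum X.reg_mult N vregD[OF F linear_coordinate] vregD[OF E B(2)])
  then show ?thesis by (rule X.reg_cong) (simp add: linear_expansion[OF B(1), symmetric])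
qed

text \<open>An enumeration of the basis turns operators into matrices, for which determinants are available.\<close>

definition enum :: "nat \<Rightarrow> 'b"
  where "enum = (SOME e. bij_betw e {0..<card Basis} Basis)"

lemma bij_betw_enum: "bij_betw enum {0..<card Basis} Basis"
  unfolding enum_def by (rule someI_ex[OF ex_bij_betw_nat_finite[OF finite_Basis]])

lemma enum_in: "i < card Basis \<Longrightarrow> enum i \<in> Basis"
  using bij_betw_enum by (auto simp: bij_betw_def)

definition op_mat :: "('b \<Rightarrow> 'b) \<Rightarrow> 'a mat"
  where "op_mat T = mat (card Basis) (card Basis) (\<lambda>(i, j). representation Basis (T (enum j)) (enum i))"

definition coord_vec :: "'b \<Rightarrow> 'a vec"
  where "coord_vec y = vec (card Basis) (\<lambda>i. representation Basis y (enum i))"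

lemma op_mat_carrier: "op_mat T \<in> carrier_mat (card Basis) (card Basis)"
  by (simp add: op_mat_def)

lemma coord_vec_carrier: "coord_vec y \<in> carrier_vec (card Basis)"
  by (simp add: coord_vec_def)

lemma sum_enum: "(\<Sum>b\<in>Basis. f b) = (\<Sum>i\<in>{0..<card Basis}. f (enum i))"
  by (rule sum.reindex_bij_betw[OF bij_betw_enum, symmetric])

lemma op_mat_mult:
  assumes "Vector_Spaces.linear scale scale T"
  shows "op_mat T *\<^sub>v coord_vec y = coord_vec (T y)"
proof (rule eq_vecI)
  fix i assume "i < dim_vec (coord_vec (T y))"
  then have i: "i < card Basis" by (simp add: coord_vec_def)
  have "representation Basis (T y) (enum i) =
      (\<Sum>b\<in>Basis. representation Basis y b * representation Basis (T b) (enum i))"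
    using linear_expansion[OF linear_composeD[OF assms linear_coordinate]] .
  also have "\<dots> = (\<Sum>j\<in>{0..<card Basis}.
      representation Basis (T (enum j)) (enum i) * representation Basis y (enum j))"
    by (simp add: sum_enum mult.commute)
  finally show "(op_mat T *\<^sub>v coord_vec y) $ i = coord_vec (T y) $ i"
    using i by (simp add: op_mat_def coord_vec_def scalar_prod_def)
qed (simp add: op_mat_def coord_vec_def)

lemma coord_vec_eq_0_iff: "coord_vec y = 0\<^sub>v (card Basis) \<longleftrightarrow> y = 0"
proof
  assume "coord_vec y = 0\<^sub>v (card Basis)"
  then have "representation Basis y (enum i) = 0" if "i < card Basis" for i
    using that by (metis coord_vec_def index_vec index_zero_vec(1))
  then have "(\<Sum>b\<in>Basis. scale (representation Basis y b) b) = 0" by (simp add: sum_enum)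
  then show "y = 0" by (simp add: coordinate_expansion)
qed (auto simp: coord_vec_def representation_zero)

lemma coord_vec_surj:
  assumes "v \<in> carrier_vec (card Basis)"
  obtains y where "coord_vec y = v"
proof -
  define y where "y = (\<Sum>j\<in>{0..<card Basis}. scale (v $ j) (enum j))"
  have "representation Basis y (enum i) = v $ i" if i: "i < card Basis" for i
  proof -
    have delta: "representation Basis (enum j) (enum i) = (if i = j then 1 else 0)" if "j < card Basis" for j
      using representation_basis[OF independent_Basis enum_in[OF that]] bij_betw_enum i that
      by (auto simp: bij_betw_def inj_on_def)
    have "representation Basis y (enum i) = (\<Sum>j\<in>{0..<card Basis}. v $ j * representation Basis (enum j) (enum i))"
      unfolding y_def by (simp add: linear_sumD[OF linear_coordinate] linear_scaleD[OF linear_coordinate])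
    also have "\<dots> = (\<Sum>j\<in>{0..<card Basis}. if i = j then v $ j else 0)"
      by (rule sum.cong) (auto simp: delta)
    also have "\<dots> = v $ i" using i by simp
    finally show ?thesis .
  qed
  then have "coord_vec y = v" using assms by (intro eq_vecI) (auto simp: coord_vec_def)
  then show ?thesis by (rule that)
qed

text \<open>A singular matrix has a nonzero kernel vector, and an endomorphism of a finite-dimensional space is bijective as
soon as its kernel vanishes.\<close>

lemma det_op_mat_eq_0_iff:
  assumes T: "Vector_Spaces.linear scale scale T"
  shows "det (op_mat T) = 0 \<longleftrightarrow> \<not> bij T"
proof -
  have "det (op_mat T) = 0 \<longleftrightarrow> (\<exists>y. y \<noteq> 0 \<and> T y = 0)"
  proof
    assume "det (op_mat T) = 0"
    then obtain v where v: "v \<in> carrier_vec (card Basis)" "v \<noteq> 0\<^sub>v (card Basis)"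
      "op_mat T *\<^sub>v v = 0\<^sub>v (card Basis)"
      using det_0_iff_vec_prod_zero_field[OF op_mat_carrier] by auto
    obtain y where y: "coord_vec y = v" using v(1) by (rule coord_vec_surj)
    show "\<exists>y. y \<noteq> 0 \<and> T y = 0"
      using v(2,3) op_mat_mult[OF T, of y] by (auto simp: y[symmetric] coord_vec_eq_0_iff)
  next
    assume "\<exists>y. y \<noteq> 0 \<and> T y = 0"
    then obtain y where y: "y \<noteq> 0" "T y = 0" by blast
    have "coord_vec y \<noteq> 0\<^sub>v (card Basis)" "op_mat T *\<^sub>v coord_vec y = 0\<^sub>v (card Basis)"
      using y op_mat_mult[OF T, of y] by (simp_all add: coord_vec_eq_0_iff)
    then show "det (op_mat T) = 0"
      using det_0_iff_vec_prod_zero_field[OF op_mat_carrier] coord_vec_carrier by blast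
  qed
  moreover have "(\<exists>y. y \<noteq> 0 \<and> T y = 0) \<longleftrightarrow> \<not> inj T"
  proof -
    have "inj T \<longleftrightarrow> (\<forall>y. T y = 0 \<longrightarrow> y = 0)"
    proof
      assume "inj T"
      then show "\<forall>y. T y = 0 \<longrightarrow> y = 0" using linear_zeroD[OF T] by (metis injD)
    next
      assume ker: "\<forall>y. T y = 0 \<longrightarrow> y = 0"
      show "inj T"
      proof (rule injI)
        fix x y assume "T x = T y"
        then have "T (x - y) = 0" by (simp add: linear_diffD[OF T])
        with ker have "x - y = 0" by blast
        then show "x = y" by simp
      qed
    qed
    then show ?thesis by blast
  qed
  moreover have "inj T \<longleftrightarrow> bij T" using linear_inj_imp_surj[OF T] by (auto simp: bij_def)
  ultimately show ?thesis by simp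
qed

lemma reg_det:
  assumes X: "fspace_ring X" and N: "openin (ztop X) N"
    and M: "\<And>x. M x \<in> carrier_mat n n" "\<And>i j. \<lbrakk>i < n; j < n\<rbrakk> \<Longrightarrow> reg X N (\<lambda>x. M x $$ (i, j))"
  shows "reg X N (\<lambda>x. det (M x) :: 'a)"
proof -
  interpret X: fspace_ring X by fact
  have "reg X N (\<lambda>x. \<Sum>p\<in>{p. p permutes {0..<n}}. signof p * (\<Prod>i = 0..<n. M x $$ (i, p i)))"
    by (intro X.reg_sum X.reg_mult X.reg_prod X.reg_const N M) (auto simp: permutes_in_image)
  then show ?thesis by (simp add: det_def'[OF M(1)])
qed

lemma
  assumes X: "fspace_ring X" and N: "openin (ztop X) N"
    and T: "\<And>x. x \<in> N \<Longrightarrow> Vector_Spaces.linear scale scale (T x)" "\<And>y. vreg X scale N (\<lambda>x. T x y)"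
  shows open_bij: "openin (ztop X) {x \<in> N. bij (T x)}"
    and vreg_inv: "\<lbrakk>\<And>x. x \<in> N \<Longrightarrow> bij (T x); vreg X scale N E\<rbrakk> \<Longrightarrow> vreg X scale N (\<lambda>x. inv_into UNIV (T x) (E x))"
proof -
  interpret X: fspace_ring X by fact
  have mat: "reg X N (\<lambda>x. op_mat (T x) $$ (i, j))" if "i < card Basis" "j < card Basis" for i j
    using vregD[OF T(2) linear_coordinate, of "enum j" "enum i"] that by (simp add: op_mat_def)
  have det: "reg X N (\<lambda>x. det (op_mat (T x)))"
    by (rule reg_det[OF X N op_mat_carrier mat])
  have "{x \<in> N. bij (T x)} = {x \<in> N. det (op_mat (T x)) \<noteq> 0}"
    using det_op_mat_eq_0_iff[OF T(1)] by blast
  then show "openin (ztop X) {x \<in> N. bij (T x)}" using X.open_nonzero[OF N det] by simp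
  assume bij: "\<And>x. x \<in> N \<Longrightarrow> bij (T x)" and E: "vreg X scale N E"
  have nz: "det (op_mat (T x)) \<noteq> 0" if "x \<in> N" for x
    using det_op_mat_eq_0_iff[OF T(1)[OF that]] bij[OF that] by simp
  let ?R = "\<lambda>k x. replace_col (op_mat (T x)) (coord_vec (E x)) k"
  have cramer: "representation Basis (inv_into UNIV (T x) (E x)) (enum k) = det (?R k x) / det (op_mat (T x))"
    if "x \<in> N" "k < card Basis" for x k
  proof -
    have "T x (inv_into UNIV (T x) (E x)) = E x" using bij[OF that(1)] by (simp add: bij_is_surj surj_f_inv_f)
    then have "op_mat (T x) *\<^sub>v coord_vec (inv_into UNIV (T x) (E x)) = coord_vec (E x)"
      using op_mat_mult[OF T(1)[OF that(1)]] by simp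
    then have "det (?R k x) = coord_vec (inv_into UNIV (T x) (E x)) $ k * det (op_mat (T x))"
      using cramer_lemma_mat[OF op_mat_carrier coord_vec_carrier that(2)] by metis
    then show ?thesis using nz[OF that(1)] that(2) by (simp add: coord_vec_def)
  qed
  have "reg X N (\<lambda>x. det (?R k x))" for k
  proof (rule reg_det[OF X N, of _ "card Basis"])
    show "?R k x \<in> carrier_mat (card Basis) (card Basis)" for x
      by (simp add: replace_col_def op_mat_def)
    show "reg X N (\<lambda>x. ?R k x $$ (i, j))" if "i < card Basis" "j < card Basis" for i j
    proof (cases "j = k")
      case True
      then show ?thesis using that vregD[OF E linear_coordinate, of "enum i"]
        by (simp add: replace_col_def op_mat_def coord_vec_def)
    next
      case False
      then show ?thesis using that mat[OF that] by (simp add: replace_col_def op_mat_def)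
    qed
  qed
  then have "vreg X scale N (\<lambda>x. \<Sum>k\<in>{0..<card Basis}. scale (det (?R k x) / det (op_mat (T x))) (enum k))"
    by (intro X.vreg_sum X.vreg_scale X.reg_divide X.vreg_const N det nz)
  then show "vreg X scale N (\<lambda>x. inv_into UNIV (T x) (E x))"
  proof (rule X.vreg_cong)
    fix x assume x: "x \<in> N"
    have "(\<Sum>k\<in>{0..<card Basis}. scale (det (?R k x) / det (op_mat (T x))) (enum k)) =
      (\<Sum>b\<in>Basis. scale (representation Basis (inv_into UNIV (T x) (E x)) b) b)"
      unfolding sum_enum by (rule sum.cong) (simp_all add: cramer[OF x])
    then show "(\<Sum>k\<in>{0..<card Basis}. scale (det (?R k x) / det (op_mat (T x))) (enum k)) = inv_into UNIV (T x) (E x)"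
      by (simp add: coordinate_expansion)
  qed
qed

end

section \<open>Quadratic forms and quadrics\<close>

locale quadratic_space = finite_dimensional_vector_space scale Basis
  for scale :: "'k::field_char_0 \<Rightarrow> 'v::ab_group_add \<Rightarrow> 'v" and Basis +
  fixes q :: "'v \<Rightarrow> 'k"
  assumes quadratic: "quadratic_form scale q" and nondegenerate: "nondegenerate q"
begin

abbreviation "B \<equiv> polar q"

lemma B_sym: "B v w = B w v"
  by (simp add: polar_def add.commute)

lemma linear_B: "Vector_Spaces.linear scale (*) (B v)"
  using quadratic by (simp add: quadratic_form_def)

lemma linear_B_left: "Vector_Spaces.linear scale (*) (\<lambda>v. B v w)"
  using linear_B[of w] by (simp add: B_sym[of _ w])

lemmas B_simps = linear_simps[OF linear_B] linear_simps[OF linear_B_left]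

lemma q_scale: "q (scale c v) = c\<^sup>2 * q v"
  using quadratic by (simp add: quadratic_form_def)

lemma q_polar: "q v = B v v"
proof -
  have "v + v = scale 2 v" using scale_left_distrib[of 1 1 v] by simp
  then show ?thesis by (simp add: polar_def q_scale power2_eq_square)
qed

lemma q_add: "q (v + w) = q v + 2 * B v w + q w"
  by (simp add: polar_def field_simps)

lemma q_diff: "q (v - w) = q v - 2 * B v w + q w"
  using B_sym[of w v] by (simp add: q_polar B_simps algebra_simps)

lemma B_nonzero:
  assumes "v \<noteq> 0"
  obtains w where "B v w \<noteq> 0"
  using nondegenerate assms unfolding nondegenerate_def by blast

lemma reg_B:
  "\<lbrakk>fspace_ring X; openin (ztop X) N; vreg X scale N E; vreg X scale N F\<rbrakk> \<Longrightarrow> reg X N (\<lambda>x. B (E x) (F x))"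
  by (rule reg_bilinear[OF _ _ linear_B linear_B_left])

lemma reg_q:
  "\<lbrakk>fspace_ring X; openin (ztop X) N; vreg X scale N E\<rbrakk> \<Longrightarrow> reg X N (\<lambda>x. q (E x))"
  using reg_B[of X N E E] by (simp add: q_polar[symmetric])

lemma line_poly_q: "line_poly scale q"
  by (rule line_polyI[where P = "\<lambda>v w. [:q v, 2 * B v w, q w:]"])
    (simp add: q_add q_scale B_simps power2_eq_square algebra_simps)

text \<open>By nondegeneracy, \<open>a \<mapsto> B a\<close> is injective. The dual space is not a vector space on a type here, so a functional is
encoded by the vector whose coordinates are its values on the basis; then injective endomorphisms are
surjective.\<close>

lemma riesz:
  assumes \<alpha>: "Vector_Spaces.linear scale (*) \<alpha>"
  obtains a where "\<And>v. B a v = \<alpha> v"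
proof -
  define D where "D a = (\<Sum>b\<in>Basis. scale (B a b) b)" for a
  have coord: "representation Basis (\<Sum>b\<in>Basis. scale (f b) b) c = f c" if "c \<in> Basis" for f c
  proof -
    have "representation Basis (\<Sum>b\<in>Basis. scale (f b) b) c = (\<Sum>b\<in>Basis. f b * representation Basis b c)"
      by (simp add: linear_sumD[OF linear_coordinate] linear_scaleD[OF linear_coordinate])
    also have "\<dots> = (\<Sum>b\<in>Basis. if c = b then f b else 0)"
      by (rule sum.cong) (auto simp: representation_basis[OF independent_Basis])
    also have "\<dots> = f c" using that finite_Basis by simp
    finally show ?thesis .
  qed
  have ext: "B a v = \<beta> v" if "Vector_Spaces.linear scale (*) \<beta>" "\<forall>b\<in>Basis. B a b = \<beta> b" for a \<beta> v
    using linear_expansion[OF linear_B, of a v] linear_expansion[OF that(1), of v] that(2) by simp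
  have D: "Vector_Spaces.linear scale scale D"
    unfolding Vector_Spaces.linear_iff D_def using vector_space_axioms
    by (simp add: B_simps scale_left_distrib sum.distrib scale_sum_right)
  have "inj D"
  proof (rule injI)
    fix x y assume "D x = D y"
    then have "D (x - y) = 0" by (simp add: linear_diffD[OF D])
    then have rep0: "representation Basis (D (x - y)) c = 0" for c by (simp add: representation_zero)
    have "\<forall>b\<in>Basis. B (x - y) b = 0"
    proof
      fix c assume "c \<in> Basis"
      from coord[OF this, of "B (x - y)"] show "B (x - y) c = 0"
        using rep0[of c] unfolding D_def by (rule trans[OF sym])
    qed
    then have "B (x - y) v = 0" for v
      by (subst linear_expansion[OF linear_B]) simp
    then have "x - y = 0" using nondegenerate unfolding nondegenerate_def by blast
    then show "x = y" by simp
  qed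
  then have "surj D" by (rule linear_inj_imp_surj[OF D])
  then obtain a where a: "D a = (\<Sum>b\<in>Basis. scale (\<alpha> b) b)" by (metis surjD)
  have "B a b = \<alpha> b" if "b \<in> Basis" for b
    using coord[OF that, of "B a"] coord[OF that, of \<alpha>] a unfolding D_def by simp
  then show ?thesis using ext[OF \<alpha>] by (intro that[of a]) simp
qed

text \<open>The line through an isotropic \<open>x\<close> and a vector \<open>z\<close> meets the quadric again in this point. For \<open>B x z = 0\<close> and
\<open>q z \<noteq> 0\<close> the line is tangent and the point is \<open>x\<close> itself; for isotropic \<open>z\<close> it is \<open>z\<close>.\<close>

definition second_point :: "'v \<Rightarrow> 'v \<Rightarrow> 'v"
  where "second_point x z = scale (q z) x - scale (2 * B x z) z"

lemma q_second_point: "q x = 0 \<Longrightarrow> q (second_point x z) = 0"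
  using B_sym[of z x]
  by (simp add: second_point_def q_diff q_scale B_simps q_polar[symmetric] power2_eq_square algebra_simps)

lemma B_second_point: "B x y = 0 \<Longrightarrow> B y (second_point x z) = - (2 * B x z * B y z)"
  using B_sym[of y x] by (simp add: second_point_def B_simps)

lemma second_point_nonzero:
  assumes "q x = 0" "B x z \<noteq> 0"
  shows "second_point x z \<noteq> 0"
proof
  assume "second_point x z = 0"
  then have "B x (second_point x z) = 0" by (simp add: B_simps)
  with assms show False by (simp add: B_second_point q_polar[symmetric])
qed

lemma line_poly_second_point:
  assumes "homogeneous_poly scale d F"
  shows "line_poly scale (\<lambda>z. F (second_point x z))"
proof (rule line_poly_compose[OF assms])
  fix \<alpha> assume \<alpha>: "Vector_Spaces.linear scale (*) \<alpha>"
  have "line_poly scale (\<lambda>z. q z * \<alpha> x + (- 2 * B x z) * \<alpha> z)"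
    by (intro line_poly_add line_poly_mult line_poly_const line_poly_q line_poly_linear linear_B \<alpha>)
  moreover have "\<alpha> (second_point x z) = q z * \<alpha> x + (- 2 * B x z) * \<alpha> z" for z
    by (simp add: second_point_def linear_diffD[OF \<alpha>] linear_scaleD[OF \<alpha>])
  ultimately show "line_poly scale (\<lambda>z. \<alpha> (second_point x z))" by simp
qed

abbreviation "cone_lines \<equiv> {l \<in> proj_points scale UNIV. \<forall>v\<in>l. q v = 0}"

lemma subvariety_quadric: "subvariety scale cone_lines"
  by unfold_locales blast

lemma quadric_eq: "quadric scale q = proj_subvariety scale cone_lines"
  by (simp add: quadric_def)

lemma line_in_cone_lines: "v \<noteq> 0 \<Longrightarrow> line scale v \<in> cone_lines \<longleftrightarrow> q v = 0"
  using line_self[of v] by (auto simp: line_def q_scale intro: line_in_proj_points[unfolded line_def])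

text \<open>Let \<open>p\<close> and \<open>r\<close> be polynomials that do not vanish at the points \<open>u\<close> and \<open>v\<close> of the quadric. The map
\<open>z \<mapsto> second_point v z\<close> parametrizes the quadric by an irreducible space; \<open>r\<close> is nonzero on it, since a tangent
direction \<open>z\<close> gives \<open>v\<close>, and \<open>p\<close> is nonzero on it provided that \<open>p\<close> does not vanish at some point that is not
orthogonal to \<open>v\<close>. The auxiliary fact \<open>move\<close> supplies such a point, by a parametrization from \<open>u\<close> instead
of \<open>v\<close>.\<close>

lemma irreducible_quadric:
  assumes tangent: "\<And>x. \<lbrakk>x \<noteq> 0; q x = 0\<rbrakk> \<Longrightarrow> \<exists>z. B x z = 0 \<and> q z \<noteq> 0"
  shows "irreducible_top (ztop (quadric scale q))"
proof -
  interpret subvariety scale cone_lines by (rule subvariety_quadric)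
  note nz_product = line_poly_nonzero_product[OF vector_space_axioms subspace_UNIV _ UNIV_I _ _ UNIV_I]
  have tangential: "\<exists>z. F (second_point x z) \<noteq> 0"
    if F: "homogeneous_poly scale d F" "x \<noteq> 0" "q x = 0" "F x \<noteq> 0" for d F x
  proof -
    obtain z where z: "B x z = 0" "q z \<noteq> 0" using tangent[OF F(2,3)] by blast
    then have "second_point x z = scale (q z) x" by (simp add: second_point_def)
    then have "F (second_point x z) \<noteq> 0" using z F(4) homogeneous_poly_scale[OF F(1)] by simp
    then show ?thesis by blast
  qed
  have move: "\<exists>y. q y = 0 \<and> F y \<noteq> 0 \<and> B x y \<noteq> 0"
    if F: "homogeneous_poly scale d F" "y \<noteq> 0" "q y = 0" "F y \<noteq> 0" and x: "x \<noteq> 0" for d F x y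
  proof (cases "B x y = 0")
    case True
    obtain z1 where z1: "F (second_point y z1) \<noteq> 0" using tangential[OF F] by blast
    obtain z2 where z2: "B x z2 \<noteq> 0" using x by (rule B_nonzero)
    obtain z3 where z3: "B y z3 \<noteq> 0" using F(2) by (rule B_nonzero)
    obtain z4 where z4: "B x z4 * B y z4 \<noteq> 0"
      using nz_product[OF line_poly_linear[OF linear_B] z2 line_poly_linear[OF linear_B] z3] by auto
    obtain z where "F (second_point y z) \<noteq> 0" "B x z * B y z \<noteq> 0"
      using nz_product[OF line_poly_second_point[OF F(1)] z1
        line_poly_mult[OF line_poly_linear[OF linear_B] line_poly_linear[OF linear_B]] z4] by auto
    then show ?thesis using q_second_point[OF F(3)] B_second_point[of y x z] True B_sym[of x y]
      by (intro exI[of _ "second_point y z"]) simp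
  qed (use that in blast)
  have "irreducible_top (ztop PZ)"
  proof (rule irreducible_criterion)
    fix d p e r u v
    assume p: "homogeneous_poly scale d p" and r: "homogeneous_poly scale e r"
      and u: "u \<noteq> 0" "line scale u \<in> cone_lines" "p u \<noteq> 0"
      and v: "v \<noteq> 0" "line scale v \<in> cone_lines" "r v \<noteq> 0"
    have qu: "q u = 0" and qv: "q v = 0" using u(1,2) v(1,2) line_in_cone_lines by blast+
    obtain y where y: "q y = 0" "p y \<noteq> 0" "B v y \<noteq> 0" using move[OF p u(1) qu u(3) v(1)] by blast
    obtain z1 where z1: "r (second_point v z1) \<noteq> 0" using tangential[OF r v(1) qv v(3)] by blast
    have "second_point v y = scale (- (2 * B v y)) y" using y(1) by (simp add: second_point_def)
    then have "p (second_point v y) = (- (2 * B v y)) ^ d * p y"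
      by (simp only: homogeneous_poly_scale[OF p])
    then have "B v y * p (second_point v y) \<noteq> 0" using y by simp
    then obtain z where z: "B v z * p (second_point v z) \<noteq> 0" "r (second_point v z) \<noteq> 0"
      using nz_product[OF line_poly_mult[OF line_poly_linear[OF linear_B] line_poly_second_point[OF p]] _
          line_poly_second_point[OF r] z1, of v y v] by auto
    let ?w = "second_point v z"
    have "?w \<noteq> 0" by (rule second_point_nonzero[OF qv]) (use z(1) in auto)
    then show "\<exists>w. w \<noteq> 0 \<and> line scale w \<in> cone_lines \<and> p w \<noteq> 0 \<and> r w \<noteq> 0"
      using line_in_cone_lines[of ?w] q_second_point[OF qv] z by (intro exI[of _ ?w]) simp
  qed
  then show ?thesis by (simp add: quadric_eq)
qed

text \<open>If \<open>q\<close> vanishes on the orthogonal complement of \<open>x\<close>, then this complement is totally isotropic, so it is contained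
in its own complement, the line of \<open>x\<close>. Hence \<open>V\<close> is a hyperbolic plane, and the quadric consists of the two
points \<open>x\<close> and \<open>y\<close>, both open in it, so it contains no irreducible closed set with more than one point.\<close>

lemma tangent_of_positive_dimension:
  assumes dim: "krull_dim (ztop (quadric scale q)) > 0" and x: "x \<noteq> 0" "q x = 0"
  shows "\<exists>z. B x z = 0 \<and> q z \<noteq> 0"
proof (rule ccontr)
  assume "\<not> (\<exists>z. B x z = 0 \<and> q z \<noteq> 0)"
  then have iso: "q z = 0" if "B x z = 0" for z using that by blast
  interpret subvariety scale cone_lines by (rule subvariety_quadric)
  obtain f where f: "B x f \<noteq> 0" using x(1) by (rule B_nonzero)
  have iso2: "B z z' = 0" if "B x z = 0" "B x z' = 0" for z z'
    using iso[OF that(1)] iso[OF that(2)] iso[of "z + z'"] that by (simp add: polar_def[of q z z'] B_simps)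
  have perp: "\<exists>a. z = scale a x" if z: "B x z = 0" for z
  proof -
    define a where "a = B z f / B x f"
    have "B (z - scale a x) v = 0" for v
    proof -
      define s where "s = B x v / B x f"
      have "B x (v - scale s f) = 0" using f by (simp add: s_def B_simps)
      moreover have "B x (z - scale a x) = 0" using z x(2) by (simp add: B_simps q_polar[symmetric])
      ultimately have "B (z - scale a x) (v - scale s f) = 0" by (rule iso2[rotated])
      moreover have "B (z - scale a x) f = 0" using f by (simp add: a_def B_simps)
      ultimately show ?thesis by (simp add: B_simps)
    qed
    then have "z - scale a x = 0" using nondegenerate unfolding nondegenerate_def by blast
    then show ?thesis by auto
  qed
  \<comment> \<open>Move \<open>f\<close> along \<open>x\<close> to an isotropic vector; this does not change \<open>B x f\<close>.\<close>
  define y where "y = f - scale (q f / (2 * B x f)) x"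
  have Bxy: "B x y \<noteq> 0" using f x(2) by (simp add: y_def B_simps q_polar[symmetric])
  have Byx: "B y x \<noteq> 0" using Bxy B_sym by simp
  have Bxx: "B x x = 0" using x(2) by (simp add: q_polar)
  have qy: "q y = 0" using f x(2) B_sym[of f x] by (simp add: y_def q_diff q_scale B_simps)
  then have Byy: "B y y = 0" by (simp add: q_polar)
  have two: "l = line scale x \<or> l = line scale y" if l: "l \<in> cone_lines" for l
  proof -
    have lp: "l \<in> proj_points scale UNIV" using l by blast
    obtain v where v: "v \<in> l" "v \<noteq> 0" using lp by (rule proj_point_rep)
    have lv: "l = line scale v" by (rule proj_pointD[OF lp v])
    have qv: "q v = 0" using l v(1) by blast
    define s where "s = B x v / B x f"
    have "B x (v - scale s f) = 0" using f by (simp add: s_def B_simps)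
    then obtain a where "v - scale s f = scale a x" using perp by blast
    then have va: "v = scale a x + scale s f" by (simp add: algebra_simps)
    show ?thesis
    proof (cases "s = 0")
      case True
      with va v(2) have "v = scale a x" "a \<noteq> 0" by auto
      with lv line_scale show ?thesis by blast
    next
      case False
      have "2 * a * s * B x f + s\<^sup>2 * q f = 0"
        using qv x(2) unfolding va by (simp add: q_add q_scale B_simps mult_ac)
      then have "s * (2 * a * B x f + s * q f) = 0" by (simp add: algebra_simps power2_eq_square)
      with False have "2 * a * B x f + s * q f = 0" by (simp only: mult_eq_0_iff simp_thms)
      then have "a = - (s * (q f / (2 * B x f)))"
        using f by (simp add: field_simps eq_neg_iff_add_eq_0)
      then have "v = scale s y" by (simp add: va y_def scale_right_diff_distrib)
      with False lv line_scale show ?thesis by blast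
    qed
  qed
  have "\<exists>e\<in>{enat n | n. \<exists>Z :: nat \<Rightarrow> 'v set set.
      (\<forall>i\<le>n. irreducible_closed (ztop PZ) (Z i)) \<and> (\<forall>i<n. Z i \<subset> Z (Suc i))}. 0 < e"
    using dim unfolding krull_dim_def quadric_eq less_Sup_iff .
  then obtain n Z where n: "0 < n" "\<forall>i\<le>n. irreducible_closed (ztop PZ) (Z i)" "\<forall>i<n. Z i \<subset> Z (Suc i)"
    by (auto simp: zero_enat_def)
  have Z: "irreducible_closed (ztop PZ) (Z 0)" "irreducible_closed (ztop PZ) (Z 1)" "Z 0 \<subset> Z 1"
    using n by auto
  have Z1: "closedin (ztop PZ) (Z 1)"
    "\<And>C D. \<lbrakk>closedin (ztop PZ) C; closedin (ztop PZ) D; Z 1 = C \<union> D\<rbrakk> \<Longrightarrow> Z 1 = C \<or> Z 1 = D"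
    using Z(2) unfolding irreducible_closed_def by blast+
  have "Z 1 \<subseteq> cone_lines" using closedin_subset[OF Z1(1)] points_PZ by simp
  then have sub: "Z 1 \<subseteq> {line scale x, line scale y}" using two by blast
  have "Z 0 \<noteq> {}" using Z(1) unfolding irreducible_closed_def by blast
  then have Zxy: "Z 1 = {line scale x, line scale y}" using sub Z(3) by blast
  define C where "C w = {l \<in> cone_lines. \<exists>v\<in>l. B w v \<noteq> 0}" for w
  have C: "closedin (ztop PZ) (Z 1 - C w)" for w
    unfolding C_def by (rule closedin_diff[OF Z1(1) open_nonvanishing[OF homogeneous_poly.linear[OF linear_B]]])
  have memC: "line scale v \<in> C w \<longleftrightarrow> B w v \<noteq> 0" if "line scale v \<in> cone_lines" for v w
    using that line_self[of v] by (auto simp: C_def line_def B_simps)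
  have cl: "line scale x \<in> cone_lines" "line scale y \<in> cone_lines"
    using Zxy \<open>Z 1 \<subseteq> cone_lines\<close> by auto
  have Cx: "line scale x \<notin> C x" "line scale y \<in> C x" "line scale x \<in> C y" "line scale y \<notin> C y"
    using memC[OF cl(1)] memC[OF cl(2)] Bxx Bxy Byx Byy by simp_all
  have "Z 1 - C x = {line scale x}" "Z 1 - C y = {line scale y}"
    unfolding Zxy using Cx by (simp_all add: insert_Diff_if)
  moreover from this have "Z 1 = (Z 1 - C x) \<union> (Z 1 - C y)" using Zxy by (simp add: insert_commute)
  from Z1(2)[OF C C this] have "Z 1 = Z 1 - C x \<or> Z 1 = Z 1 - C y" .
  ultimately have "{line scale x, line scale y} = {line scale x} \<or> {line scale x, line scale y} = {line scale y}"
    using Zxy by argo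
  moreover have "line scale x \<noteq> line scale y" using Cx(1,2) by metis
  ultimately show False by (elim disjE) (drule equalityD1, simp)+
qed

lemma subspace_orthogonal_complement: "subspace (orthogonal_complement q A)"
  by (rule subspaceI) (auto simp: orthogonal_complement_def B_simps)

end

lemma (in vector_space) projection_onto_subspace:
  assumes "subspace S"
  obtains p where "Vector_Spaces.linear scale scale p" "\<forall>v. p v \<in> S" "\<forall>v\<in>S. p v = v"
proof -
  interpret vector_space_pair scale scale by unfold_locales
  obtain p where "p ` UNIV \<subseteq> S" "Vector_Spaces.linear scale scale p" "\<forall>v\<in>S. p (id v) = v"
    using linear_exists_left_inverse_on[of id S] assms linear_id by auto
  then show ?thesis by (intro that[of p]) auto
qed

text \<open>Compose a functional that is \<open>1\<close> at the nonzero vector \<open>a - p a\<close> with \<open>v \<mapsto> v - p v\<close>, where \<open>p\<close> is a projection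
onto \<open>S\<close>.\<close>

lemma (in vector_space) functional_vanishing_on_subspace:
  assumes "subspace S" "a \<notin> S"
  obtains \<alpha> where "Vector_Spaces.linear scale (*) \<alpha>" "\<And>v. v \<in> S \<Longrightarrow> \<alpha> v = 0" "\<alpha> a = 1"
proof -
  obtain p where p: "Vector_Spaces.linear scale scale p" "\<forall>v. p v \<in> S" "\<forall>v\<in>S. p v = v"
    using assms(1) by (rule projection_onto_subspace)
  have "p a \<in> S" using p(2) by blast
  then have "a - p a \<noteq> 0" using assms(2) by auto
  then obtain \<beta> where \<beta>: "Vector_Spaces.linear scale (*) \<beta>" "\<beta> (a - p a) = 1" by (rule separating_functional)
  have "Vector_Spaces.linear scale (*) (\<lambda>v. \<beta> (v - p v))"
    unfolding Vector_Spaces.linear_iff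
    using \<beta>(1)[unfolded Vector_Spaces.linear_iff, THEN conjunct2, THEN conjunct1] vector_space_axioms
    by (simp add: linear_simps[OF \<beta>(1)] linear_simps[OF p(1)] algebra_simps)
  then show ?thesis by (rule that) (use p(3) linear_zeroD[OF \<beta>(1)] \<beta>(2) in auto)
qed

section \<open>Coordinates on representations\<close>

lemma linear_image_line: "Vector_Spaces.linear s1 s2 L \<Longrightarrow> L ` line s1 v = line s2 (L v)"
  by (auto simp: line_def linear_scaleD image_image)

lemma regular_map_linear_image:
  assumes L: "Vector_Spaces.linear s1 s2 L" and Z1: "subvariety s1 Z1" and Z2: "subvariety s2 Z2"
    and map: "\<And>v. \<lbrakk>v \<noteq> 0; line s1 v \<in> Z1\<rbrakk> \<Longrightarrow> L v \<noteq> 0 \<and> line s2 (L v) \<in> Z2"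
  shows "regular_map (proj_subvariety s1 Z1) Z1 (proj_subvariety s2 Z2) Z2 (\<lambda>l. L ` l)"
proof -
  interpret Z1: subvariety s1 Z1 by fact
  have rep: "L v \<noteq> 0 \<and> L ` l = line s2 (L v) \<and> L ` l \<in> Z2" if l: "l \<in> Z1" "v \<in> l" "v \<noteq> 0" for l v
  proof -
    have "l \<in> proj_points s1 UNIV" using l(1) Z1.Z_points by blast
    then have "l = line s1 v" using l(2,3) by (rule Z1.proj_pointD)
    then show ?thesis using map[of v] l linear_image_line[OF L, of v] by simp
  qed
  have rep': "L ` l \<in> Z2" if l: "l \<in> Z1" for l
  proof -
    have "l \<in> proj_points s1 UNIV" using l Z1.Z_points by blast
    then obtain v where "v \<in> l" "v \<noteq> 0" by (rule Z1.proj_point_rep)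
    with rep[OF l] show ?thesis by blast
  qed
  have op: "openin (ztop Z1.PZ) Z1" using openin_topspace[of "ztop Z1.PZ"] Z1.points_PZ by simp
  show ?thesis
  proof (rule Z1.PZ.regular_map_to_projective[OF Z2 op])
    show "(\<lambda>l. L ` l) ` Z1 \<subseteq> Z2" using rep' by blast
    fix l assume l: "l \<in> Z1"
    obtain N \<sigma> where N: "openin (ztop Z1.PZ) N" "l \<in> N" "vreg Z1.PZ s1 N \<sigma>"
      "\<And>m. m \<in> N \<Longrightarrow> \<sigma> m \<in> m \<and> \<sigma> m \<noteq> 0" using Z1.local_lift[OF l] by metis
    have "N \<subseteq> Z1" using openin_subset[OF N(1)] Z1.points_PZ by simp
    then show "\<exists>N Y. openin (ztop Z1.PZ) N \<and> l \<in> N \<and> N \<subseteq> Z1 \<and> vreg Z1.PZ s2 N Y \<and>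
        (\<forall>z\<in>N. Y z \<noteq> 0 \<and> L ` z = line s2 (Y z))"
      using N rep vreg_linear[OF N(3) L] by (intro exI[of _ N] exI[of _ "\<lambda>m. L (\<sigma> m)"]) blast
  qed simp
qed

lemma sum_apply: "(\<Sum>i\<in>A. f i) x = (\<Sum>i\<in>A. f i x)"
  by (induction A rule: infinite_finite_induct) auto

lemma vector_space_coord_scale: "vector_space (coord_scale :: 'k::field \<Rightarrow> _)"
  by unfold_locales (auto simp: coord_scale_def fun_eq_iff algebra_simps)

lemma subspace_coord_space: "module.subspace (coord_scale :: 'k::field \<Rightarrow> _) (coord_space n)"
proof -
  interpret vector_space "coord_scale :: 'k \<Rightarrow> _" by (rule vector_space_coord_scale)
  show ?thesis by (rule subspaceI) (auto simp: coord_space_def coord_scale_def)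
qed

lemma subvariety_proj_space: "vector_space scale \<Longrightarrow> subvariety scale (proj_points scale S)"
  by (auto simp: subvariety_def subvariety_axioms_def proj_points_mono)

lemma (in vector_space) subspace_coordinates:
  assumes fin: "finite S" and E: "E = span S"
  obtains n and \<kappa> :: "(nat \<Rightarrow> 'a) \<Rightarrow> 'b" and \<pi>
  where "Vector_Spaces.linear coord_scale scale \<kappa>" "Vector_Spaces.linear scale coord_scale \<pi>"
    "\<forall>x. \<kappa> x \<in> E" "\<forall>v. \<pi> v \<in> coord_space n" "\<forall>x\<in>coord_space n. \<pi> (\<kappa> x) = x" "\<forall>v\<in>E. \<kappa> (\<pi> v) = v"
proof -
  obtain B where B: "B \<subseteq> S" "independent B" "S \<subseteq> span B" by (rule maximal_independent_subset)
  have finB: "finite B" using B(1) fin finite_subset by blast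
  have EB: "E = span B" unfolding E using B(1,3) by (metis span_mono span_span subset_antisym)
  obtain e where e: "bij_betw e {0..<card B} B" using ex_bij_betw_nat_finite[OF finB] by blast
  have eB: "e i \<in> B" if "i < card B" for i using bij_betwE[OF e] that by simp
  \<comment> \<open>Coordinates in a basis of \<open>E\<close> are extended to the whole space through a projection onto \<open>E\<close>.\<close>
  obtain p where p: "Vector_Spaces.linear scale scale p" "\<forall>v. p v \<in> E" "\<forall>v\<in>E. p v = v"
    using subspace_span[of S] unfolding E[symmetric] by (rule projection_onto_subspace)
  define n where "n = card B"
  define \<kappa> where "\<kappa> x = (\<Sum>i\<in>{0..<n}. scale (x i) (e i))" for x
  define \<pi> where "\<pi> v = (\<lambda>i. if i < n then representation B (p v) (e i) else 0)" for v
  have pB: "p v \<in> span B" for v using p(2) EB by simp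
  have \<kappa>: "Vector_Spaces.linear coord_scale scale \<kappa>"
    unfolding Vector_Spaces.linear_iff \<kappa>_def using vector_space_axioms vector_space_coord_scale
    by (simp add: coord_scale_def scale_left_distrib sum.distrib scale_sum_right)
  have \<pi>: "Vector_Spaces.linear scale coord_scale \<pi>"
    unfolding Vector_Spaces.linear_iff \<pi>_def using vector_space_axioms vector_space_coord_scale
    by (auto simp: coord_scale_def fun_eq_iff linear_simps[OF p(1)] representation_add[OF B(2) pB pB]
        representation_scale[OF B(2) pB])
  have \<kappa>E: "\<kappa> x \<in> E" for x
    unfolding \<kappa>_def EB by (intro span_sum span_scale span_base eB) (simp add: n_def)
  have "\<pi> (\<kappa> x) = x" if x: "x \<in> coord_space n" for x
  proof
    fix k
    show "\<pi> (\<kappa> x) k = x k"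
    proof (cases "k < n")
      case True
      have delta: "\<pi> (e i) k = (if i = k then 1 else 0)" if i: "i \<in> {0..<n}" for i
      proof -
        have eE: "p (e i) = e i" using p(3) eB[of i] i EB span_base by (simp add: n_def)
        show ?thesis using True i representation_basis[OF B(2) eB[of i]] bij_betw_imp_inj_on[OF e]
          by (auto simp: \<pi>_def eE n_def inj_on_def)
      qed
      have "\<pi> (\<kappa> x) = (\<Sum>i\<in>{0..<n}. coord_scale (x i) (\<pi> (e i)))"
        unfolding \<kappa>_def by (simp add: linear_sumD[OF \<pi>] linear_scaleD[OF \<pi>])
      then have "\<pi> (\<kappa> x) k = (\<Sum>i\<in>{0..<n}. x i * \<pi> (e i) k)"
        by (simp add: coord_scale_def sum_apply)
      also have "\<dots> = (\<Sum>i\<in>{0..<n}. if i = k then x i else 0)"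
        by (rule sum.cong) (auto simp: delta)
      finally show ?thesis using True by simp
    qed (use x in \<open>simp add: \<pi>_def coord_space_def\<close>)
  qed
  moreover have "\<kappa> (\<pi> v) = v" if v: "v \<in> E" for v
  proof -
    have "\<kappa> (\<pi> v) = (\<Sum>i\<in>{0..<card B}. scale (representation B v (e i)) (e i))"
      unfolding \<kappa>_def \<pi>_def using p(3) v by (intro sum.cong) (simp_all add: n_def)
    also have "\<dots> = (\<Sum>b\<in>B. scale (representation B v b) b)"
      by (rule sum.reindex_bij_betw[OF e])
    also have "\<dots> = v" using v EB by (intro sum_representation_eq[OF B(2) _ finB]) auto
    finally show ?thesis .
  qed
  moreover have "\<pi> v \<in> coord_space n" for v by (simp add: \<pi>_def coord_space_def)
  ultimately show ?thesis using \<kappa> \<pi> \<kappa>E by (intro that[of \<kappa> \<pi> n]) auto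
qed

text \<open>The definition of linearizability asks for a representation on some \<open>k\<^sup>n\<close>. Coordinates on the finite-dimensional space
\<open>E\<close> transport both the representation and the birational map, so the model may live in any vector space.\<close>

lemma linear_model:
  fixes scale :: "'k::field_char_0 \<Rightarrow> 'v::ab_group_add \<Rightarrow> 'v" and G :: "('g, 'm) monoid_scheme"
  assumes G: "group G" and vs: "vector_space scale" and fin: "finite S" and E: "E = module.span scale S"
    and nontrivial: "e \<in> E" "e \<noteq> 0" and rep: "linear_representation G scale E \<tau>"
    and bir: "equivariantly_birational G (proj_action \<tau>) (proj_space scale E) act X"
  shows "\<exists>n \<rho>'. linear_representation G (coord_scale :: 'k \<Rightarrow> _) (coord_space n) \<rho>' \<and>
      equivariantly_birational G (proj_action \<rho>') (proj_space (coord_scale :: 'k \<Rightarrow> _) (coord_space n)) act X"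
proof -
  interpret G: group G by fact
  interpret V: vector_space scale by fact
  interpret K: vector_space "coord_scale :: 'k \<Rightarrow> _" by (rule vector_space_coord_scale)
  obtain n and \<kappa> :: "(nat \<Rightarrow> 'k) \<Rightarrow> 'v" and \<pi>
  where \<kappa>: "Vector_Spaces.linear coord_scale scale \<kappa>" and \<pi>: "Vector_Spaces.linear scale coord_scale \<pi>"
    and \<kappa>E: "\<forall>x. \<kappa> x \<in> E" and \<pi>K: "\<forall>v. \<pi> v \<in> coord_space n"
    and \<pi>\<kappa>: "\<forall>x\<in>coord_space n. \<pi> (\<kappa> x) = x" and \<kappa>\<pi>: "\<forall>v\<in>E. \<kappa> (\<pi> v) = v"
    using fin E by (rule V.subspace_coordinates)
  have subE: "V.subspace E" unfolding E by (rule V.subspace_span)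
  note subK = subspace_coord_space[where 'k = 'k, of n]
  let ?K = "proj_space (coord_scale :: 'k \<Rightarrow> _) (coord_space n)" and ?E = "proj_space scale E"
  let ?ZK = "proj_points (coord_scale :: 'k \<Rightarrow> _) (coord_space n)" and ?ZE = "proj_points scale E"
  interpret ZK: subvariety "coord_scale :: 'k \<Rightarrow> _" ?ZK
    by (rule subvariety_proj_space[OF vector_space_coord_scale])
  interpret ZE: subvariety scale ?ZE by (rule subvariety_proj_space[OF vs])
  define \<rho>' where "\<rho>' g x = \<pi> (\<tau> g (\<kappa> x))" for g x
  have \<tau>E: "\<tau> g v \<in> E" if "g \<in> carrier G" "v \<in> E" for g v
    using rep that unfolding linear_representation_def by blast
  have \<tau>: "\<tau> g (v + w) = \<tau> g v + \<tau> g w" "\<tau> g (scale c v) = scale c (\<tau> g v)"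
    if "g \<in> carrier G" "v \<in> E" "w \<in> E" for g v w c
    using rep that unfolding linear_representation_def by blast+
  have \<tau>1: "\<tau> \<one>\<^bsub>G\<^esub> v = v" if "v \<in> E" for v
    using rep that unfolding linear_representation_def by blast
  have \<tau>m: "\<tau> (g \<otimes>\<^bsub>G\<^esub> h) v = \<tau> g (\<tau> h v)" if "g \<in> carrier G" "h \<in> carrier G" "v \<in> E" for g h v
    using rep that unfolding linear_representation_def by blast
  have \<kappa>\<rho>: "\<kappa> (\<rho>' g x) = \<tau> g (\<kappa> x)" if "g \<in> carrier G" for g x
    using \<kappa>\<pi> \<kappa>E \<tau>E[OF that] by (simp add: \<rho>'_def)
  have rep': "linear_representation G coord_scale (coord_space n) \<rho>'"
    unfolding linear_representation_def
  proof (intro conjI ballI allI)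
    show "module.subspace coord_scale (coord_space n :: (nat \<Rightarrow> 'k) set)" by (rule subK)
    fix g assume g: "g \<in> carrier G"
    show "\<rho>' g ` coord_space n \<subseteq> coord_space n" using \<pi>K by (auto simp: \<rho>'_def)
    fix v w :: "nat \<Rightarrow> 'k" and c :: 'k
    show "\<rho>' g (v + w) = \<rho>' g v + \<rho>' g w"
      using \<tau>(1)[OF g] \<kappa>E by (simp add: \<rho>'_def linear_addD[OF \<kappa>] linear_addD[OF \<pi>])
    show "\<rho>' g (coord_scale c v) = coord_scale c (\<rho>' g v)"
      using \<tau>(2)[OF g \<kappa>E[rule_format] \<kappa>E[rule_format]] by (simp add: \<rho>'_def linear_scaleD[OF \<kappa>] linear_scaleD[OF \<pi>])
  next
    fix v :: "nat \<Rightarrow> 'k" assume v: "v \<in> coord_space n"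
    show "\<rho>' \<one>\<^bsub>G\<^esub> v = v" using v \<tau>1 \<kappa>E \<pi>\<kappa> by (simp add: \<rho>'_def)
    fix g h assume g: "g \<in> carrier G" and h: "h \<in> carrier G"
    show "\<rho>' (g \<otimes>\<^bsub>G\<^esub> h) v = \<rho>' g (\<rho>' h v)"
      using \<kappa>\<rho>[OF h] \<tau>m[OF g h] \<kappa>E by (simp add: \<rho>'_def[of g] \<rho>'_def[of "g \<otimes>\<^bsub>G\<^esub> h"])
  qed
  have \<kappa>0: "\<kappa> x \<noteq> 0" if "x \<noteq> 0" "x \<in> coord_space n" for x
    using \<pi>\<kappa> that linear_zeroD[OF \<pi>] by metis
  have \<pi>0: "\<pi> v \<noteq> 0" if "v \<noteq> 0" "v \<in> E" for v
    using \<kappa>\<pi> that linear_zeroD[OF \<kappa>] by metis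
  define k where "k l = \<kappa> ` l" for l
  define j where "j m = \<pi> ` m" for m
  have reg_k: "regular_map ?K ?ZK ?E ?ZE k" unfolding k_def
    by (rule regular_map_linear_image[OF \<kappa> ZK.subvariety_axioms ZE.subvariety_axioms])
      (use \<kappa>0 \<kappa>E K.line_in_subspace_points[OF subK] in \<open>auto intro: line_in_proj_points\<close>)
  have reg_j: "regular_map ?E ?ZE ?K ?ZK j" unfolding j_def
    by (rule regular_map_linear_image[OF \<pi> ZE.subvariety_axioms ZK.subvariety_axioms])
      (use \<pi>0 \<pi>K V.line_in_subspace_points[OF subE] in \<open>auto intro: line_in_proj_points\<close>)
  have subset_K: "l \<subseteq> coord_space n" if "l \<in> ?ZK" for l
    using that K.subspace_scale[OF subK] by (auto elim!: proj_pointsE simp: line_def)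
  have subset_E: "m \<subseteq> E" if "m \<in> ?ZE" for m
    using that V.subspace_scale[OF subE] by (auto elim!: proj_pointsE simp: line_def)
  have jk: "j (k l) = l" if "l \<in> ?ZK" for l
    using subset_K[OF that] \<pi>\<kappa> unfolding j_def k_def image_image by (force simp: subset_iff)
  have kj: "k (j m) = m" if "m \<in> ?ZE" for m
    using subset_E[OF that] \<kappa>\<pi> unfolding j_def k_def image_image by (force simp: subset_iff)
  have k_equiv: "k (proj_action \<rho>' g l) = proj_action \<tau> g (k l)" if "g \<in> carrier G" for g l
    unfolding k_def proj_action_def image_image using \<kappa>\<rho>[OF that] by simp
  obtain U V \<phi> \<psi> where UV: "dense_open ?E U" "dense_open X V"
      "regular_map ?E U X V \<phi>" "regular_map X V ?E U \<psi>"
      "\<forall>x\<in>U. \<psi> (\<phi> x) = x" "\<forall>y\<in>V. \<phi> (\<psi> y) = y"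
      "\<forall>g\<in>carrier G. \<forall>x\<in>U. proj_action \<tau> g x \<in> U \<longrightarrow> \<phi> (proj_action \<tau> g x) = act g (\<phi> x)"
    using bir unfolding equivariantly_birational_def by (elim exE conjE)
  have U: "openin (ztop ?E) U" by (rule dense_open_openin[OF UV(1)])
  have UZ: "U \<subseteq> ?ZE" using openin_subset[OF U] ZE.points_PZ by simp
  have kimg: "k l \<in> ?ZE" if "l \<in> ?ZK" for l using reg_k that unfolding regular_map_def by blast
  have jimg: "j m \<in> ?ZK" if "m \<in> ?ZE" for m using reg_j that unfolding regular_map_def by blast
  define U' where "U' = {l \<in> ?ZK. k l \<in> U}"
  have U': "openin (ztop ?K) U'" unfolding U'_def by (rule regular_map_open[OF reg_k U UZ])
  have "line scale e \<in> ?ZE" using nontrivial by (rule line_in_proj_points)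
  then have "U \<inter> ?ZE \<noteq> {}"
    using dense_open_meets[OF UV(1) openin_topspace] ZE.points_PZ by auto
  then obtain m where m: "m \<in> U" "m \<in> ?ZE" by blast
  then have "j m \<in> U'" unfolding U'_def using jimg kj by simp
  then have dense: "dense_open ?K U'"
    by (intro dense_open_irreducible[OF irreducible_proj_space[OF vector_space_coord_scale subK] U']) blast
  have "regular_map ?K U' ?E U k"
    by (rule regular_map_codomain[OF ZK.PZ.regular_map_restrict[OF reg_k U']])
      (use UZ in \<open>auto simp: U'_def\<close>)
  then have rm1: "regular_map ?K U' X V (\<lambda>l. \<phi> (k l))" by (rule regular_map_compose[OF _ UV(3)])
  have "regular_map ?E U ?K U' j"
    by (rule regular_map_codomain[OF ZE.PZ.regular_map_restrict[OF reg_j U UZ]])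
      (use UZ jimg kj in \<open>auto simp: U'_def subset_iff\<close>)
  then have rm2: "regular_map X V ?K U' (\<lambda>y. j (\<psi> y))" by (rule regular_map_compose[OF UV(4)])
  have \<psi>U: "\<psi> y \<in> U" if "y \<in> V" for y using UV(4) that unfolding regular_map_def by blast
  have "equivariantly_birational G (proj_action \<rho>') ?K act X"
    unfolding equivariantly_birational_def
  proof (rule exI[of _ U'], rule exI[of _ V], rule exI[of _ "\<lambda>l. \<phi> (k l)"], rule exI[of _ "\<lambda>y. j (\<psi> y)"],
      intro conjI dense UV(2) rm1 rm2 ballI impI)
    show "j (\<psi> (\<phi> (k x))) = x" if "x \<in> U'" for x
      using that UV(5) jk by (simp add: U'_def)
    show "\<phi> (k (j (\<psi> y))) = y" if "y \<in> V" for y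
    proof -
      have "k (j (\<psi> y)) = \<psi> y" using \<psi>U[OF that] UZ kj by blast
      then show ?thesis using UV(6) that by simp
    qed
    show "\<phi> (k (proj_action \<rho>' g x)) = act g (\<phi> (k x))"
      if "g \<in> carrier G" "x \<in> U'" "proj_action \<rho>' g x \<in> U'" for g x
    proof -
      have "k x \<in> U" "proj_action \<tau> g (k x) \<in> U" using that k_equiv[OF that(1)] by (simp_all add: U'_def)
      then show ?thesis using UV(7) that(1) k_equiv[OF that(1)] by simp
    qed
  qed
  with rep' show ?thesis by blast
qed

section \<open>Equivariant frames\<close>

locale finite_rep = finite_dimensional_vector_space scale Basis + group G
  for G :: "('g, 'm) monoid_scheme" (structure)
    and scale :: "'k::field_char_0 \<Rightarrow> 'v::ab_group_add \<Rightarrow> 'v" and Basis :: "'v set" +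
  fixes \<rho> :: "'g \<Rightarrow> 'v \<Rightarrow> 'v"
  assumes finite_G: "finite (carrier G)" and rep: "linear_representation G scale UNIV \<rho>"
begin

lemma linear_rho: "g \<in> carrier G \<Longrightarrow> Vector_Spaces.linear scale scale (\<rho> g)"
  using rep vector_space_axioms unfolding linear_representation_def Vector_Spaces.linear_iff by blast

lemma rho_one: "\<rho> \<one> v = v"
  using rep unfolding linear_representation_def by blast

lemma rho_mult: "\<lbrakk>g \<in> carrier G; h \<in> carrier G\<rbrakk> \<Longrightarrow> \<rho> (g \<otimes> h) v = \<rho> g (\<rho> h v)"
  using rep unfolding linear_representation_def by blast

lemma rho_inv_left: "g \<in> carrier G \<Longrightarrow> \<rho> (inv g) (\<rho> g v) = v"
  by (simp add: rho_mult[symmetric] rho_one)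

lemma rho_inv_right: "g \<in> carrier G \<Longrightarrow> \<rho> g (\<rho> (inv g) v) = v"
  by (simp add: rho_mult[symmetric] rho_one)

lemma rho_nonzero: "\<lbrakk>g \<in> carrier G; v \<noteq> 0\<rbrakk> \<Longrightarrow> \<rho> g v \<noteq> 0"
  using rho_inv_left[of g v] linear_zeroD[OF linear_rho, of "inv g"] by auto

lemma sum_translate:
  assumes h: "h \<in> carrier G"
  shows "(\<Sum>g\<in>carrier G. F g) = (\<Sum>g\<in>carrier G. F (h \<otimes> g))"
proof -
  have "bij_betw (\<lambda>g. h \<otimes> g) (carrier G) (carrier G)"
    by (rule bij_betwI[where g = "\<lambda>g. inv h \<otimes> g"]) (use h in \<open>auto simp: m_assoc[symmetric]\<close>)
  from sum.reindex_bij_betw[OF this, of F] show ?thesis by simp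
qed

text \<open>Trivial stabilizer of the line of \<open>v\<close>, written with vectors.\<close>

definition free_vec :: "'v \<Rightarrow> bool"
  where "free_vec v \<longleftrightarrow> (\<forall>g\<in>carrier G. \<forall>c. \<rho> g v = scale c v \<longrightarrow> g = \<one>)"

lemma proj_action_line: "g \<in> carrier G \<Longrightarrow> proj_action \<rho> g (line scale v) = line scale (\<rho> g v)"
  unfolding proj_action_def by (rule linear_image_line[OF linear_rho])

lemma free_vec_iff:
  assumes "v \<noteq> 0"
  shows "free_vec v \<longleftrightarrow> (\<forall>g\<in>carrier G. proj_action \<rho> g (line scale v) = line scale v \<longrightarrow> g = \<one>)"
proof -
  have "proj_action \<rho> g (line scale v) = line scale v \<longleftrightarrow> (\<exists>c. \<rho> g v = scale c v)" if g: "g \<in> carrier G" for g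
  proof -
    have "c \<noteq> 0" if "\<rho> g v = scale c v" for c
      using that rho_nonzero[OF g assms] by auto
    then show ?thesis unfolding proj_action_line[OF g] line_eq_iff[OF rho_nonzero[OF g assms]] by blast
  qed
  then show ?thesis unfolding free_vec_def by blast
qed

definition avg :: "('v \<Rightarrow> 'k) \<Rightarrow> 'v \<Rightarrow> 'k"
  where "avg f v = (\<Sum>g\<in>carrier G. f (\<rho> (inv g) v))"

text \<open>The operator \<open>A\<^sub>v\<close> of the no-name lemma. Division by the invariant \<open>avg f v\<close> makes it homogeneous of degree
\<open>0\<close> in \<open>v\<close>.\<close>

definition frame :: "('v \<Rightarrow> 'k) \<Rightarrow> 'v \<Rightarrow> 'v \<Rightarrow> 'v"
  where "frame f v y = (\<Sum>g\<in>carrier G. scale (f (\<rho> (inv g) v) / avg f v) (\<rho> g y))"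

lemma rho_inv_mult_cancel:
  "\<lbrakk>g \<in> carrier G; h \<in> carrier G\<rbrakk> \<Longrightarrow> \<rho> (inv (h \<otimes> g)) (\<rho> h v) = \<rho> (inv g) v"
  by (simp add: inv_mult_group rho_mult rho_inv_left)

lemma avg_rho: "h \<in> carrier G \<Longrightarrow> avg f (\<rho> h v) = avg f v"
  unfolding avg_def by (subst sum_translate[of h]) (auto intro!: sum.cong simp: rho_inv_mult_cancel)

text \<open>Reindex the sum by \<open>g \<mapsto> h g\<close>.\<close>

lemma frame_rho:
  assumes h: "h \<in> carrier G"
  shows "frame f (\<rho> h v) y = \<rho> h (frame f v y)"
proof -
  have "frame f (\<rho> h v) y =
      (\<Sum>g\<in>carrier G. scale (f (\<rho> (inv (h \<otimes> g)) (\<rho> h v)) / avg f v) (\<rho> (h \<otimes> g) y))"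
    unfolding frame_def avg_rho[OF h] by (rule sum_translate[OF h])
  also have "\<dots> = (\<Sum>g\<in>carrier G. \<rho> h (scale (f (\<rho> (inv g) v) / avg f v) (\<rho> g y)))"
    by (rule sum.cong) (simp_all add: h rho_inv_mult_cancel rho_mult linear_scaleD[OF linear_rho])
  also have "\<dots> = \<rho> h (frame f v y)" unfolding frame_def by (simp add: linear_sumD[OF linear_rho[OF h]])
  finally show ?thesis .
qed

lemma linear_frame: "Vector_Spaces.linear scale scale (frame f v)"
  unfolding Vector_Spaces.linear_iff frame_def using vector_space_axioms
  by (simp add: linear_addD[OF linear_rho] linear_scaleD[OF linear_rho] scale_right_distrib sum.distrib
      scale_sum_right mult.commute)

lemma avg_scale:
  assumes "homogeneous_poly scale d f"
  shows "avg f (scale c v) = c ^ d * avg f v"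
  unfolding avg_def
  by (simp add: linear_scaleD[OF linear_rho] homogeneous_poly_scale[OF assms] sum_distrib_left)

lemma frame_scale:
  assumes "homogeneous_poly scale d f" "c \<noteq> 0"
  shows "frame f (scale c v) = frame f v"
  unfolding frame_def fun_eq_iff avg_scale[OF assms(1)]
  using assms(2) by (simp add: linear_scaleD[OF linear_rho] homogeneous_poly_scale[OF assms(1)])

lemma frame_in_subspace:
  assumes "subspace S" "\<And>g. g \<in> carrier G \<Longrightarrow> \<rho> g ` S \<subseteq> S" "y \<in> S"
  shows "frame f v y \<in> S"
  unfolding frame_def by (intro subspace_sum subspace_scale assms(1)) (use assms in auto)

lemma reg_translate:
  assumes "fspace_ring X" "openin (ztop X) N" "vreg X scale N E" "homogeneous_poly scale d f" "g \<in> carrier G"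
  shows "reg X N (\<lambda>x. f (\<rho> (inv g) (E x)))"
  using fspace_ring.reg_homogeneous_poly[OF assms(1,4,2) vreg_linear[OF assms(3) linear_rho[OF inv_closed[OF assms(5)]]]] .

lemma reg_avg:
  assumes "fspace_ring X" "openin (ztop X) N" "vreg X scale N E" "homogeneous_poly scale d f"
  shows "reg X N (\<lambda>x. avg f (E x))"
  unfolding avg_def by (intro fspace_ring.reg_sum[OF assms(1,2)] reg_translate[OF assms])

lemma vreg_frame:
  assumes X: "fspace_ring X" "openin (ztop X) N" "vreg X scale N E" "homogeneous_poly scale d f"
    and nz: "\<And>x. x \<in> N \<Longrightarrow> avg f (E x) \<noteq> 0"
  shows "vreg X scale N (\<lambda>x. frame f (E x) y)"
  unfolding frame_def
  by (intro fspace_ring.vreg_sum[OF X(1,2)] fspace_ring.vreg_scale[OF X(1)] fspace_ring.vreg_const[OF X(1,2)]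
      fspace_ring.reg_divide[OF X(1)] reg_translate[OF X] reg_avg[OF X] nz)

text \<open>For \<open>g \<noteq> 1\<close> the vectors \<open>v0\<close> and \<open>\<rho> g v0\<close> are independent, so some linear form is \<open>1\<close> at \<open>v0\<close> and \<open>0\<close> at
\<open>\<rho> g v0\<close>. The product of these forms is \<open>f\<close>, and then only \<open>g = 1\<close> contributes to the frame at \<open>v0\<close>.\<close>

lemma frame_exists:
  assumes v0: "v0 \<noteq> 0" "free_vec v0"
  obtains d f where "homogeneous_poly scale d f" "avg f v0 = 1" "frame f v0 = (\<lambda>y. y)"
proof -
  have "\<exists>\<alpha>. Vector_Spaces.linear scale (*) \<alpha> \<and> \<alpha> (\<rho> g v0) = 0 \<and> \<alpha> v0 = 1" if g: "g \<in> carrier G - {\<one>}" for g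
  proof -
    have "v0 \<notin> span {\<rho> g v0}"
    proof
      assume "v0 \<in> span {\<rho> g v0}"
      then obtain c where c: "v0 = scale c (\<rho> g v0)" unfolding span_singleton by blast
      then have "c \<noteq> 0" using v0(1) by auto
      with c have "\<rho> g v0 = scale (inverse c) v0" by (metis left_inverse scale_one scale_scale)
      with v0(2) g show False unfolding free_vec_def by blast
    qed
    from functional_vanishing_on_subspace[OF subspace_span this] obtain \<alpha>
      where "Vector_Spaces.linear scale (*) \<alpha>" "\<And>v. v \<in> span {\<rho> g v0} \<Longrightarrow> \<alpha> v = 0" "\<alpha> v0 = 1" by metis
    then show ?thesis by (intro exI[of _ \<alpha>]) (simp add: span_base)
  qed
  then obtain \<alpha> where \<alpha>: "\<And>g. g \<in> carrier G - {\<one>} \<Longrightarrow> Vector_Spaces.linear scale (*) (\<alpha> g)"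
    "\<And>g. g \<in> carrier G - {\<one>} \<Longrightarrow> \<alpha> g (\<rho> g v0) = 0" "\<And>g. g \<in> carrier G - {\<one>} \<Longrightarrow> \<alpha> g v0 = 1"
    by metis
  define f where "f v = (\<Prod>g\<in>carrier G - {\<one>}. \<alpha> g v)" for v
  have hf: "homogeneous_poly scale (card (carrier G - {\<one>})) f"
    unfolding f_def by (rule homogeneous_poly_prod) (use finite_G \<alpha>(1) homogeneous_poly.linear in auto)
  have f: "f (\<rho> (inv g) v0) = (if g = \<one> then 1 else 0)" if g: "g \<in> carrier G" for g
  proof (cases "g = \<one>")
    case True
    then show ?thesis using \<alpha>(3) by (simp add: f_def rho_one)
  next
    case False
    then have "inv g \<in> carrier G - {\<one>}" using g by (simp add: inv_eq_1_iff)
    with \<alpha>(2) finite_G False show ?thesis unfolding f_def by (auto intro!: prod_zero)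
  qed
  have avg: "avg f v0 = 1"
  proof -
    have "avg f v0 = (\<Sum>g\<in>carrier G. if g = \<one> then 1 else 0)"
      unfolding avg_def by (rule sum.cong) (simp_all add: f)
    then show ?thesis using finite_G by simp
  qed
  have "frame f v0 y = y" for y
  proof -
    have "frame f v0 y = (\<Sum>g\<in>carrier G. if g = \<one> then y else 0)"
      unfolding frame_def avg by (rule sum.cong) (simp_all add: f rho_one)
    then show ?thesis using finite_G by simp
  qed
  then show ?thesis using hf avg by (intro that[of _ f]) auto
qed

end

text \<open>The normalization at \<open>v0\<close> guarantees that the locus where the frame is invertible is not empty.\<close>

locale framed_rep = finite_rep G scale Basis \<rho>
  for G :: "('g, 'm) monoid_scheme" (structure)
    and scale :: "'k::field_char_0 \<Rightarrow> 'v::ab_group_add \<Rightarrow> 'v" and Basis :: "'v set" and \<rho> :: "'g \<Rightarrow> 'v \<Rightarrow> 'v" +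
  fixes f :: "'v \<Rightarrow> 'k" and d :: nat and v0 :: 'v
  assumes hom_f: "homogeneous_poly scale d f" and v0_nonzero: "v0 \<noteq> 0" and v0_free: "free_vec v0"
    and avg_v0: "avg f v0 = 1" and frame_v0: "frame f v0 = (\<lambda>y. y)"
begin

abbreviation "A \<equiv> frame f"
abbreviation "Ai v \<equiv> inv_into UNIV (A v)"

definition good :: "'v \<Rightarrow> bool"
  where "good v \<longleftrightarrow> avg f v \<noteq> 0 \<and> bij (A v)"

lemma good_v0: "good v0"
  using bij_id by (simp add: good_def avg_v0 frame_v0 id_def)

lemma good_scale: "c \<noteq> 0 \<Longrightarrow> good (scale c v) \<longleftrightarrow> good v"
  by (simp add: good_def avg_scale[OF hom_f] frame_scale[OF hom_f])

lemma A_Ai: "good v \<Longrightarrow> A v (Ai v y) = y"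
  by (simp add: good_def bij_is_surj surj_f_inv_f)

lemma Ai_A: "good v \<Longrightarrow> Ai v (A v y) = y"
  by (simp add: good_def bij_is_inj)

lemma Ai_eqI: "\<lbrakk>good v; A v y = z\<rbrakk> \<Longrightarrow> Ai v z = y"
  using Ai_A by blast

lemma linear_Ai:
  assumes "good v"
  shows "Vector_Spaces.linear scale scale (Ai v)"
proof -
  have "Ai v (x + y) = Ai v x + Ai v y" for x y
    by (rule Ai_eqI[OF assms]) (simp add: linear_addD[OF linear_frame] A_Ai[OF assms])
  moreover have "Ai v (scale c x) = scale c (Ai v x)" for c x
    by (rule Ai_eqI[OF assms]) (simp add: linear_scaleD[OF linear_frame] A_Ai[OF assms])
  ultimately show ?thesis unfolding Vector_Spaces.linear_iff using vector_space_axioms by blast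
qed

lemma Ai_scale: "c \<noteq> 0 \<Longrightarrow> Ai (scale c v) = Ai v"
  by (simp add: frame_scale[OF hom_f])

lemma A_scale: "c \<noteq> 0 \<Longrightarrow> A (scale c v) = A v"
  by (simp add: frame_scale[OF hom_f])

lemma Ai_rho:
  assumes "good v" "g \<in> carrier G" "good (\<rho> g v)"
  shows "Ai (\<rho> g v) (\<rho> g y) = Ai v y"
  by (rule Ai_eqI[OF assms(3)]) (simp add: frame_rho[OF assms(2)] A_Ai[OF assms(1)])

lemma good_rho:
  assumes "g \<in> carrier G"
  shows "good (\<rho> g v) \<longleftrightarrow> good v"
proof -
  have bij_rho: "bij (\<rho> g)"
    by (rule bij_betw_byWitness[where f' = "\<rho> (inv g)"]) (use assms in \<open>auto simp: rho_inv_left rho_inv_right\<close>)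
  have "A (\<rho> g v) = \<rho> g \<circ> A v" by (simp add: fun_eq_iff frame_rho[OF assms])
  moreover have "bij (\<rho> g \<circ> A v) \<longleftrightarrow> bij (A v)"
    using bij_betw_comp_iff[OF bij_rho] bij_rho by (metis bij_betw_comp_iff2 top_greatest)
  ultimately show ?thesis by (simp add: good_def avg_rho[OF assms])
qed

text \<open>The frame maps the invariant subspace \<open>S\<close> into itself, and by finite dimension onto itself.\<close>

lemma Ai_in_subspace:
  assumes S: "subspace S" and inv: "\<And>g. g \<in> carrier G \<Longrightarrow> \<rho> g ` S \<subseteq> S" and v: "good v" and y: "y \<in> S"
  shows "Ai v y \<in> S"
proof -
  have sub: "A v ` S \<subseteq> S" using frame_in_subspace[OF S inv] by blast
  interpret vp: finite_dimensional_vector_space_pair scale Basis scale Basis by unfold_locales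
  have inj: "inj_on (A v) (span S)" using v by (simp add: good_def bij_is_inj inj_on_subset[OF bij_is_inj])
  have "dim (A v ` S) = dim S" using vp.dim_image_eq[OF linear_frame inj] .
  then have dim: "dim S \<le> dim (A v ` S)" by (rule eq_refl[OF sym])
  have "subspace (A v ` S)" using vp.linear_subspace_image[OF linear_frame S] .
  then have img: "A v ` S = S" using S sub dim by (rule subspace_dim_equal)
  have "y \<in> A v ` S" unfolding img by (rule y)
  then obtain x where x: "y = A v x" "x \<in> S" by (rule imageE)
  show ?thesis unfolding x(1) Ai_A[OF v] by (rule x(2))
qed

text \<open>If \<open>g\<close> fixes the line of \<open>v\<close>, then \<open>\<rho> g\<close> composed with \<open>A v\<close> is \<open>A v\<close>. Where \<open>A v\<close> is invertible, \<open>\<rho> g\<close> is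
therefore the identity, and it fixes \<open>v0\<close>. So the invertibility locus of the frame consists of points with trivial
stabilizer.\<close>

lemma good_free:
  assumes v: "good v" "v \<noteq> 0"
  shows "free_vec v"
  unfolding free_vec_def
proof (intro ballI allI impI)
  fix g c assume g: "g \<in> carrier G" and c: "\<rho> g v = scale c v"
  then have "c \<noteq> 0" using rho_nonzero[OF g v(2)] by auto
  have "\<rho> g (A v y) = A v y" for y
    using frame_rho[OF g, of f v y] by (simp add: c A_scale[OF \<open>c \<noteq> 0\<close>])
  then have "\<rho> g (A v (Ai v v0)) = A v (Ai v v0)" .
  then have "\<rho> g v0 = scale 1 v0" by (simp add: A_Ai[OF v(1)])
  then show "g = \<one>" using v0_free g unfolding free_vec_def by blast
qed

lemma open_good:
  assumes X: "fspace_ring X" "openin (ztop X) N" "vreg X scale N E"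
  shows "openin (ztop X) {x \<in> N. good (E x)}"
proof -
  let ?N = "{x \<in> N. avg f (E x) \<noteq> 0}"
  have N: "openin (ztop X) ?N" by (rule fspace_ring.open_nonzero[OF X(1,2) reg_avg[OF X hom_f]])
  have E: "vreg X scale ?N E" by (rule fspace_ring.vreg_restrict[OF X(1,3) N]) blast
  have "openin (ztop X) {x \<in> ?N. bij (A (E x))}"
    by (rule open_bij[OF X(1) N linear_frame vreg_frame[OF X(1) N E hom_f]]) simp
  moreover have "{x \<in> ?N. bij (A (E x))} = {x \<in> N. good (E x)}" by (auto simp: good_def)
  ultimately show ?thesis by simp
qed

lemma vreg_A:
  assumes X: "fspace_ring X" "openin (ztop X) N" "vreg X scale N E" "vreg X scale N F"
    and nz: "\<And>x. x \<in> N \<Longrightarrow> good (E x)"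
  shows "vreg X scale N (\<lambda>x. A (E x) (F x))"
  by (rule vreg_operator[OF X(1,2) linear_frame vreg_frame[OF X(1-3) hom_f] X(4)])
    (use nz in \<open>auto simp: good_def\<close>)

lemma vreg_Ai:
  assumes X: "fspace_ring X" "openin (ztop X) N" "vreg X scale N E" "vreg X scale N F"
    and nz: "\<And>x. x \<in> N \<Longrightarrow> good (E x)"
  shows "vreg X scale N (\<lambda>x. Ai (E x) (F x))"
  by (rule vreg_inv[OF X(1,2) linear_frame vreg_frame[OF X(1-3) hom_f] _ X(4)])
    (use nz in \<open>auto simp: good_def\<close>)

end

section \<open>Hyperbolic pairs\<close>

text \<open>Average an arbitrary projection over the group; the order of the group is invertible in characteristic zero.\<close>

lemma (in finite_rep) maschke:
  assumes S: "subspace S" and inv: "\<And>g. g \<in> carrier G \<Longrightarrow> \<rho> g ` S \<subseteq> S"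
  obtains p where "Vector_Spaces.linear scale scale p" "\<forall>v. p v \<in> S" "\<forall>v\<in>S. p v = v"
    "\<forall>g\<in>carrier G. \<forall>v. p (\<rho> g v) = \<rho> g (p v)"
proof -
  obtain p where p: "Vector_Spaces.linear scale scale p" "\<forall>v. p v \<in> S" "\<forall>v\<in>S. p v = v"
    using S by (rule projection_onto_subspace)
  define n :: 'k where "n = of_nat (card (carrier G))"
  have n: "n \<noteq> 0" using finite_G one_closed by (auto simp: n_def card_eq_0_iff)
  define r where "r v = scale (inverse n) (\<Sum>g\<in>carrier G. \<rho> g (p (\<rho> (inv g) v)))" for v
  have lin: "Vector_Spaces.linear scale scale r"
    unfolding Vector_Spaces.linear_iff r_def using vector_space_axioms
    by (simp add: linear_addD[OF linear_rho] linear_addD[OF p(1)] linear_scaleD[OF linear_rho]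
        linear_scaleD[OF p(1)] scale_right_distrib sum.distrib scale_sum_right mult.commute)
  have "r v \<in> S" for v
    unfolding r_def using p(2) inv by (intro subspace_scale[OF S] subspace_sum[OF S]) blast
  moreover have "r v = v" if v: "v \<in> S" for v
  proof -
    have "\<rho> g (p (\<rho> (inv g) v)) = v" if g: "g \<in> carrier G" for g
    proof -
      have "\<rho> (inv g) v \<in> S" using inv[OF inv_closed[OF g]] v by blast
      then show ?thesis using p(3) by (simp add: rho_inv_right g)
    qed
    then have "(\<Sum>g\<in>carrier G. \<rho> g (p (\<rho> (inv g) v))) = scale n v"
      by (simp add: n_def sum_constant_scale)
    then show ?thesis using n by (simp add: r_def)
  qed
  moreover have "r (\<rho> h v) = \<rho> h (r v)" if h: "h \<in> carrier G" for h v
  proof -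
    have "r (\<rho> h v) = scale (inverse n) (\<Sum>g\<in>carrier G. \<rho> (h \<otimes> g) (p (\<rho> (inv (h \<otimes> g)) (\<rho> h v))))"
      unfolding r_def by (subst sum_translate[OF h]) simp
    also have "\<dots> = scale (inverse n) (\<Sum>g\<in>carrier G. \<rho> h (\<rho> g (p (\<rho> (inv g) v))))"
      by (simp add: rho_inv_mult_cancel rho_mult h)
    also have "\<dots> = \<rho> h (r v)"
      by (simp add: r_def linear_scaleD[OF linear_rho[OF h]] linear_sumD[OF linear_rho[OF h]])
    finally show ?thesis .
  qed
  ultimately show ?thesis using lin by (intro that[of r]) auto
qed

locale quadratic_rep = finite_rep G scale Basis \<rho> + quadratic_space scale Basis q
  for G :: "('g, 'm) monoid_scheme" (structure)
    and scale :: "'k::field_char_0 \<Rightarrow> 'v::ab_group_add \<Rightarrow> 'v" and Basis :: "'v set" and \<rho> :: "'g \<Rightarrow> 'v \<Rightarrow> 'v"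
    and q :: "'v \<Rightarrow> 'k" +
  assumes invariant: "invariant_form G \<rho> q"
begin

lemma q_rho: "g \<in> carrier G \<Longrightarrow> q (\<rho> g v) = q v"
  using invariant by (simp add: invariant_form_def)

lemma B_rho: "g \<in> carrier G \<Longrightarrow> B (\<rho> g v) (\<rho> g w) = B v w"
  by (simp add: polar_def q_rho linear_addD[OF linear_rho, symmetric])

lemma B_rho_adjoint: "g \<in> carrier G \<Longrightarrow> B (\<rho> g v) w = B v (\<rho> (inv g) w)"
  using B_rho[of g v "\<rho> (inv g) w"] by (simp add: rho_inv_right)

lemma orthogonal_complement_invariant:
  assumes "\<And>g. g \<in> carrier G \<Longrightarrow> \<rho> g ` S \<subseteq> S" "g \<in> carrier G"
  shows "\<rho> g ` orthogonal_complement q S \<subseteq> orthogonal_complement q S"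
proof -
  have "\<rho> (inv g) a \<in> S" if "a \<in> S" for a using assms(1)[OF inv_closed[OF assms(2)]] that by blast
  then show ?thesis by (auto simp: orthogonal_complement_def B_rho_adjoint[OF assms(2)])
qed

lemma isotropicD:
  assumes "isotropic_subspace G scale \<rho> q W"
  shows "subspace W" "g \<in> carrier G \<Longrightarrow> \<rho> g ` W \<subseteq> W" "\<lbrakk>v \<in> W; w \<in> W\<rbrakk> \<Longrightarrow> B v w = 0"
proof -
  show W: "subspace W" "g \<in> carrier G \<Longrightarrow> \<rho> g ` W \<subseteq> W" using assms by (auto simp: isotropic_subspace_def)
  assume "v \<in> W" "w \<in> W"
  then show "B v w = 0"
    using assms subspace_add[OF W(1), of v w] by (simp add: polar_def isotropic_subspace_def)
qed

lemma eq_if_B_eq: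
  assumes "\<And>b. B x b = B y b"
  shows "x = y"
proof -
  have "B (x - y) w = 0" for w using assms by (simp add: B_simps)
  then have "x - y = 0" using nondegenerate unfolding nondegenerate_def by blast
  then show ?thesis by simp
qed

lemma adjoint:
  assumes p: "Vector_Spaces.linear scale scale p"
  obtains r where "Vector_Spaces.linear scale scale r" "\<And>a b. B (r a) b = B a (p b)"
proof -
  have "\<exists>c. \<forall>b. B c b = B a (p b)" for a
    using riesz[OF linear_composeD[OF p linear_B[of a]]] by metis
  then obtain r where r: "\<And>a b. B (r a) b = B a (p b)" by metis
  have "r (x + y) = r x + r y" for x y by (rule eq_if_B_eq) (simp add: r B_simps)
  moreover have "r (scale c x) = scale c (r x)" for c x by (rule eq_if_B_eq) (simp add: r B_simps)
  ultimately show ?thesis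
    using r vector_space_axioms by (intro that[of r]) (simp_all add: Vector_Spaces.linear_iff)
qed

lemma restrict_in_dual_space:
  assumes "subspace W" "Vector_Spaces.linear scale (*) \<alpha>"
  shows "restrict \<alpha> W \<in> dual_space scale W"
  using assms subspace_add[OF assms(1)] subspace_scale[OF assms(1)]
  by (auto simp: dual_space_def linear_addD linear_scaleD)

text \<open>Extend the functional to \<open>V\<close> through a projection onto \<open>W\<close>, then represent it by \<open>riesz\<close>.\<close>

lemma dual_space_extends:
  assumes W: "subspace W" and \<alpha>: "\<alpha> \<in> dual_space scale W"
  obtains a where "\<And>w. w \<in> W \<Longrightarrow> B a w = \<alpha> w"
proof -
  obtain p where p: "Vector_Spaces.linear scale scale p" "\<forall>v. p v \<in> W" "\<forall>v\<in>W. p v = v"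
    using W by (rule projection_onto_subspace)
  have "vector_space ((*) :: 'k \<Rightarrow> 'k \<Rightarrow> 'k)" by unfold_locales (auto simp: algebra_simps)
  then have "Vector_Spaces.linear scale (*) (\<lambda>v. \<alpha> (p v))"
    unfolding Vector_Spaces.linear_iff using vector_space_axioms \<alpha> p(2)
    by (simp add: dual_space_def linear_addD[OF p(1)] linear_scaleD[OF p(1)])
  then obtain a where "\<And>v. B a v = \<alpha> (p v)" by (rule riesz) blast
  then show ?thesis using p(3) by (intro that[of a]) simp
qed

text \<open>The adjoint \<open>pT\<close> of an equivariant projection \<open>p\<close> onto \<open>W\<close> satisfies \<open>B w (pT a) = B w a\<close> for \<open>w \<in> W\<close>, so its
range is an invariant complement of the orthogonal complement of \<open>W\<close> and pairs perfectly with \<open>W\<close>. It need not be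
isotropic. Subtracting half of \<open>p (pT a) \<in> W\<close> from \<open>pT a\<close> does not change the pairing with \<open>W\<close> and corrects this,
since \<open>q (pT a) = B (pT a) (p (pT a))\<close>.\<close>

lemma hyperbolic_pair_exists:
  assumes iso: "isotropic_subspace G scale \<rho> q W"
  shows "\<exists>W'. hyperbolic_pair G scale \<rho> q W W'"
proof -
  note W = isotropicD[OF iso]
  obtain p where p: "Vector_Spaces.linear scale scale p" "\<forall>v. p v \<in> W" "\<forall>v\<in>W. p v = v"
    "\<forall>g\<in>carrier G. \<forall>v. p (\<rho> g v) = \<rho> g (p v)"
    using W(1,2) by (rule maschke)
  obtain pT where pT: "Vector_Spaces.linear scale scale pT" "\<And>a b. B (pT a) b = B a (p b)"
    using p(1) by (rule adjoint) blast
  have pp: "p (p v) = p v" for v using p(2,3) by blast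
  have pTpT: "B (pT a) (pT b) = B (p (pT a)) b" for a b
    using pT(2)[of b "pT a"] B_sym[of "pT a" "pT b"] B_sym[of b "p (pT a)"] by simp
  define r where "r a = pT a - scale (1/2) (p (pT a))" for a
  have lin_r: "Vector_Spaces.linear scale scale r"
    unfolding Vector_Spaces.linear_iff r_def using vector_space_axioms
    by (simp add: linear_simps[OF p(1)] linear_simps[OF pT(1)] scale_right_distrib
        scale_right_diff_distrib mult.commute)
  have pT_rho: "pT (\<rho> g a) = \<rho> g (pT a)" if g: "g \<in> carrier G" for g a
  proof (rule eq_if_B_eq)
    fix b
    have "B (pT (\<rho> g a)) b = B a (\<rho> (inv g) (p b))" by (simp add: pT(2) B_rho_adjoint[OF g])
    also have "\<dots> = B (\<rho> g (pT a)) b" using p(4) inv_closed[OF g] by (simp add: pT(2) B_rho_adjoint[OF g])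
    finally show "B (pT (\<rho> g a)) b = B (\<rho> g (pT a)) b" .
  qed
  have r_rho: "r (\<rho> g a) = \<rho> g (r a)" if g: "g \<in> carrier G" for g a
    using p(4) g by (simp add: r_def pT_rho[OF g] linear_diffD[OF linear_rho[OF g]] linear_scaleD[OF linear_rho[OF g]])
  have pW: "B w (p a) = 0" if "w \<in> W" for w a using W(3) that p(2) by blast
  have Bwr: "B w (r a) = B w a" if w: "w \<in> W" for w a
  proof -
    have "B w (pT a) = B a (p w)" using pT(2)[of a w] B_sym by simp
    also have "\<dots> = B w a" using p(3) w B_sym by simp
    finally show ?thesis using pW[OF w] by (simp add: r_def B_simps)
  qed
  have q_r: "q (r a) = 0" for a
  proof -
    have "q (pT a) = B (p (pT a)) a" using pTpT[of a a] by (simp add: q_polar)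
    also have "\<dots> = B (pT a) (p (pT a))"
      using pT(2)[of a "p (pT a)"] pp B_sym[of a] by simp
    finally show ?thesis
      using W(3) p(2) by (simp add: r_def q_diff q_scale q_polar[of "p (pT a)"] B_simps)
  qed
  define W' where "W' = range r"
  define \<theta> where "\<theta> f = restrict (\<lambda>w. B w f) W" for f
  have isoW': "isotropic_subspace G scale \<rho> q W'"
    unfolding isotropic_subspace_def
  proof (intro conjI ballI)
    interpret vp: vector_space_pair scale scale by unfold_locales
    show "module.subspace scale W'" unfolding W'_def by (rule vp.linear_subspace_image[OF lin_r subspace_UNIV])
    show "\<rho> g ` W' \<subseteq> W'" if "g \<in> carrier G" for g
      unfolding W'_def using r_rho[OF that, symmetric] by auto
    show "q w = 0" if "w \<in> W'" for w using that q_r by (auto simp: W'_def)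
  qed
  have inj: "inj_on \<theta> W'"
  proof (rule inj_onI)
    fix x y assume x: "x \<in> W'" and y: "y \<in> W'" and eq: "\<theta> x = \<theta> y"
    obtain a b where ab: "x = r a" "y = r b" using x y by (auto simp: W'_def)
    have "B w x = B w y" if "w \<in> W" for w using fun_cong[OF eq, of w] that by (simp add: \<theta>_def)
    then have "B w a = B w b" if "w \<in> W" for w using Bwr that unfolding ab by metis
    then have "B (pT a) c = B (pT b) c" for c using p(2) B_sym[of _ "p c"] by (simp add: pT(2))
    then have "pT a = pT b" by (rule eq_if_B_eq)
    then show "x = y" by (simp add: ab r_def)
  qed
  have "\<theta> ` W' = dual_space scale W"
  proof
    show "\<theta> ` W' \<subseteq> dual_space scale W"
      unfolding \<theta>_def using restrict_in_dual_space[OF W(1) linear_B_left] by blast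
    show "dual_space scale W \<subseteq> \<theta> ` W'"
    proof
      fix \<alpha> assume \<alpha>: "\<alpha> \<in> dual_space scale W"
      obtain a where a: "\<And>w. w \<in> W \<Longrightarrow> B a w = \<alpha> w" using W(1) \<alpha> by (rule dual_space_extends) blast
      have "\<alpha> \<in> extensional W" using \<alpha> by (simp add: dual_space_def)
      then have "\<theta> (r a) = \<alpha>"
        using a Bwr B_sym[of a] by (intro extensionalityI[of _ W]) (auto simp: \<theta>_def)
      then show "\<alpha> \<in> \<theta> ` W'" by (auto simp: W'_def)
    qed
  qed
  with inj have bij: "bij_betw \<theta> W' (dual_space scale W)" by (simp add: bij_betw_def)
  have equiv: "\<theta> (\<rho> g f) = dual_action G \<rho> W g (\<theta> f)" if g: "g \<in> carrier G" for g f
  proof -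
    have "\<rho> (inv g) w \<in> W" if "w \<in> W" for w using W(2)[OF inv_closed[OF g]] that by blast
    then show ?thesis
      using B_rho_adjoint[OF inv_closed[OF g]] g by (auto simp: \<theta>_def dual_action_def fun_eq_iff restrict_def)
  qed
  show ?thesis unfolding hyperbolic_pair_def
    by (rule exI[of _ W'], intro conjI iso isoW' exI[of _ \<theta>] bij ballI equiv) (simp_all add: \<theta>_def)
qed

text \<open>Since \<open>W'\<close> is isotropic and represents all functionals on \<open>W\<close>, it splits off from its own orthogonal complement with
remainder orthogonal to \<open>H\<^sub>W\<close>. If \<open>W + U\<close> were not all of \<open>V\<close>, some \<open>a \<noteq> 0\<close> would be orthogonal to it; orthogonality
to \<open>U\<close> puts \<open>a\<close> into \<open>W'\<close> by biduality, and orthogonality to \<open>W\<close> makes it zero in the dual of \<open>W\<close>.\<close>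

lemma hyperbolic_complement:
  assumes hyp: "hyperbolic_pair G scale \<rho> q W W'"
  defines "U \<equiv> sum_subspace W' (orthogonal_complement q (sum_subspace W W'))"
  shows "U = orthogonal_complement q W'"
    and "W \<inter> U = {0}"
    and "\<exists>w\<in>W. v - w \<in> U"
proof -
  obtain \<theta> where iso: "isotropic_subspace G scale \<rho> q W" "isotropic_subspace G scale \<rho> q W'"
    and \<theta>: "bij_betw \<theta> W' (dual_space scale W)" "\<And>w f. \<lbrakk>w \<in> W; f \<in> W'\<rbrakk> \<Longrightarrow> B w f = \<theta> f w"
    using hyp unfolding hyperbolic_pair_def by blast
  note W = isotropicD[OF iso(1)] and W' = isotropicD[OF iso(2)]
  have dual: "\<exists>f\<in>W'. \<forall>w\<in>W. B w f = \<alpha> w" if "Vector_Spaces.linear scale (*) \<alpha>" for \<alpha>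
  proof -
    have "restrict \<alpha> W \<in> \<theta> ` W'"
      using restrict_in_dual_space[OF W(1) that] \<theta>(1) by (simp add: bij_betw_def)
    then obtain f where "f \<in> W'" "restrict \<alpha> W = \<theta> f" by blast
    then show ?thesis using \<theta>(2) by (metis restrict_apply')
  qed
  show U: "U = orthogonal_complement q W'"
  proof (intro equalityI subsetI)
    fix v assume "v \<in> U"
    then obtain f u where v: "v = f + u" "f \<in> W'" "\<forall>a\<in>sum_subspace W W'. B u a = 0"
      by (auto simp: U_def sum_subspace_def orthogonal_complement_def)
    have "B u a = 0" if "a \<in> W'" for a
    proof -
      have "0 + a \<in> sum_subspace W W'" unfolding sum_subspace_def using that subspace_0[OF W(1)] by blast
      then show ?thesis using v(3) by simp
    qed
    then show "v \<in> orthogonal_complement q W'"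
      using W'(3)[OF v(2)] by (simp add: orthogonal_complement_def v(1) B_simps)
  next
    fix v assume v: "v \<in> orthogonal_complement q W'"
    obtain f where f: "f \<in> W'" "\<forall>w\<in>W. B w f = B v w" using dual[OF linear_B] by blast
    have "B (v - f) (w + f') = 0" if "w \<in> W" "f' \<in> W'" for w f'
      using f(2) that v W'(3)[OF f(1) that(2)] B_sym[of f w]
      by (simp add: B_simps orthogonal_complement_def)
    then have "v - f \<in> orthogonal_complement q (sum_subspace W W')"
      by (auto simp: orthogonal_complement_def sum_subspace_def)
    then have "f + (v - f) \<in> U" unfolding U_def sum_subspace_def using f(1) by blast
    then show "v \<in> U" by simp
  qed
  have subU: "subspace U" unfolding U by (rule subspace_orthogonal_complement)
  show WU: "W \<inter> U = {0}"
  proof (intro equalityI subsetI)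
    fix w assume w: "w \<in> W \<inter> U"
    have "w = 0"
    proof (rule ccontr)
      assume "w \<noteq> 0"
      then obtain \<alpha> where \<alpha>: "Vector_Spaces.linear scale (*) \<alpha>" "\<alpha> w = 1" by (rule separating_functional)
      obtain f where "f \<in> W'" "\<forall>w\<in>W. B w f = \<alpha> w" using dual[OF \<alpha>(1)] by blast
      then show False using w \<alpha>(2) unfolding U orthogonal_complement_def by auto
    qed
    then show "w \<in> {0}" by simp
  qed (use subspace_0[OF W(1)] subspace_0[OF subU] in simp)
  let ?S = "sum_subspace W U"
  have S_eq: "?S = {x + y | x y. x \<in> W \<and> y \<in> U}" by (simp add: sum_subspace_def)
  have subS: "subspace ?S" unfolding S_eq by (rule subspace_sums[OF W(1) subU])
  have WS: "w \<in> ?S" if "w \<in> W" for w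
  proof -
    have "w + 0 \<in> ?S" unfolding S_eq using that subspace_0[OF subU] by blast
    then show ?thesis by simp
  qed
  have US: "u \<in> ?S" if "u \<in> U" for u
  proof -
    have "0 + u \<in> ?S" unfolding S_eq using that subspace_0[OF W(1)] by blast
    then show ?thesis by simp
  qed
  have "v \<in> ?S"
  proof (rule ccontr)
    assume "v \<notin> ?S"
    with subS obtain \<alpha> where \<alpha>: "Vector_Spaces.linear scale (*) \<alpha>" "\<And>x. x \<in> ?S \<Longrightarrow> \<alpha> x = 0" "\<alpha> v = 1"
      by (rule functional_vanishing_on_subspace) blast
    obtain a where a: "\<And>x. B a x = \<alpha> x" using \<alpha>(1) by (rule riesz) blast
    have "a \<in> W'"
    proof (rule ccontr)
      assume "a \<notin> W'"
      with W'(1) obtain \<beta> where \<beta>: "Vector_Spaces.linear scale (*) \<beta>" "\<And>x. x \<in> W' \<Longrightarrow> \<beta> x = 0" "\<beta> a = 1"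
        by (rule functional_vanishing_on_subspace) blast
      obtain b where b: "\<And>x. B b x = \<beta> x" using \<beta>(1) by (rule riesz) blast
      have "b \<in> U" unfolding U orthogonal_complement_def using b \<beta>(2) by simp
      then have "B a b = 0" using a \<alpha>(2) US by simp
      then show False using b[of a] \<beta>(3) B_sym[of a b] by simp
    qed
    have "\<theta> a = \<theta> 0"
    proof (rule extensionalityI[of _ W])
      have "\<theta> ` W' = dual_space scale W" using \<theta>(1) by (simp add: bij_betw_def)
      then show "\<theta> a \<in> extensional W" "\<theta> 0 \<in> extensional W"
        using \<open>a \<in> W'\<close> subspace_0[OF W'(1)] unfolding dual_space_def by blast+
      fix w assume w: "w \<in> W"
      have "B w a = 0" using a[of w] \<alpha>(2)[OF WS[OF w]] B_sym[of w a] by simp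
      then show "\<theta> a w = \<theta> 0 w"
        using \<theta>(2)[OF w \<open>a \<in> W'\<close>] \<theta>(2)[OF w subspace_0[OF W'(1)]] by (simp add: B_simps)
    qed
    then have "a = 0" using \<theta>(1) \<open>a \<in> W'\<close> subspace_0[OF W'(1)] by (auto simp: bij_betw_def dest: inj_onD)
    then show False using a[of v] \<alpha>(3) by (simp add: B_simps)
  qed
  then obtain w u where "v = w + u" "w \<in> W" "u \<in> U" unfolding S_eq by blast
  then show "\<exists>w\<in>W. v - w \<in> U" by (intro bexI[of _ w]) simp_all
qed

end

lemma (in vector_space) projection_along:
  assumes W: "subspace W" and U: "subspace U" and int: "W \<inter> U = {0}" and sum: "\<And>v. \<exists>w\<in>W. v - w \<in> U"
  obtains p where "Vector_Spaces.linear scale scale p" "\<And>v. p v \<in> W" "\<And>v. v - p v \<in> U"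
    "\<And>v w. \<lbrakk>w \<in> W; v - w \<in> U\<rbrakk> \<Longrightarrow> p v = w"
proof -
  obtain p where p: "\<And>v. p v \<in> W" "\<And>v. v - p v \<in> U" using sum by metis
  have uniq: "p v = w" if "w \<in> W" "v - w \<in> U" for v w
  proof -
    have "p v - w \<in> W" using p(1) that(1) subspace_diff[OF W] by blast
    moreover have "(v - w) - (v - p v) \<in> U" using p(2) that(2) subspace_diff[OF U] by blast
    ultimately have "p v - w \<in> W \<inter> U" by simp
    then show ?thesis using int by simp
  qed
  have "p (x + y) = p x + p y" for x y
  proof (rule uniq)
    have "(x - p x) + (y - p y) \<in> U" using p(2) subspace_add[OF U] by blast
    then show "x + y - (p x + p y) \<in> U" by (simp add: algebra_simps)
  qed (use p(1) subspace_add[OF W] in blast)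
  moreover have "p (scale c x) = scale c (p x)" for c x
  proof (rule uniq)
    have "scale c (x - p x) \<in> U" using p(2) subspace_scale[OF U] by blast
    then show "scale c x - scale c (p x) \<in> U" by (simp add: scale_right_diff_distrib)
  qed (use p(1) subspace_scale[OF W] in blast)
  ultimately have "Vector_Spaces.linear scale scale p"
    unfolding Vector_Spaces.linear_iff using vector_space_axioms by blast
  then show ?thesis using p uniq by (rule that)
qed

section \<open>Regular maps given on representatives\<close>

text \<open>Points \<open>x\<close> with representatives \<open>r\<close>, written \<open>R x r\<close>, such that regular families of representatives, singled out
by \<open>vr\<close>, exist locally. In this setting open sets and regular maps can be described by conditions and formulas on
representatives; the instances are lines with their nonzero vectors, and pairs of lines.\<close>

locale represented_space = fspace_ring X
  for X :: "('a, 'k::field) fspace" +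
  fixes R :: "'a \<Rightarrow> 'r \<Rightarrow> bool" and vr :: "'a set \<Rightarrow> ('a \<Rightarrow> 'r) \<Rightarrow> bool"
  assumes R_point: "R x r \<Longrightarrow> x \<in> points X"
    and local_section: "x \<in> points X \<Longrightarrow>
      \<exists>N \<sigma>. openin (ztop X) N \<and> x \<in> N \<and> vr N \<sigma> \<and> (\<forall>z\<in>N. R z (\<sigma> z))"
    and vr_restrict: "\<lbrakk>vr N \<sigma>; openin (ztop X) N'; N' \<subseteq> N\<rbrakk> \<Longrightarrow> vr N' \<sigma>"
begin

definition dom :: "('r \<Rightarrow> bool) \<Rightarrow> 'a set"
  where "dom D = {x. \<exists>r. R x r \<and> D r}"

definition pick :: "'a \<Rightarrow> 'r"
  where "pick x = (SOME r. R x r)"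

lemma pick: "R x r \<Longrightarrow> R x (pick x)"
  unfolding pick_def by (rule someI)

lemma domE:
  assumes "x \<in> dom D"
  obtains r where "R x r" "D r"
  using assms unfolding dom_def by blast

lemma open_dom:
  assumes inv: "\<And>x r r'. \<lbrakk>R x r; R x r'; D r\<rbrakk> \<Longrightarrow> D r'"
    and op: "\<And>N \<sigma>. \<lbrakk>openin (ztop X) N; vr N \<sigma>; \<forall>z\<in>N. R z (\<sigma> z)\<rbrakk> \<Longrightarrow> openin (ztop X) {z \<in> N. D (\<sigma> z)}"
  shows "openin (ztop X) (dom D)"
proof (subst openin_subopen, intro ballI)
  fix x assume "x \<in> dom D"
  then obtain r where r: "R x r" "D r" by (rule domE)
  obtain N \<sigma> where N: "openin (ztop X) N" "x \<in> N" "vr N \<sigma>" "\<forall>z\<in>N. R z (\<sigma> z)"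
    using local_section[OF R_point[OF r(1)]] by (elim exE conjE)
  have "D (\<sigma> x)" using inv[OF r(1) _ r(2)] N(2,4) by blast
  moreover have "{z \<in> N. D (\<sigma> z)} \<subseteq> dom D" using N(4) unfolding dom_def by blast
  ultimately show "\<exists>T. openin (ztop X) T \<and> x \<in> T \<and> T \<subseteq> dom D"
    using op[OF N(1,3,4)] N(2) by (intro exI[of _ "{z \<in> N. D (\<sigma> z)}"]) simp
qed

text \<open>Locally, the formula applied to a regular family of representatives is a lift as in
\<open>regular_map_to_projective\<close>.\<close>

lemma regular_map_on_dom:
  assumes inv: "\<And>x r r'. \<lbrakk>R x r; R x r'; D r\<rbrakk> \<Longrightarrow> D r'"
    and op: "\<And>N \<sigma>. \<lbrakk>openin (ztop X) N; vr N \<sigma>; \<forall>z\<in>N. R z (\<sigma> z)\<rbrakk> \<Longrightarrow> openin (ztop X) {z \<in> N. D (\<sigma> z)}"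
    and Z: "subvariety scale Z"
    and F: "\<And>N \<sigma>. \<lbrakk>openin (ztop X) N; vr N \<sigma>; \<forall>z\<in>N. R z (\<sigma> z); \<forall>z\<in>N. D (\<sigma> z)\<rbrakk>
        \<Longrightarrow> vreg X scale N (\<lambda>z. F (\<sigma> z))"
    and F_inv: "\<And>x r r'. \<lbrakk>R x r; R x r'; D r; D r'\<rbrakk> \<Longrightarrow> line scale (F r) = line scale (F r')"
    and F_img: "\<And>x r. \<lbrakk>R x r; D r\<rbrakk> \<Longrightarrow> F r \<noteq> 0 \<and> line scale (F r) \<in> Z"
  shows "regular_map X (dom D) (proj_subvariety scale Z) Z (\<lambda>x. line scale (F (pick x)))"
    and "\<lbrakk>R x r; D r\<rbrakk> \<Longrightarrow> line scale (F (pick x)) = line scale (F r)"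
proof -
  have val: "line scale (F (pick x)) = line scale (F r)" if "R x r" "D r" for x r
    using F_inv[OF pick[OF that(1)] that(1) inv[OF that(1) pick[OF that(1)] that(2)] that(2)] .
  then show "\<lbrakk>R x r; D r\<rbrakk> \<Longrightarrow> line scale (F (pick x)) = line scale (F r)" .
  have dom: "openin (ztop X) (dom D)" by (rule open_dom[OF inv op])
  show "regular_map X (dom D) (proj_subvariety scale Z) Z (\<lambda>x. line scale (F (pick x)))"
  proof (rule regular_map_to_projective[OF Z dom _ subset_refl])
    show "(\<lambda>x. line scale (F (pick x))) ` dom D \<subseteq> Z"
    proof
      fix m assume "m \<in> (\<lambda>x. line scale (F (pick x))) ` dom D"
      then obtain x where x: "m = line scale (F (pick x))" "x \<in> dom D" by (rule imageE)
      from x(2) obtain r where r: "R x r" "D r" by (rule domE)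
      show "m \<in> Z" unfolding x(1) val[OF r] using F_img[OF r] by blast
    qed
    fix x assume "x \<in> dom D"
    then obtain r where r: "R x r" "D r" by (rule domE)
    obtain N \<sigma> where N: "openin (ztop X) N" "x \<in> N" "vr N \<sigma>" "\<forall>z\<in>N. R z (\<sigma> z)"
      using local_section[OF R_point[OF r(1)]] by (elim exE conjE)
    let ?N = "{z \<in> N. D (\<sigma> z)}"
    have N': "openin (ztop X) ?N" by (rule op[OF N(1,3,4)])
    have sub: "?N \<subseteq> N" by blast
    have sec: "\<forall>z\<in>?N. R z (\<sigma> z)" "\<forall>z\<in>?N. D (\<sigma> z)" using N(4) by blast+
    have "x \<in> ?N" using inv[OF r(1) _ r(2)] N(2,4) by blast
    moreover have "?N \<subseteq> dom D" unfolding dom_def using sec by blast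
    moreover have "vreg X scale ?N (\<lambda>z. F (\<sigma> z))"
      by (rule F[OF N' vr_restrict[OF N(3) N' sub] sec])
    moreover have "\<forall>z\<in>?N. F (\<sigma> z) \<noteq> 0 \<and> line scale (F (pick z)) = line scale (F (\<sigma> z))"
      using F_img val sec by blast
    ultimately show "\<exists>N Y. openin (ztop X) N \<and> x \<in> N \<and> N \<subseteq> dom D \<and> vreg X scale N Y \<and>
        (\<forall>z\<in>N. Y z \<noteq> 0 \<and> line scale (F (pick z)) = line scale (Y z))"
      using N' by (intro exI[of _ ?N] exI[of _ "\<lambda>z. F (\<sigma> z)"] conjI)
  qed
qed

end

context subvariety
begin

definition rep_of :: "'v set \<Rightarrow> 'v \<Rightarrow> bool"
  where "rep_of l v \<longleftrightarrow> l \<in> Z \<and> v \<in> l \<and> v \<noteq> 0"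

lemma rep_of_line: "rep_of l v \<Longrightarrow> l = line scale v"
  using proj_pointD[of l UNIV v] Z_points by (auto simp: rep_of_def)

lemma rep_of_lineI: "\<lbrakk>v \<noteq> 0; line scale v \<in> Z\<rbrakk> \<Longrightarrow> rep_of (line scale v) v"
  using line_self by (simp add: rep_of_def)

lemma rep_of_multiple:
  assumes "rep_of l v" "rep_of l w"
  obtains c where "c \<noteq> 0" "w = scale c v"
proof -
  have "line scale w = line scale v" using rep_of_line[OF assms(1)] rep_of_line[OF assms(2)] by simp
  moreover have "w \<noteq> 0" using assms(2) by (simp add: rep_of_def)
  ultimately show ?thesis using line_eq_iff that by blast
qed

sublocale PZ: represented_space PZ rep_of "vreg PZ scale"
proof
  show "x \<in> points PZ" if "rep_of x r" for x r using that by (simp add: rep_of_def points_PZ)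
  show "\<exists>N \<sigma>. openin (ztop PZ) N \<and> x \<in> N \<and> vreg PZ scale N \<sigma> \<and> (\<forall>z\<in>N. rep_of z (\<sigma> z))"
    if "x \<in> points PZ" for x
  proof -
    have "x \<in> Z" using that points_PZ by simp
    then obtain N \<sigma> where N: "openin (ztop PZ) N" "x \<in> N" "vreg PZ scale N \<sigma>"
      "\<And>m. m \<in> N \<Longrightarrow> \<sigma> m \<in> m \<and> \<sigma> m \<noteq> 0" by (rule local_lift) blast
    moreover have "N \<subseteq> Z" using openin_subset[OF N(1)] points_PZ by simp
    ultimately show ?thesis by (intro exI[of _ N] exI[of _ \<sigma>]) (auto simp: rep_of_def)
  qed
qed (rule PZ.vreg_restrict)

end

section \<open>Projection of the quadric from an isotropic subspace\<close>

locale framed_quadratic_rep = quadratic_rep G scale Basis \<rho> q + framed_rep G scale Basis \<rho> f d v0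
  for G :: "('g, 'm) monoid_scheme" (structure)
    and scale :: "'k::field_char_0 \<Rightarrow> 'v::ab_group_add \<Rightarrow> 'v" and Basis :: "'v set" and \<rho> :: "'g \<Rightarrow> 'v \<Rightarrow> 'v"
    and q :: "'v \<Rightarrow> 'k" and f d v0

context quadratic_rep
begin

lemma regular_action_quadric: "regular_action G (proj_action \<rho>) (quadric scale q)"
proof -
  interpret Q: subvariety scale cone_lines by (rule subvariety_quadric)
  show ?thesis unfolding regular_action_def quadric_eq Q.points_PZ
  proof (intro conjI ballI)
    fix g assume g: "g \<in> carrier G"
    show "regular_map Q.PZ cone_lines Q.PZ cone_lines (proj_action \<rho> g)"
      unfolding proj_action_def
      by (rule regular_map_linear_image[OF linear_rho[OF g] Q.subvariety_axioms Q.subvariety_axioms])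
        (use rho_nonzero[OF g] line_in_cone_lines q_rho[OF g] in simp)
  qed (auto simp: proj_action_def rho_one rho_mult image_image)
qed

end

context framed_quadratic_rep
begin

text \<open>The condition on \<open>u \<in> U\<close> under which the fibre of the projection from \<open>P(W)\<close> over \<open>u\<close> is parametrized: the frame
trivializes it, and the coefficient of \<open>w0\<close> in its equation does not vanish.\<close>

definition nice :: "'v \<Rightarrow> 'v \<Rightarrow> bool"
  where "nice w0 u \<longleftrightarrow> good u \<and> B (A u w0) u \<noteq> 0"

lemma nice_nonzero: "nice w0 u \<Longrightarrow> u \<noteq> 0"
  by (auto simp: nice_def B_simps)

lemma nice_scale: "c \<noteq> 0 \<Longrightarrow> nice w0 (scale c u) \<longleftrightarrow> nice w0 u"
  by (simp add: nice_def good_scale A_scale B_simps)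

lemma open_nice:
  assumes X: "fspace_ring X" "openin (ztop X) N" "vreg X scale N E"
  shows "openin (ztop X) {x \<in> N. nice w0 (E x)}"
proof -
  let ?N = "{x \<in> N. good (E x)}"
  have N: "openin (ztop X) ?N" by (rule open_good[OF X])
  have E: "vreg X scale ?N E" by (rule fspace_ring.vreg_restrict[OF X(1,3) N]) blast
  have "openin (ztop X) {x \<in> ?N. B (A (E x) w0) (E x) \<noteq> 0}"
    by (rule fspace_ring.open_nonzero[OF X(1) N reg_B[OF X(1) N vreg_A[OF X(1) N E fspace_ring.vreg_const[OF X(1) N]] E]])
      simp
  moreover have "{x \<in> ?N. B (A (E x) w0) (E x) \<noteq> 0} = {x \<in> N. nice w0 (E x)}" by (auto simp: nice_def)
  ultimately show ?thesis by simp
qed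

text \<open>The birational map from \<open>P(C \<oplus> U)\<close> is \<open>c + u \<mapsto> A\<^sub>u (c + t w0) + u\<close>, where \<open>t\<close> solves the equation of the quadric.
Here \<open>E\<close> stands for \<open>C \<oplus> U\<close>, and \<open>P\<close>, \<open>Q\<close> are the projections of \<open>V = W \<oplus> U\<close>. All formulas are homogeneous of degree
one in \<open>c + u\<close>, because \<open>A\<^sub>u\<close> depends on the line of \<open>u\<close> only. The component in \<open>U\<close> of a
point of the domain is good, so it has trivial stabilizer, and then so has the point, since \<open>Q\<close> is equivariant.\<close>

theorem linearizable_quadric:
  assumes hyp: "hyperbolic_pair G scale \<rho> q W W'" and w0: "w0 \<in> W" "B w0 v0 \<noteq> 0"
    and v0U: "v0 \<in> sum_subspace W' (orthogonal_complement q (sum_subspace W W'))"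
    and irr: "irreducible_top (ztop (quadric scale q))"
  shows "linearizable G (proj_action \<rho>) (quadric scale q)"
proof -
  define U where "U = sum_subspace W' (orthogonal_complement q (sum_subspace W W'))"
  have iso: "isotropic_subspace G scale \<rho> q W" "isotropic_subspace G scale \<rho> q W'"
    using hyp unfolding hyperbolic_pair_def by blast+
  note W = isotropicD[OF iso(1)] and W' = isotropicD[OF iso(2)]
  note comp = hyperbolic_complement[OF hyp, folded U_def]
  have subU: "subspace U" unfolding comp(1) by (rule subspace_orthogonal_complement)
  have invU: "\<rho> g u \<in> U" if "g \<in> carrier G" "u \<in> U" for g u
    using orthogonal_complement_invariant[of W' g] W'(2) that unfolding comp(1) by blast
  obtain P where P: "Vector_Spaces.linear scale scale P" "\<And>v. P v \<in> W" "\<And>v. v - P v \<in> U"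
    "\<And>v w. \<lbrakk>w \<in> W; v - w \<in> U\<rbrakk> \<Longrightarrow> P v = w"
    using W(1) subU comp(2,3) by (rule projection_along) blast
  define Q where "Q v = v - P v" for v
  have linQ: "Vector_Spaces.linear scale scale Q"
    unfolding Vector_Spaces.linear_iff Q_def using vector_space_axioms
    by (simp add: linear_addD[OF P(1)] linear_scaleD[OF P(1)] scale_right_diff_distrib)
  have PQ: "P (w + u) = w" "Q (w + u) = u" if "w \<in> W" "u \<in> U" for w u
    using P(4)[of w "w + u"] that by (simp_all add: Q_def)
  have split: "v = P v + Q v" for v by (simp add: Q_def)
  have QU: "Q v \<in> U" for v using P(3) by (simp add: Q_def)
  have P_rho: "P (\<rho> g v) = \<rho> g (P v)" and Q_rho: "Q (\<rho> g v) = \<rho> g (Q v)" if g: "g \<in> carrier G" for g v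
  proof -
    have "\<rho> g v = \<rho> g (P v) + \<rho> g (Q v)" using split[of v] linear_addD[OF linear_rho[OF g]] by metis
    moreover have "\<rho> g (P v) \<in> W" using W(2)[OF g] P(2) by blast
    ultimately show "P (\<rho> g v) = \<rho> g (P v)" "Q (\<rho> g v) = \<rho> g (Q v)"
      using PQ invU[OF g QU] by metis+
  qed
  have AW: "A u w \<in> W" if "w \<in> W" for u w by (rule frame_in_subspace[OF W(1,2) that])
  have AiW: "Ai u w \<in> W" if "good u" "w \<in> W" for u w by (rule Ai_in_subspace[OF W(1,2) that])
  have w0_nz: "w0 \<noteq> 0" using w0(2) by (auto simp: B_simps)
  \<comment> \<open>The kernel of \<open>\<eta>\<close> in \<open>W\<close> is the complement \<open>C\<close> of the line of \<open>w0\<close>.\<close>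
  obtain \<eta> where \<eta>: "Vector_Spaces.linear scale (*) \<eta>" "\<eta> w0 = 1" using w0_nz by (rule separating_functional)
  define E where "E = {v. \<eta> (P v) = 0}"
  have subE: "subspace E"
    by (rule subspaceI) (auto simp: E_def linear_simps[OF P(1)] linear_simps[OF \<eta>(1)])
  \<comment> \<open>Trivial on \<open>W\<close>, hence on \<open>C\<close>, and the given action on \<open>U\<close>.\<close>
  define \<tau> where "\<tau> g v = P v + \<rho> g (Q v)" for g v
  have P\<tau>: "P (\<tau> g v) = P v" and Q\<tau>: "Q (\<tau> g v) = \<rho> g (Q v)" if "g \<in> carrier G" for g v
    unfolding \<tau>_def using PQ[OF P(2) invU[OF that QU]] by simp_all
  have rep\<tau>: "linear_representation G scale E \<tau>"
    unfolding linear_representation_def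
  proof (intro conjI ballI allI subE)
    fix g assume g: "g \<in> carrier G"
    show "\<tau> g ` E \<subseteq> E" using P\<tau>[OF g] by (auto simp: E_def)
    show "\<tau> g (v + w) = \<tau> g v + \<tau> g w" for v w
      by (simp add: \<tau>_def linear_addD[OF P(1)] linear_addD[OF linQ] linear_addD[OF linear_rho[OF g]])
    show "\<tau> g (scale c v) = scale c (\<tau> g v)" for c v
      by (simp add: \<tau>_def linear_scaleD[OF P(1)] linear_scaleD[OF linQ] linear_scaleD[OF linear_rho[OF g]]
          scale_right_distrib)
  next
    show "\<tau> \<one> v = v" for v using split[of v] by (simp add: \<tau>_def rho_one)
    show "\<tau> (g \<otimes> h) v = \<tau> g (\<tau> h v)" if "g \<in> carrier G" "h \<in> carrier G" for g h v
      using P\<tau>[OF that(2)] Q\<tau>[OF that(2)] that by (simp add: \<tau>_def[of g] \<tau>_def[of "g \<otimes> h"] rho_mult)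
  qed
  \<comment> \<open>On \<open>A u (c + t w0) + u\<close> the form is \<open>2 B (A u c) u + 2 t B (A u w0) u + q u\<close>.\<close>
  define t where "t v = - ((2 * B (A (Q v) (P v)) (Q v) + q (Q v)) / (2 * B (A (Q v) w0) (Q v)))" for v
  define \<Phi> where "\<Phi> v = A (Q v) (P v + scale (t v) w0) + Q v" for v
  define \<Psi> where "\<Psi> v = Ai (Q v) (P v) - scale (\<eta> (Ai (Q v) (P v))) w0 + Q v" for v
  define D where "D v = nice w0 (Q v)" for v
  have D_scale: "D (scale c v) \<longleftrightarrow> D v" if "c \<noteq> 0" for c v
    using that by (simp add: D_def linear_scaleD[OF linQ] nice_scale)
  have D_good: "good (Q v)" "B (A (Q v) w0) (Q v) \<noteq> 0" if "D v" for v using that by (auto simp: D_def nice_def)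
  have P\<Phi>: "P (\<Phi> v) = A (Q v) (P v + scale (t v) w0)" and Q\<Phi>: "Q (\<Phi> v) = Q v" for v
    unfolding \<Phi>_def using PQ[OF AW QU] subspace_add[OF W(1) P(2) subspace_scale[OF W(1) w0(1)]] by blast+
  have \<Psi>W: "Ai (Q v) (P v) - scale (\<eta> (Ai (Q v) (P v))) w0 \<in> W" if "D v" for v
    by (intro subspace_diff[OF W(1)] subspace_scale[OF W(1)] AiW D_good(1)[OF that] P(2) w0(1))
  have P\<Psi>: "P (\<Psi> v) = Ai (Q v) (P v) - scale (\<eta> (Ai (Q v) (P v))) w0" and Q\<Psi>: "Q (\<Psi> v) = Q v" if "D v" for v
    unfolding \<Psi>_def using PQ[OF \<Psi>W[OF that] QU] by blast+
  have D\<Phi>: "D (\<Phi> v) \<longleftrightarrow> D v" for v by (simp add: D_def Q\<Phi>)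
  have D\<Psi>: "D (\<Psi> v)" if "D v" for v using that Q\<Psi>[OF that] by (simp add: D_def)
  have D_nz: "v \<noteq> 0" if "D v" for v
    using that nice_nonzero[of w0 "Q v"] linear_zeroD[OF linQ] by (auto simp: D_def)
  have q_split: "q v = 2 * B (P v) (Q v) + q (Q v)" for v
  proof -
    have "q (P v) = 0" using W(3)[OF P(2) P(2)] by (simp add: q_polar)
    then show ?thesis using q_add[of "P v" "Q v"] split[of v] by simp
  qed
  have q\<Phi>: "q (\<Phi> v) = 0" if "D v" for v
  proof -
    have "B (P (\<Phi> v)) (Q v) = B (A (Q v) (P v)) (Q v) + t v * B (A (Q v) w0) (Q v)"
      unfolding P\<Phi> by (simp add: linear_addD[OF linear_frame] linear_scaleD[OF linear_frame] B_simps)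
    also have "2 * \<dots> = - q (Q v)" using D_good(2)[OF that] by (simp add: t_def field_simps)
    finally show ?thesis unfolding q_split[of "\<Phi> v"] Q\<Phi> by simp
  qed
  have \<Psi>E: "\<Psi> v \<in> E" if "D v" for v
    by (simp add: E_def P\<Psi>[OF that] linear_simps[OF \<eta>(1)] \<eta>(2))
  have \<Psi>\<Phi>: "\<Psi> (\<Phi> v) = v" if "D v" "v \<in> E" for v
  proof -
    have "Ai (Q (\<Phi> v)) (P (\<Phi> v)) = P v + scale (t v) w0"
      unfolding Q\<Phi> P\<Phi> by (rule Ai_A[OF D_good(1)[OF that(1)]])
    moreover have "\<eta> (P v + scale (t v) w0) = t v"
      using that(2) by (simp add: E_def linear_simps[OF \<eta>(1)] \<eta>(2))
    ultimately show ?thesis using split[of v] by (simp add: \<Psi>_def Q\<Phi>)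
  qed
  have \<Phi>\<Psi>: "\<Phi> (\<Psi> v) = v" if D: "D v" and qv: "q v = 0" for v
  proof -
    define y where "y = Ai (Q v) (P v)"
    have Ay: "A (Q v) y = P v" unfolding y_def by (rule A_Ai[OF D_good(1)[OF D]])
    have Py: "P (\<Psi> v) = y - scale (\<eta> y) w0" using P\<Psi>[OF D] by (simp add: y_def)
    have "2 * B (A (Q v) (P (\<Psi> v))) (Q v) + q (Q v) = - (\<eta> y * (2 * B (A (Q v) w0) (Q v)))"
      using qv q_split[of v] unfolding Py
      by (simp add: linear_diffD[OF linear_frame] linear_scaleD[OF linear_frame] Ay B_simps algebra_simps)
    then have "t (\<Psi> v) = \<eta> y" using D_good(2)[OF D] by (simp add: t_def Q\<Psi>[OF D])
    then have "P (\<Psi> v) + scale (t (\<Psi> v)) w0 = y" by (simp add: Py)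
    then show ?thesis using split[of v] by (simp add: \<Phi>_def Q\<Psi>[OF D] Ay)
  qed
  have t_scale: "t (scale c v) = c * t v" if "c \<noteq> 0" for c v
    using that by (simp add: t_def linear_scaleD[OF P(1)] linear_scaleD[OF linQ] A_scale
        linear_scaleD[OF linear_frame] B_simps q_scale power2_eq_square divide_simps) (simp add: algebra_simps)
  have \<Phi>_scale: "\<Phi> (scale c v) = scale c (\<Phi> v)" if "c \<noteq> 0" for c v
    using that by (simp add: \<Phi>_def t_scale linear_scaleD[OF P(1)] linear_scaleD[OF linQ] A_scale
        linear_addD[OF linear_frame] linear_scaleD[OF linear_frame] scale_right_distrib)
  have \<Psi>_scale: "\<Psi> (scale c v) = scale c (\<Psi> v)" if "c \<noteq> 0" "D v" for c v
    using that(1) by (simp add: \<Psi>_def linear_scaleD[OF P(1)] linear_scaleD[OF linQ] Ai_scale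
        linear_scaleD[OF linear_Ai[OF D_good(1)[OF that(2)]]] linear_scaleD[OF \<eta>(1)]
        scale_right_distrib scale_right_diff_distrib)
  have \<Phi>_equiv: "\<Phi> (\<tau> g v) = \<rho> g (\<Phi> v)" if g: "g \<in> carrier G" for g v
  proof -
    have "t (\<tau> g v) = t v"
      by (simp add: t_def P\<tau>[OF g] Q\<tau>[OF g] frame_rho[OF g] B_rho[OF g] q_rho[OF g])
    then show ?thesis
      by (simp add: \<Phi>_def P\<tau>[OF g] Q\<tau>[OF g] frame_rho[OF g] linear_addD[OF linear_rho[OF g]])
  qed
  interpret S: subvariety scale "proj_points scale E" by (rule subvariety_proj_space[OF vector_space_axioms])
  interpret C: subvariety scale cone_lines by (rule subvariety_quadric)
  have open_D: "openin (ztop X) {z \<in> N. D (\<sigma> z)}"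
    if "fspace_ring X" "openin (ztop X) N" "vreg X scale N \<sigma>" for X :: "('v set, 'k) fspace" and N \<sigma>
    unfolding D_def by (rule open_nice[OF that(1,2) vreg_linear[OF that(3) linQ]])
  have vreg_\<Phi>: "vreg X scale N (\<lambda>z. \<Phi> (\<sigma> z))"
    if X: "fspace_ring X" "openin (ztop X) N" "vreg X scale N \<sigma>" "\<forall>z\<in>N. D (\<sigma> z)"
    for X :: "('v set, 'k) fspace" and N \<sigma>
  proof -
    interpret X: fspace_ring X by (rule X(1))
    note Qr = vreg_linear[OF X(3) linQ] and Pr = vreg_linear[OF X(3) P(1)]
    have gd: "good (Q (\<sigma> z))" "B (A (Q (\<sigma> z)) w0) (Q (\<sigma> z)) \<noteq> 0" if "z \<in> N" for z
      using D_good X(4) that by blast+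
    have t: "reg X N (\<lambda>z. t (\<sigma> z))" unfolding t_def
      by (intro X.reg_minus X.reg_divide X.reg_add X.reg_cmult reg_B reg_q vreg_A X.vreg_const Qr Pr gd X(1,2))
        (use gd in auto)
    show ?thesis unfolding \<Phi>_def
      by (intro X.vreg_add vreg_A X.vreg_scale X.vreg_const t Qr Pr gd X(1,2))
  qed
  have vreg_\<Psi>: "vreg X scale N (\<lambda>z. \<Psi> (\<sigma> z))"
    if X: "fspace_ring X" "openin (ztop X) N" "vreg X scale N \<sigma>" "\<forall>z\<in>N. D (\<sigma> z)"
    for X :: "('v set, 'k) fspace" and N \<sigma>
  proof -
    interpret X: fspace_ring X by (rule X(1))
    note Qr = vreg_linear[OF X(3) linQ] and Pr = vreg_linear[OF X(3) P(1)]
    have gd: "good (Q (\<sigma> z))" if "z \<in> N" for z using D_good X(4) that by blast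
    have y: "vreg X scale N (\<lambda>z. Ai (Q (\<sigma> z)) (P (\<sigma> z)))" by (rule vreg_Ai[OF X(1,2) Qr Pr gd])
    show ?thesis unfolding \<Psi>_def
      by (intro X.vreg_add X.vreg_diff X.vreg_scale X.vreg_const vregD[OF y \<eta>(1)] y Qr X(2))
  qed
  have S_E: "v \<in> E" if "S.rep_of l v" for l v
    using that line_in_subspace_points[OF subE, of v] S.rep_of_line[OF that] by (simp add: S.rep_of_def)
  have C_q: "q v = 0" if "C.rep_of l v" for l v using that by (auto simp: C.rep_of_def)
  have D_inv_S: "D r'" if "S.rep_of x r" "S.rep_of x r'" "D r" for x r r'
    using S.rep_of_multiple[OF that(1,2)] D_scale that(3) by metis
  have D_inv_C: "D r'" if "C.rep_of x r" "C.rep_of x r'" "D r" for x r r'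
    using C.rep_of_multiple[OF that(1,2)] D_scale that(3) by metis
  have \<Phi>_line: "line scale (\<Phi> r) = line scale (\<Phi> r')" if "S.rep_of x r" "S.rep_of x r'" for x r r'
    using S.rep_of_multiple[OF that] \<Phi>_scale line_scale by metis
  have \<Psi>_line: "line scale (\<Psi> r) = line scale (\<Psi> r')" if "C.rep_of x r" "C.rep_of x r'" "D r" for x r r'
    using C.rep_of_multiple[OF that(1,2)] \<Psi>_scale[OF _ that(3)] line_scale by metis
  have \<Phi>_rep: "C.rep_of (line scale (\<Phi> v)) (\<Phi> v)" if "D v" for v
    using that D\<Phi> D_nz[of "\<Phi> v"] q\<Phi>[OF that] line_in_cone_lines[of "\<Phi> v"] by (intro C.rep_of_lineI) simp_all
  have \<Psi>_rep: "S.rep_of (line scale (\<Psi> v)) (\<Psi> v)" if "D v" for v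
    using D_nz[OF D\<Psi>[OF that]] \<Psi>E[OF that] by (intro S.rep_of_lineI line_in_proj_points) simp_all
  define \<phi> where "\<phi> l = line scale (\<Phi> (S.PZ.pick l))" for l
  define \<psi> where "\<psi> l = line scale (\<Psi> (C.PZ.pick l))" for l
  have op_S: "openin (ztop S.PZ) {z \<in> N. D (\<sigma> z)}"
    if "openin (ztop S.PZ) N" "vreg S.PZ scale N \<sigma>" "\<forall>z\<in>N. S.rep_of z (\<sigma> z)" for N \<sigma>
    by (rule open_D[OF S.PZ.fspace_ring_axioms that(1,2)])
  have op_C: "openin (ztop C.PZ) {z \<in> N. D (\<sigma> z)}"
    if "openin (ztop C.PZ) N" "vreg C.PZ scale N \<sigma>" "\<forall>z\<in>N. C.rep_of z (\<sigma> z)" for N \<sigma>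
    by (rule open_D[OF C.PZ.fspace_ring_axioms that(1,2)])
  have vr_S: "vreg S.PZ scale N (\<lambda>z. \<Phi> (\<sigma> z))"
    if "openin (ztop S.PZ) N" "vreg S.PZ scale N \<sigma>" "\<forall>z\<in>N. S.rep_of z (\<sigma> z)" "\<forall>z\<in>N. D (\<sigma> z)" for N \<sigma>
    by (rule vreg_\<Phi>[OF S.PZ.fspace_ring_axioms that(1,2,4)])
  have vr_C: "vreg C.PZ scale N (\<lambda>z. \<Psi> (\<sigma> z))"
    if "openin (ztop C.PZ) N" "vreg C.PZ scale N \<sigma>" "\<forall>z\<in>N. C.rep_of z (\<sigma> z)" "\<forall>z\<in>N. D (\<sigma> z)" for N \<sigma>
    by (rule vreg_\<Psi>[OF C.PZ.fspace_ring_axioms that(1,2,4)])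
  have line_S: "line scale (\<Phi> r) = line scale (\<Phi> r')"
    if "S.rep_of x r" "S.rep_of x r'" "D r" "D r'" for x r r' using \<Phi>_line that(1,2) .
  have line_C: "line scale (\<Psi> r) = line scale (\<Psi> r')"
    if "C.rep_of x r" "C.rep_of x r'" "D r" "D r'" for x r r' using \<Psi>_line that(1-3) .
  have img_S: "\<Phi> r \<noteq> 0 \<and> line scale (\<Phi> r) \<in> cone_lines" if "S.rep_of x r" "D r" for x r
    using \<Phi>_rep[OF that(2)] unfolding C.rep_of_def by (elim conjE) (intro conjI)
  have img_C: "\<Psi> r \<noteq> 0 \<and> line scale (\<Psi> r) \<in> proj_points scale E" if "C.rep_of x r" "D r" for x r
    using \<Psi>_rep[OF that(2)] unfolding S.rep_of_def by (elim conjE) (intro conjI)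
  have \<phi>: "regular_map S.PZ (S.PZ.dom D) C.PZ cone_lines \<phi>" unfolding \<phi>_def
    by (rule S.PZ.regular_map_on_dom(1)[OF D_inv_S op_S C.subvariety_axioms vr_S line_S img_S])
  have \<phi>_val: "\<phi> l = line scale (\<Phi> r)" if "S.rep_of l r" "D r" for l r unfolding \<phi>_def
    by (rule S.PZ.regular_map_on_dom(2)[where D = D, OF D_inv_S op_S C.subvariety_axioms vr_S line_S img_S that])
  have \<psi>: "regular_map C.PZ (C.PZ.dom D) S.PZ (proj_points scale E) \<psi>" unfolding \<psi>_def
    by (rule C.PZ.regular_map_on_dom(1)[OF D_inv_C op_C S.subvariety_axioms vr_C line_C img_C])
  have \<psi>_val: "\<psi> l = line scale (\<Psi> r)" if "C.rep_of l r" "D r" for l r unfolding \<psi>_def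
    by (rule C.PZ.regular_map_on_dom(2)[where D = D, OF D_inv_C op_C S.subvariety_axioms vr_C line_C img_C that])
  have oS: "openin (ztop S.PZ) (S.PZ.dom D)"
    by (rule S.PZ.open_dom[OF D_inv_S op_S])
  have oC: "openin (ztop C.PZ) (C.PZ.dom D)"
    by (rule C.PZ.open_dom[OF D_inv_C op_C])
  have v0E: "v0 \<in> E" and Dv0: "D v0"
  proof -
    have "P v0 = 0" "Q v0 = v0"
      using PQ[OF subspace_0[OF W(1)], of v0] v0U by (simp_all add: U_def)
    then show "v0 \<in> E" "D v0"
      using good_v0 w0(2) by (simp_all add: E_def linear_zeroD[OF \<eta>(1)] D_def nice_def frame_v0)
  qed
  have "S.rep_of (line scale v0) v0"
    using v0_nonzero v0E by (intro S.rep_of_lineI line_in_proj_points)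
  then have "line scale v0 \<in> S.PZ.dom D" using Dv0 unfolding S.PZ.dom_def by blast
  then have dS: "dense_open S.PZ (S.PZ.dom D)"
    by (intro dense_open_irreducible[OF irreducible_proj_space[OF vector_space_axioms subE] oS]) blast
  have "line scale (\<Phi> v0) \<in> C.PZ.dom D" using \<Phi>_rep[OF Dv0] Dv0 D\<Phi> unfolding C.PZ.dom_def by blast
  then have dC: "dense_open C.PZ (C.PZ.dom D)"
    by (intro dense_open_irreducible[OF irr[unfolded quadric_eq] oC]) blast
  have bir: "equivariantly_birational G (proj_action \<tau>) (proj_space scale E) (proj_action \<rho>) C.PZ"
    unfolding equivariantly_birational_def
  proof (rule exI[of _ "S.PZ.dom D"], rule exI[of _ "C.PZ.dom D"], rule exI[of _ \<phi>], rule exI[of _ \<psi>],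
      intro conjI dS dC ballI impI)
    have img\<phi>: "\<phi> l \<in> C.PZ.dom D" if "l \<in> S.PZ.dom D" for l
      using that
    proof (rule S.PZ.domE)
      fix r assume r: "S.rep_of l r" "D r"
      show ?thesis unfolding \<phi>_val[OF r] C.PZ.dom_def using \<Phi>_rep[OF r(2)] r(2) D\<Phi> by blast
    qed
    have img\<psi>: "\<psi> l \<in> S.PZ.dom D" if "l \<in> C.PZ.dom D" for l
      using that
    proof (rule C.PZ.domE)
      fix r assume r: "C.rep_of l r" "D r"
      show ?thesis unfolding \<psi>_val[OF r] S.PZ.dom_def using \<Psi>_rep[OF r(2)] D\<Psi>[OF r(2)] by blast
    qed
    show "regular_map S.PZ (S.PZ.dom D) C.PZ (C.PZ.dom D) \<phi>"
      by (rule regular_map_codomain[OF \<phi>])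
        (use img\<phi> openin_subset[OF oC] C.points_PZ in auto)
    show "regular_map C.PZ (C.PZ.dom D) S.PZ (S.PZ.dom D) \<psi>"
      by (rule regular_map_codomain[OF \<psi>])
        (use img\<psi> openin_subset[OF oS] S.points_PZ in auto)
    show "\<psi> (\<phi> l) = l" if "l \<in> S.PZ.dom D" for l
      using that
    proof (rule S.PZ.domE)
      fix r assume r: "S.rep_of l r" "D r"
      have "\<psi> (\<phi> l) = line scale (\<Psi> (\<Phi> r))"
        unfolding \<phi>_val[OF r] by (rule \<psi>_val[OF \<Phi>_rep[OF r(2)]]) (use r D\<Phi> in simp)
      also have "\<dots> = l" using \<Psi>\<Phi>[OF r(2) S_E[OF r(1)]] S.rep_of_line[OF r(1)] by simp
      finally show ?thesis .
    qed
    show "\<phi> (\<psi> l) = l" if "l \<in> C.PZ.dom D" for l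
      using that
    proof (rule C.PZ.domE)
      fix r assume r: "C.rep_of l r" "D r"
      have "\<phi> (\<psi> l) = line scale (\<Phi> (\<Psi> r))"
        unfolding \<psi>_val[OF r] by (rule \<phi>_val[OF \<Psi>_rep[OF r(2)] D\<Psi>[OF r(2)]])
      also have "\<dots> = l" using \<Phi>\<Psi>[OF r(2) C_q[OF r(1)]] C.rep_of_line[OF r(1)] by simp
      finally show ?thesis .
    qed
    show "\<phi> (proj_action \<tau> g l) = proj_action \<rho> g (\<phi> l)"
      if g: "g \<in> carrier G" and l: "l \<in> S.PZ.dom D" "proj_action \<tau> g l \<in> S.PZ.dom D" for g l
      using l(1)
    proof (rule S.PZ.domE)
      fix r assume r: "S.rep_of l r" "D r"
      have \<tau>r: "\<tau> g r \<in> proj_action \<tau> g l" using r(1) by (simp add: proj_action_def S.rep_of_def)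
      have D\<tau>: "D (\<tau> g r)"
        using r(2) by (simp add: D_def nice_def Q\<tau>[OF g] good_rho[OF g] frame_rho[OF g] B_rho[OF g])
      have "proj_action \<tau> g l \<in> proj_points scale E" using openin_subset[OF oS] l(2) S.points_PZ by auto
      then have "S.rep_of (proj_action \<tau> g l) (\<tau> g r)" using \<tau>r D_nz[OF D\<tau>] by (simp add: S.rep_of_def)
      then have "\<phi> (proj_action \<tau> g l) = line scale (\<Phi> (\<tau> g r))" using D\<tau> by (rule \<phi>_val)
      also have "\<dots> = proj_action \<rho> g (\<phi> l)"
        by (simp add: \<Phi>_equiv[OF g] \<phi>_val[OF r] proj_action_line[OF g])
      finally show ?thesis .
    qed
  qed
  have free: "generically_free G (proj_action \<rho>) C.PZ"
    unfolding generically_free_def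
  proof (intro exI[of _ "C.PZ.dom D"] conjI dC ballI impI)
    fix l g assume l: "l \<in> C.PZ.dom D" and g: "g \<in> carrier G" and fix_l: "proj_action \<rho> g l = l"
    from l obtain r where r: "C.rep_of l r" "D r" by (rule C.PZ.domE)
    have "\<rho> g r \<in> l" using r(1) fix_l by (auto simp: proj_action_def C.rep_of_def)
    then obtain c where "\<rho> g r = scale c r" using C.rep_of_line[OF r(1)] by (auto simp: line_def)
    then have "\<rho> g (Q r) = scale c (Q r)" using Q_rho[OF g, of r] linear_scaleD[OF linQ] by simp
    moreover have "free_vec (Q r)"
      by (rule good_free[OF D_good(1)[OF r(2)] nice_nonzero[OF r(2)[unfolded D_def]]])
    ultimately show "g = \<one>" using g unfolding free_vec_def by blast
  qed
  obtain Bs where Bs: "Bs \<subseteq> E" "independent Bs" "E \<subseteq> span Bs" by (rule basis_exists[of E]) blast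
  have E_span: "E = span Bs" using Bs(1,3) span_minimal[OF Bs(1) subE] by blast
  have "finite Bs" using finiteI_independent[OF Bs(2)] .
  from linear_model[OF group_axioms vector_space_axioms this E_span v0E v0_nonzero rep\<tau> bir]
  show ?thesis unfolding linearizable_def quadric_eq
    using regular_action_quadric[unfolded quadric_eq] free by blast
qed

end

section \<open>Stereographic projection of the family of twisted quadrics\<close>

text \<open>The vector \<open>v0\<close> plays two roles: the frame is normalized there, and with \<open>w0\<close> it spans a hyperbolic plane.\<close>

locale quadric_projection = framed_quadratic_rep G scale Basis \<rho> q f d v0
  for G :: "('g, 'm) monoid_scheme" (structure)
    and scale :: "'k::field_char_0 \<Rightarrow> 'v::ab_group_add \<Rightarrow> 'v" and Basis :: "'v set" and \<rho> :: "'g \<Rightarrow> 'v \<Rightarrow> 'v"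
    and q :: "'v \<Rightarrow> 'k" and f d v0 +
  fixes W :: "'v set" and w0 :: 'v
  assumes W: "isotropic_subspace G scale \<rho> q W" and w0: "w0 \<in> W"
    and q_v0: "q v0 = 0" and B_w0_v0: "B w0 v0 \<noteq> 0"
begin

text \<open>The base point of the stereographic projection, moved from the fibre \<open>q(A\<^sub>v y) = 0\<close> back to the quadric.\<close>

definition \<omega> :: "'v \<Rightarrow> 'v"
  where "\<omega> v = A v w0"

text \<open>An invariant of degree one in \<open>v\<close>. It gives \<open>c \<in> C\<close>, which is of degree one on \<open>P(C \<oplus> V)\<close>, the affine scale
\<open>c / lam v\<close>.\<close>

definition lam :: "'v \<Rightarrow> 'k"
  where "lam v = B (\<omega> v) v"

text \<open>The direction of the line through \<open>w0\<close> with affine parameter \<open>c / lam v\<close>, scaled by \<open>lam v\<close> to be of degree one.\<close>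

definition chord :: "'v \<Rightarrow> 'v \<Rightarrow> 'v"
  where "chord c v = c + scale (lam v / B w0 v0) v0"

text \<open>The point of \<open>X\<close> with parameter \<open>c\<close>: the second point on a line through \<open>\<omega> v\<close>.\<close>

definition param :: "'v \<Rightarrow> 'v \<Rightarrow> 'v"
  where "param c v = second_point (\<omega> v) (A v (chord c v))"

definition param_ok :: "'v \<Rightarrow> 'v \<Rightarrow> bool"
  where "param_ok c v \<longleftrightarrow> good v \<and> lam v \<noteq> 0 \<and> B (\<omega> v) (A v (chord c v)) \<noteq> 0 \<and> good (param c v)"

text \<open>The orthogonal complement of the hyperbolic plane spanned by \<open>w0\<close> and \<open>v0\<close>.\<close>

definition C :: "'v set"
  where "C = {c. B w0 c = 0 \<and> B v0 c = 0}"

text \<open>The orthogonal projection to \<open>C\<close>; \<open>w0\<close> and \<open>v0\<close> are isotropic.\<close>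

definition prC :: "'v \<Rightarrow> 'v"
  where "prC y = y - scale (B v0 y / B w0 v0) w0 - scale (B w0 y / B w0 v0) v0"

text \<open>Move \<open>x\<close> to the fibre over \<open>v\<close> and project it from \<open>w0\<close>. The component along \<open>v0\<close> is scaled as in
\<open>chord\<close>.\<close>

definition unparam :: "'v \<Rightarrow> 'v \<Rightarrow> 'v"
  where "unparam x v = scale (lam v / B w0 (Ai v x)) (prC (Ai v x))"

definition unparam_ok :: "'v \<Rightarrow> 'v \<Rightarrow> bool"
  where "unparam_ok x v \<longleftrightarrow> good x \<and> good v \<and> lam v \<noteq> 0 \<and> B (\<omega> v) x \<noteq> 0 \<and> B w0 (Ai v x) \<noteq> 0"

lemma q_w0: "q w0 = 0" and B_w0_w0: "B w0 w0 = 0" and B_v0_v0: "B v0 v0 = 0" and B_v0_w0: "B v0 w0 = B w0 v0"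
  using isotropicD(3)[OF W w0 w0] q_v0 B_sym[of v0 w0] by (simp_all add: q_polar)

lemma q_omega: "q (\<omega> v) = 0" and B_omega: "B (\<omega> v) (\<omega> v) = 0"
proof -
  have "\<omega> v \<in> W" unfolding \<omega>_def by (rule frame_in_subspace[OF isotropicD(1,2)[OF W] w0])
  then show "B (\<omega> v) (\<omega> v) = 0" by (intro isotropicD(3)[OF W])
  then show "q (\<omega> v) = 0" by (simp add: q_polar)
qed

lemma subspace_C: "subspace C"
  by (rule subspaceI) (auto simp: C_def B_simps)

lemma linear_prC: "Vector_Spaces.linear scale scale prC"
  unfolding Vector_Spaces.linear_iff prC_def using vector_space_axioms
  by (simp add: B_simps scale_left_distrib scale_right_diff_distrib add_divide_distrib algebra_simps)

lemma prC_C: "prC y \<in> C"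
  using B_w0_v0 by (simp add: C_def prC_def B_simps B_w0_w0 B_v0_v0 B_v0_w0)

lemma prC_id: "c \<in> C \<Longrightarrow> prC c = c"
  by (simp add: C_def prC_def)

lemma prC_w0: "prC w0 = 0" and prC_v0: "prC v0 = 0"
  using B_w0_v0 by (simp_all add: prC_def B_w0_w0 B_v0_v0 B_v0_w0)

lemma lam_scale: "a \<noteq> 0 \<Longrightarrow> lam (scale a v) = a * lam v"
  by (simp add: lam_def \<omega>_def A_scale B_simps)

lemma omega_scale: "a \<noteq> 0 \<Longrightarrow> \<omega> (scale a v) = \<omega> v"
  by (simp add: \<omega>_def A_scale)

lemma lam_nonzero: "lam v \<noteq> 0 \<Longrightarrow> v \<noteq> 0"
  by (auto simp: lam_def B_simps)

lemma chord_scale: "a \<noteq> 0 \<Longrightarrow> chord (scale a c) (scale a v) = scale a (chord c v)"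
  by (simp add: chord_def lam_scale scale_right_distrib)

lemma second_point_scale: "second_point x (scale a z) = scale (a\<^sup>2) (second_point x z)"
  by (simp add: second_point_def q_scale B_simps scale_right_diff_distrib power2_eq_square mult_ac)

lemma param_scale: "a \<noteq> 0 \<Longrightarrow> param (scale a c) (scale a v) = scale (a\<^sup>2) (param c v)"
  by (simp add: param_def chord_scale omega_scale A_scale linear_scaleD[OF linear_frame] second_point_scale)

lemma param_ok_scale: "a \<noteq> 0 \<Longrightarrow> param_ok (scale a c) (scale a v) \<longleftrightarrow> param_ok c v"
  by (simp add: param_ok_def good_scale lam_scale chord_scale omega_scale A_scale
      linear_scaleD[OF linear_frame] B_simps param_scale)

lemma omega_rho: "g \<in> carrier G \<Longrightarrow> \<omega> (\<rho> g v) = \<rho> g (\<omega> v)"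
  by (simp add: \<omega>_def frame_rho)

lemma lam_rho: "g \<in> carrier G \<Longrightarrow> lam (\<rho> g v) = lam v"
  by (simp add: lam_def omega_rho B_rho)

lemma param_rho: "g \<in> carrier G \<Longrightarrow> param c (\<rho> g v) = \<rho> g (param c v)"
  by (simp add: param_def chord_def omega_rho lam_rho frame_rho second_point_def q_rho B_rho
      linear_diffD[OF linear_rho] linear_scaleD[OF linear_rho])

lemma param_ok_rho: "g \<in> carrier G \<Longrightarrow> param_ok c (\<rho> g v) \<longleftrightarrow> param_ok c v"
  by (simp add: param_ok_def good_rho lam_rho param_rho) (simp add: chord_def omega_rho lam_rho frame_rho B_rho)

lemma q_param: "q (param c v) = 0"
  unfolding param_def by (rule q_second_point[OF q_omega])

lemma param_nonzero: "param_ok c v \<Longrightarrow> param c v \<noteq> 0"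
  unfolding param_def param_ok_def by (intro second_point_nonzero[OF q_omega]) blast

lemma Ai_param:
  assumes "param_ok c v"
  shows "Ai v (param c v) =
    scale (q (A v (chord c v))) w0 - scale (2 * B (\<omega> v) (A v (chord c v))) (chord c v)"
proof -
  have v: "good v" using assms by (simp add: param_ok_def)
  show ?thesis
    by (rule Ai_eqI[OF v])
      (simp add: param_def second_point_def \<omega>_def linear_diffD[OF linear_frame] linear_scaleD[OF linear_frame])
qed

lemma B_w0_chord: "c \<in> C \<Longrightarrow> B w0 (chord c v) = lam v"
  using B_w0_v0 by (simp add: chord_def C_def B_simps)

lemma unparam_ok_param:
  assumes ok: "param_ok c v" and c: "c \<in> C"
  shows "unparam_ok (param c v) v"
proof -
  have "B w0 (Ai v (param c v)) = - (2 * B (\<omega> v) (A v (chord c v)) * lam v)"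
    using B_w0_chord[OF c] by (simp add: Ai_param[OF ok] B_simps B_w0_w0)
  moreover have "B (\<omega> v) (param c v) = - (2 * (B (\<omega> v) (A v (chord c v)))\<^sup>2)"
    unfolding param_def using B_second_point[OF B_omega] by (simp add: power2_eq_square)
  ultimately show ?thesis using ok by (simp add: unparam_ok_def param_ok_def)
qed

lemma unparam_param:
  assumes ok: "param_ok c v" and c: "c \<in> C"
  shows "unparam (param c v) v = c"
proof -
  let ?p = "B (\<omega> v) (A v (chord c v))"
  have nz: "?p \<noteq> 0" "lam v \<noteq> 0" using ok by (simp_all add: param_ok_def)
  have eps: "B w0 (Ai v (param c v)) = - (2 * ?p * lam v)"
    using B_w0_chord[OF c] by (simp add: Ai_param[OF ok] B_simps B_w0_w0)
  have "prC (chord c v) = c"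
    by (simp add: chord_def linear_simps[OF linear_prC] prC_id[OF c] prC_v0)
  then have "prC (Ai v (param c v)) = scale (- (2 * ?p)) c"
    by (simp add: Ai_param[OF ok] linear_simps[OF linear_prC] prC_w0)
  then have "unparam (param c v) v = scale (lam v / (- (2 * ?p * lam v)) * (- (2 * ?p))) c"
    unfolding unparam_def eps by simp
  also have "lam v / (- (2 * ?p * lam v)) * (- (2 * ?p)) = 1" using nz by (simp add: field_simps)
  finally show ?thesis by simp
qed

lemma unparam_in_C: "unparam x v \<in> C"
  unfolding unparam_def by (rule subspace_scale[OF subspace_C prC_C])

text \<open>The chord direction recovered from \<open>x\<close> is a multiple of \<open>x - s \<omega> v\<close>, so it spans the same line through \<open>\<omega> v\<close> as
\<open>x\<close> does, and \<open>x\<close> is the second point on it.\<close>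

lemma param_unparam:
  assumes ok: "unparam_ok x v" and qx: "q x = 0"
  shows "\<exists>a. a \<noteq> 0 \<and> param (unparam x v) v = scale a x" and "param_ok (unparam x v) v"
proof -
  define y where "y = Ai v x"
  \<comment> \<open>The factors by which \<open>unparam\<close> scales \<open>y\<close> and by which \<open>w0\<close> occurs in \<open>y\<close>.\<close>
  define k where "k = lam v / B w0 y"
  define s where "s = B v0 y / B w0 v0"
  have v: "good v" "good x" and nz: "lam v \<noteq> 0" "B (\<omega> v) x \<noteq> 0" "B w0 y \<noteq> 0"
    using ok by (simp_all add: unparam_ok_def y_def)
  have k: "k \<noteq> 0" using nz by (simp add: k_def)
  have Ay: "A v y = x" unfolding y_def by (rule A_Ai[OF v(1)])
  have keq: "lam v / B w0 v0 = k * (B w0 y / B w0 v0)" using nz by (simp add: k_def)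
  have "chord (unparam x v) v = scale k (prC y) + scale k (scale (B w0 y / B w0 v0) v0)"
    unfolding chord_def unparam_def y_def[symmetric] k_def[symmetric] keq scale_scale by (rule refl)
  also have "\<dots> = scale k (y - scale s w0)"
    unfolding prC_def s_def scale_right_distrib[symmetric] by simp
  finally have zeta: "A v (chord (unparam x v) v) = scale k (x - scale s (\<omega> v))"
    by (simp add: linear_simps[OF linear_frame] Ay \<omega>_def)
  have p: "B (\<omega> v) (A v (chord (unparam x v) v)) = k * B (\<omega> v) x"
    unfolding zeta by (simp add: B_simps B_omega)
  have qz: "q (A v (chord (unparam x v) v)) = - (2 * k\<^sup>2 * s * B (\<omega> v) x)"
    unfolding zeta using B_sym[of x "\<omega> v"]
    by (simp add: q_scale q_diff qx q_omega B_simps)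
  have par: "param (unparam x v) v = scale (- (2 * k\<^sup>2 * B (\<omega> v) x)) x"
    unfolding param_def second_point_def p qz unfolding zeta
    by (simp add: scale_right_diff_distrib power2_eq_square mult_ac)
  moreover have "- (2 * k\<^sup>2 * B (\<omega> v) x) \<noteq> 0" using k nz by simp
  ultimately show "\<exists>a. a \<noteq> 0 \<and> param (unparam x v) v = scale a x" by blast
  show "param_ok (unparam x v) v"
    unfolding param_ok_def p par using good_scale[OF \<open>- (2 * k\<^sup>2 * B (\<omega> v) x) \<noteq> 0\<close>, of x] v k nz by simp
qed

lemma unparam_scale:
  assumes "a \<noteq> 0" "b \<noteq> 0" "good v"
  shows "unparam (scale a x) (scale b v) = scale b (unparam x v)"
    and "unparam_ok (scale a x) (scale b v) \<longleftrightarrow> unparam_ok x v"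
  using assms
  by (simp_all add: unparam_def unparam_ok_def lam_scale Ai_scale linear_scaleD[OF linear_Ai[OF assms(3)]]
      B_simps linear_scaleD[OF linear_prC] good_scale omega_scale)

lemma unparam_ok_v0: "unparam_ok v0 v0"
proof -
  have "Ai v0 v0 = v0" by (rule Ai_eqI[OF good_v0]) (simp add: frame_v0)
  then show ?thesis using B_w0_v0 good_v0 by (simp add: unparam_ok_def lam_def \<omega>_def frame_v0)
qed

lemma vreg_omega:
  assumes X: "fspace_ring X" "openin (ztop X) N" "vreg X scale N E" and gd: "\<And>x. x \<in> N \<Longrightarrow> good (E x)"
  shows "vreg X scale N (\<lambda>x. \<omega> (E x))"
  unfolding \<omega>_def by (rule vreg_A[OF X fspace_ring.vreg_const[OF X(1,2)] gd])

lemma reg_lam: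
  assumes X: "fspace_ring X" "openin (ztop X) N" "vreg X scale N E" and gd: "\<And>x. x \<in> N \<Longrightarrow> good (E x)"
  shows "reg X N (\<lambda>x. lam (E x))"
  unfolding lam_def by (rule reg_B[OF X(1,2) vreg_omega[OF X gd] X(3)])

lemma vreg_zeta:
  assumes X: "fspace_ring X" "openin (ztop X) N" "vreg X scale N E" "vreg X scale N F"
    and gd: "\<And>x. x \<in> N \<Longrightarrow> good (E x)"
  shows "vreg X scale N (\<lambda>x. A (E x) (chord (F x) (E x)))"
proof -
  interpret X: fspace_ring X by (rule X(1))
  have "reg X N (\<lambda>x. lam (E x) / B w0 v0)"
    by (intro X.reg_divide X.reg_const reg_lam[OF X(1-3) gd] X(2) B_w0_v0)
  then have "vreg X scale N (\<lambda>x. chord (F x) (E x))"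
    unfolding chord_def by (intro X.vreg_add X.vreg_scale X.vreg_const X)
  then show ?thesis by (rule vreg_A[OF X(1-3) _ gd])
qed

lemma vreg_param:
  assumes X: "fspace_ring X" "openin (ztop X) N" "vreg X scale N E" "vreg X scale N F"
    and gd: "\<And>x. x \<in> N \<Longrightarrow> good (E x)"
  shows "vreg X scale N (\<lambda>x. param (F x) (E x))"
proof -
  interpret X: fspace_ring X by (rule X(1))
  note z = vreg_zeta[OF X gd] and o = vreg_omega[OF X(1-3) gd]
  show ?thesis unfolding param_def second_point_def
    by (intro X.vreg_diff X.vreg_scale X.reg_cmult reg_q reg_B z o X(1,2))
qed

lemma open_param_ok:
  assumes X: "fspace_ring X" "openin (ztop X) N" "vreg X scale N E" "vreg X scale N F"
  shows "openin (ztop X) {x \<in> N. param_ok (F x) (E x)}"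
proof -
  interpret X: fspace_ring X by (rule X(1))
  let ?N = "{x \<in> N. good (E x)}"
  have N: "openin (ztop X) ?N" by (rule open_good[OF X(1-3)])
  have E: "vreg X scale ?N E" and F: "vreg X scale ?N F"
    by (rule X.vreg_restrict[OF X(3) N], blast) (rule X.vreg_restrict[OF X(4) N], blast)
  note e = X(1) N E
  have "reg X ?N (\<lambda>x. lam (E x) * B (\<omega> (E x)) (A (E x) (chord (F x) (E x))))"
    by (intro X.reg_mult reg_lam[OF e] reg_B[OF X(1) N] vreg_omega[OF e] vreg_zeta[OF e F]) simp_all
  from openin_Int[OF X.open_nonzero[OF N this] open_good[OF X(1) N vreg_param[OF e F]]]
  have "openin (ztop X) ({x \<in> ?N. lam (E x) * B (\<omega> (E x)) (A (E x) (chord (F x) (E x))) \<noteq> 0} \<inter>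
      {x \<in> ?N. good (param (F x) (E x))})" by simp
  moreover have "{x \<in> ?N. lam (E x) * B (\<omega> (E x)) (A (E x) (chord (F x) (E x))) \<noteq> 0} \<inter>
      {x \<in> ?N. good (param (F x) (E x))} = {x \<in> N. param_ok (F x) (E x)}"
    by (auto simp: param_ok_def)
  ultimately show ?thesis by simp
qed

lemma vreg_unparam:
  assumes X: "fspace_ring X" "openin (ztop X) N" "vreg X scale N E" "vreg X scale N F"
    and ok: "\<And>x. x \<in> N \<Longrightarrow> unparam_ok (F x) (E x)"
  shows "vreg X scale N (\<lambda>x. unparam (F x) (E x))"
proof -
  interpret X: fspace_ring X by (rule X(1))
  have gd: "good (E x)" "B w0 (Ai (E x) (F x)) \<noteq> 0" if "x \<in> N" for x
    using ok[OF that] by (simp_all add: unparam_ok_def)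
  note y = vreg_Ai[OF X gd(1)]
  show ?thesis unfolding unparam_def
    by (intro X.vreg_scale X.reg_divide reg_lam[OF X(1-3) gd(1)] vregD[OF y linear_B] vreg_linear[OF y linear_prC] gd(2))
qed

lemma open_unparam_ok:
  assumes X: "fspace_ring X" "openin (ztop X) N" "vreg X scale N F" "vreg X scale N K"
  shows "openin (ztop X) {x \<in> N. unparam_ok (F x) (A (F x) (K x))}"
proof -
  interpret X: fspace_ring X by (rule X(1))
  let ?N = "{x \<in> N. good (F x)}"
  have N: "openin (ztop X) ?N" by (rule open_good[OF X(1-3)])
  have F: "vreg X scale ?N F" and K: "vreg X scale ?N K"
    by (rule X.vreg_restrict[OF X(3) N], blast) (rule X.vreg_restrict[OF X(4) N], blast)
  let ?E = "\<lambda>x. A (F x) (K x)"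
  have E: "vreg X scale ?N ?E" by (rule vreg_A[OF X(1) N F K]) simp
  let ?M = "{x \<in> ?N. good (?E x)}"
  have M: "openin (ztop X) ?M" by (rule open_good[OF X(1) N E])
  have E': "vreg X scale ?M ?E" and F': "vreg X scale ?M F"
    by (rule X.vreg_restrict[OF E M], blast) (rule X.vreg_restrict[OF F M], blast)
  note e = X(1) M E'
  have "reg X ?M (\<lambda>x. lam (?E x) * (B (\<omega> (?E x)) (F x) * B w0 (Ai (?E x) (F x))))"
    by (intro X.reg_mult reg_lam[OF e] reg_B[OF X(1) M] vreg_omega[OF e] vreg_Ai[OF e F'] X.vreg_const[OF M] F')
      simp_all
  from X.open_nonzero[OF M this]
  show ?thesis by (rule back_subst[of "openin (ztop X)"]) (auto simp: unparam_ok_def)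
qed

end

text \<open>A point of a product of two projective subvarieties is represented by a pair of vectors.\<close>

locale two_subvarieties = X: subvariety s1 Z1 + Y: subvariety s2 Z2
  for s1 :: "'k::field \<Rightarrow> 'v::ab_group_add \<Rightarrow> 'v" and Z1 and s2 :: "'k \<Rightarrow> 'w::ab_group_add \<Rightarrow> 'w" and Z2
begin

sublocale XY: fspace_product X.PZ Y.PZ
  by unfold_locales

definition rep2 :: "'v set \<times> 'w set \<Rightarrow> 'v \<times> 'w \<Rightarrow> bool"
  where "rep2 p r \<longleftrightarrow> X.rep_of (fst p) (fst r) \<and> Y.rep_of (snd p) (snd r)"

definition vreg2 :: "('v set \<times> 'w set) set \<Rightarrow> ('v set \<times> 'w set \<Rightarrow> 'v \<times> 'w) \<Rightarrow> bool"
  where "vreg2 N \<sigma> \<longleftrightarrow> vreg XY.XY s1 N (\<lambda>p. fst (\<sigma> p)) \<and> vreg XY.XY s2 N (\<lambda>p. snd (\<sigma> p))"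

sublocale P2: represented_space XY.XY rep2 vreg2
proof
  show "p \<in> points XY.XY" if "rep2 p r" for p r
    using that X.points_PZ Y.points_PZ by (cases p) (simp add: rep2_def X.rep_of_def Y.rep_of_def XY.points_XY)
  show "\<exists>N \<sigma>. openin (ztop XY.XY) N \<and> p \<in> N \<and> vreg2 N \<sigma> \<and> (\<forall>z\<in>N. rep2 z (\<sigma> z))"
    if p: "p \<in> points XY.XY" for p
  proof -
    have "fst p \<in> points X.PZ" "snd p \<in> points Y.PZ" using p by (auto simp: XY.points_XY)
    then obtain N1 \<sigma>1 N2 \<sigma>2 where
      1: "openin (ztop X.PZ) N1" "fst p \<in> N1" "vreg X.PZ s1 N1 \<sigma>1" "\<forall>z\<in>N1. X.rep_of z (\<sigma>1 z)" and
      2: "openin (ztop Y.PZ) N2" "snd p \<in> N2" "vreg Y.PZ s2 N2 \<sigma>2" "\<forall>z\<in>N2. Y.rep_of z (\<sigma>2 z)"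
      using X.PZ.local_section Y.PZ.local_section by metis
    have sub: "N1 \<subseteq> points X.PZ" "N2 \<subseteq> points Y.PZ" using openin_subset 1(1) 2(1) by blast+
    have N: "openin (ztop XY.XY) (N1 \<times> N2)" by (rule XY.open_Times[OF 1(1) 2(1)])
    have "vreg XY.XY s1 (N1 \<times> N2) (\<lambda>p. \<sigma>1 (fst p))"
      by (rule XY.XY.vreg_restrict[OF regular_map_vreg[OF XY.regular_map_fst 1(1) sub(1) 1(3)] N])
        (use sub in \<open>auto simp: XY.points_XY\<close>)
    moreover have "vreg XY.XY s2 (N1 \<times> N2) (\<lambda>p. \<sigma>2 (snd p))"
      by (rule XY.XY.vreg_restrict[OF regular_map_vreg[OF XY.regular_map_snd 2(1) sub(2) 2(3)] N])
        (use sub in \<open>auto simp: XY.points_XY\<close>)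
    ultimately have "vreg2 (N1 \<times> N2) (\<lambda>p. (\<sigma>1 (fst p), \<sigma>2 (snd p)))" by (simp add: vreg2_def)
    moreover have "p \<in> N1 \<times> N2" using 1(2) 2(2) by (cases p) simp
    moreover have "\<forall>z\<in>N1 \<times> N2. rep2 z (\<sigma>1 (fst z), \<sigma>2 (snd z))" using 1(4) 2(4) by (auto simp: rep2_def)
    ultimately show ?thesis using N by (intro exI[of _ "N1 \<times> N2"] exI[of _ "\<lambda>p. (\<sigma>1 (fst p), \<sigma>2 (snd p))"]) simp
  qed
  show "vreg2 N' \<sigma>" if "vreg2 N \<sigma>" "openin (ztop XY.XY) N'" "N' \<subseteq> N" for N N' \<sigma>
  proof -
    have "vreg XY.XY s1 N (\<lambda>p. fst (\<sigma> p))" "vreg XY.XY s2 N (\<lambda>p. snd (\<sigma> p))"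
      using that(1) by (simp_all add: vreg2_def)
    from this[THEN XY.XY.vreg_restrict, OF that(2,3)] show ?thesis unfolding vreg2_def by (rule conjI)
  qed
qed

end

context quadric_projection
begin

text \<open>The birational map sends the line of \<open>(c, v)\<close> in \<open>C \<oplus> V\<close> to the pair of \<open>x = param c v\<close> and the line of
\<open>A\<^sub>x\<inverse> v\<close>; its inverse sends \<open>(x, y)\<close> to \<open>(unparam x v, v)\<close> with \<open>v = A\<^sub>x y\<close>. The vector \<open>A\<^sub>x\<inverse> v\<close> does not change
when a group element acts on \<open>x\<close> and \<open>v\<close> simultaneously, so the action on the second factor is trivial. Here \<open>\<kappa>\<close> and
\<open>\<pi>\<close> are coordinates of \<open>V\<close>, which identify \<open>P(V)\<close> with the standard projective space.\<close>

theorem stably_linearizable_quadric: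
  assumes irr: "irreducible_top (ztop (quadric scale q))"
  shows "stably_linearizable G (proj_action \<rho>) (quadric scale q)"
proof -
  obtain n and \<kappa> :: "(nat \<Rightarrow> 'k) \<Rightarrow> 'v" and \<pi>
  where \<kappa>: "Vector_Spaces.linear coord_scale scale \<kappa>" and \<pi>: "Vector_Spaces.linear scale coord_scale \<pi>"
    and "\<forall>x. \<kappa> x \<in> UNIV" and \<pi>K: "\<forall>v. \<pi> v \<in> coord_space n"
    and \<pi>\<kappa>: "\<forall>x\<in>coord_space n. \<pi> (\<kappa> x) = x" and \<kappa>\<pi>: "\<forall>v\<in>UNIV. \<kappa> (\<pi> v) = v"
    using finite_Basis span_Basis[symmetric] by (rule subspace_coordinates)
  have "n \<noteq> 0"
  proof
    assume "n = 0"
    then have "\<pi> v0 = 0" using \<pi>K by (auto simp: coord_space_def fun_eq_iff)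
    then have "\<kappa> (\<pi> v0) = 0" using linear_zeroD[OF \<kappa>] by simp
    then show False using \<kappa>\<pi> v0_nonzero by simp
  qed
  then obtain m where m: "n = m + 1" by (cases n) auto
  let ?ks = "coord_scale :: 'k \<Rightarrow> _"
  note subK = subspace_coord_space[where 'k = 'k, of n]
  have \<pi>0: "\<pi> v \<noteq> 0" if "v \<noteq> 0" for v
  proof
    assume "\<pi> v = 0"
    then have "\<kappa> (\<pi> v) = 0" using linear_zeroD[OF \<kappa>] by simp
    then show False using \<kappa>\<pi> that by simp
  qed
  define scale2 where "scale2 a r = (scale a (fst r), scale a (snd r))" for a and r :: "'v \<times> 'v"
  have vs2: "vector_space scale2"
    by unfold_locales (auto simp: scale2_def scale_right_distrib scale_left_distrib)
  interpret V2: vector_space scale2 by (rule vs2)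
  have lin_fst: "Vector_Spaces.linear scale2 scale fst" and lin_snd: "Vector_Spaces.linear scale2 scale snd"
    and lin_L1: "Vector_Spaces.linear scale scale2 (\<lambda>v. (v, 0))"
    and lin_L2: "Vector_Spaces.linear scale scale2 (\<lambda>v. (0, v))"
    using vs2 vector_space_axioms by (simp_all add: Vector_Spaces.linear_iff scale2_def)
  define E :: "('v \<times> 'v) set" where "E = C \<times> UNIV"
  have subE: "V2.subspace E"
    by (rule V2.subspaceI)
      (use subspace_0[OF subspace_C] subspace_add[OF subspace_C] subspace_scale[OF subspace_C] in
        \<open>auto simp: E_def scale2_def zero_prod_def\<close>)
  obtain Bs where Bs: "Bs \<subseteq> C" "independent Bs" "C \<subseteq> span Bs" by (rule basis_exists[of C]) blast
  define S where "S = (\<lambda>v. (v, 0)) ` Bs \<union> (\<lambda>v. (0, v)) ` Basis"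
  have finS: "finite S" unfolding S_def using finiteI_independent[OF Bs(2)] finite_Basis by simp
  have E_span: "E = V2.span S"
  proof (rule equalityI)
    have "S \<subseteq> E" using Bs(1) subspace_0[OF subspace_C] by (auto simp: S_def E_def)
    then show "V2.span S \<subseteq> E" by (rule V2.span_minimal[OF _ subE])
    interpret L: vector_space_pair scale scale2 by unfold_locales
    have "(v, 0) \<in> V2.span S" if "v \<in> C" for v
    proof -
      have "(\<lambda>v. (v, 0)) ` span Bs = V2.span ((\<lambda>v. (v, 0)) ` Bs)"
        using L.linear_span_image[OF lin_L1] by simp
      also have "\<dots> \<subseteq> V2.span S" unfolding S_def by (rule V2.span_mono) blast
      finally show ?thesis using that Bs(3) by blast
    qed
    moreover have "(0, v) \<in> V2.span S" for v
    proof -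
      have "(\<lambda>v. (0, v)) ` span Basis = V2.span ((\<lambda>v. (0, v)) ` Basis)"
        using L.linear_span_image[OF lin_L2] by simp
      also have "\<dots> \<subseteq> V2.span S" unfolding S_def by (rule V2.span_mono) blast
      finally show ?thesis using span_Basis by blast
    qed
    ultimately have "(c, 0) + (0, v) \<in> V2.span S" if "c \<in> C" for c v
      using that by (intro V2.span_add) auto
    then show "E \<subseteq> V2.span S" by (auto simp: E_def)
  qed
  define \<tau> where "\<tau> g r = (fst r, \<rho> g (snd r))" for g and r :: "'v \<times> 'v"
  have rep\<tau>: "linear_representation G scale2 E \<tau>"
    unfolding linear_representation_def
    by (intro conjI ballI allI subE)
      (auto simp: \<tau>_def E_def scale2_def linear_addD[OF linear_rho] linear_scaleD[OF linear_rho] rho_one rho_mult)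
  interpret S: subvariety scale2 "proj_points scale2 E" by (rule subvariety_proj_space[OF vs2])
  interpret C: subvariety scale cone_lines by (rule subvariety_quadric)
  interpret K: subvariety ?ks "proj_points ?ks (coord_space n)"
    by (rule subvariety_proj_space[OF vector_space_coord_scale])
  interpret T: two_subvarieties scale cone_lines ?ks "proj_points ?ks (coord_space n)"
    by unfold_locales
  define D where "D r = param_ok (fst r) (snd r)" for r
  define \<Phi>1 where "\<Phi>1 r = param (fst r) (snd r)" for r
  define \<Phi>2 where "\<Phi>2 r = \<pi> (Ai (\<Phi>1 r) (snd r))" for r
  define base where "base p = A (fst p) (\<kappa> (snd p))" for p
  define D' where "D' p = unparam_ok (fst p) (base p)" for p
  define \<Psi> where "\<Psi> p = (unparam (fst p) (base p), base p)" for p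
  have good1: "good (snd r)" "good (\<Phi>1 r)" "snd r \<noteq> 0" if "D r" for r
    using that lam_nonzero by (auto simp: D_def \<Phi>1_def param_ok_def)
  have good2: "good (fst p)" "good (base p)" "base p \<noteq> 0" if "D' p" for p
    using that lam_nonzero by (auto simp: D'_def unparam_ok_def)
  have base\<Phi>: "base (\<Phi>1 r, \<Phi>2 r) = snd r" if "D r" for r
    using \<kappa>\<pi> A_Ai[OF good1(2)[OF that]] by (simp add: base_def \<Phi>2_def)
  have S_C: "fst r \<in> C" if "S.rep_of l r" for l r
  proof -
    have r: "r \<noteq> 0" "l \<in> proj_points scale2 E" using that by (simp_all add: S.rep_of_def)
    then have "r \<in> E" using V2.line_in_subspace_points[OF subE r(1)] S.rep_of_line[OF that] by simp
    then show ?thesis by (simp add: E_def mem_Times_iff)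
  qed
  have C_q: "q x = 0" if "C.rep_of l x" for l x using that by (auto simp: C.rep_of_def)
  have K_coord: "y \<in> coord_space n" if "K.rep_of l y" for l y
    using that K.line_in_subspace_points[OF subK, of y] K.rep_of_line[OF that] by (simp add: K.rep_of_def)
  have D\<Phi>: "D' (\<Phi>1 r, \<Phi>2 r)" if "D r" "fst r \<in> C" for r
    unfolding D'_def base\<Phi>[OF that(1)] using unparam_ok_param[of "fst r" "snd r"] that by (simp add: D_def \<Phi>1_def)
  have \<Psi>\<Phi>: "\<Psi> (\<Phi>1 r, \<Phi>2 r) = r" if "D r" "fst r \<in> C" for r
    unfolding \<Psi>_def base\<Phi>[OF that(1)] using unparam_param[of "fst r" "snd r"] that by (simp add: D_def \<Phi>1_def)
  have D\<Psi>: "D (\<Psi> p)" if "D' p" "q (fst p) = 0" for p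
    using param_unparam(2)[of "fst p" "base p"] that by (simp add: D_def D'_def \<Psi>_def)
  have \<Phi>\<Psi>: "\<exists>a. a \<noteq> 0 \<and> \<Phi>1 (\<Psi> p) = scale a (fst p)" "\<Phi>2 (\<Psi> p) = snd p"
    if "D' p" "q (fst p) = 0" "snd p \<in> coord_space n" for p
  proof -
    have "unparam_ok (fst p) (base p)" using that(1) by (simp add: D'_def)
    from param_unparam(1)[OF this that(2)] obtain a where a: "a \<noteq> 0" "\<Phi>1 (\<Psi> p) = scale a (fst p)"
      by (auto simp: \<Phi>1_def \<Psi>_def)
    then show "\<exists>a. a \<noteq> 0 \<and> \<Phi>1 (\<Psi> p) = scale a (fst p)" by blast
    have "Ai (fst p) (base p) = \<kappa> (snd p)" unfolding base_def by (rule Ai_A[OF good2(1)[OF that(1)]])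
    then show "\<Phi>2 (\<Psi> p) = snd p" unfolding \<Phi>2_def a(2) Ai_scale[OF a(1)] using \<pi>\<kappa> that(3) by (simp add: \<Psi>_def)
  qed
  have \<Phi>1_scale: "\<Phi>1 (scale2 a r) = scale (a\<^sup>2) (\<Phi>1 r)" and D_scale: "D (scale2 a r) \<longleftrightarrow> D r" if "a \<noteq> 0" for a r
    using param_scale[OF that] param_ok_scale[OF that] by (simp_all add: \<Phi>1_def D_def scale2_def)
  have \<Phi>2_scale: "\<Phi>2 (scale2 a r) = coord_scale a (\<Phi>2 r)" if "a \<noteq> 0" "D r" for a r
    using that Ai_scale[of "a\<^sup>2"] linear_scaleD[OF linear_Ai[OF good1(2)[OF that(2)]]]
    by (simp add: \<Phi>2_def \<Phi>1_scale) (simp add: scale2_def linear_scaleD[OF \<pi>])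
  have base_scale: "base (scale a x, coord_scale b y) = scale b (base (x, y))" if "a \<noteq> 0" for a b x y
    using that by (simp add: base_def A_scale linear_scaleD[OF \<kappa>] linear_scaleD[OF linear_frame])
  have D'_scale: "D' (scale a x, coord_scale b y) \<longleftrightarrow> D' (x, y)" if "a \<noteq> 0" "b \<noteq> 0" "D' (x, y)" for a b x y
    using unparam_scale(2)[OF that(1,2) good2(2)[OF that(3)]] by (simp add: D'_def base_scale[OF that(1)])
  have \<Psi>_scale: "\<Psi> (scale a x, coord_scale b y) = scale2 b (\<Psi> (x, y))" if "a \<noteq> 0" "b \<noteq> 0" "D' (x, y)" for a b x y
    using unparam_scale(1)[OF that(1,2) good2(2)[OF that(3)]] by (simp add: \<Psi>_def base_scale[OF that(1)] scale2_def)
  have equiv1: "\<Phi>1 (\<tau> g r) = \<rho> g (\<Phi>1 r)" and D_equiv: "D (\<tau> g r) \<longleftrightarrow> D r" if g: "g \<in> carrier G" for g r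
    using param_rho[OF g] param_ok_rho[OF g] by (simp_all add: \<Phi>1_def D_def \<tau>_def)
  have equiv2: "\<Phi>2 (\<tau> g r) = \<Phi>2 r" if g: "g \<in> carrier G" and D: "D r" for g r
    unfolding \<Phi>2_def equiv1[OF g] using Ai_rho[OF good1(2)[OF D] g] good_rho[OF g] good1(2)[OF D]
    by (simp add: \<tau>_def)

  have vreg_\<Phi>1: "vreg S.PZ scale N (\<lambda>z. \<Phi>1 (\<sigma> z))"
    and vreg_\<Phi>2: "vreg S.PZ coord_scale N (\<lambda>z. \<Phi>2 (\<sigma> z))"
    if N: "openin (ztop S.PZ) N" "vreg S.PZ scale2 N \<sigma>" "\<forall>z\<in>N. S.rep_of z (\<sigma> z)" "\<forall>z\<in>N. D (\<sigma> z)" for N \<sigma>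
  proof -
    note F = vreg_linear[OF N(2) lin_fst] and E = vreg_linear[OF N(2) lin_snd]
    have gd: "good (snd (\<sigma> z))" "good (\<Phi>1 (\<sigma> z))" if "z \<in> N" for z using good1 N(4) that by blast+
    show v1: "vreg S.PZ scale N (\<lambda>z. \<Phi>1 (\<sigma> z))"
      unfolding \<Phi>1_def by (rule vreg_param[OF S.PZ.fspace_ring_axioms N(1) E F gd(1)])
    show "vreg S.PZ coord_scale N (\<lambda>z. \<Phi>2 (\<sigma> z))"
      unfolding \<Phi>2_def by (rule vreg_linear[OF vreg_Ai[OF S.PZ.fspace_ring_axioms N(1) v1 E gd(2)] \<pi>])
  qed
  have op_S: "openin (ztop S.PZ) {z \<in> N. D (\<sigma> z)}"
    if N: "openin (ztop S.PZ) N" "vreg S.PZ scale2 N \<sigma>" "\<forall>z\<in>N. S.rep_of z (\<sigma> z)" for N \<sigma>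
    unfolding D_def
    by (rule open_param_ok[OF S.PZ.fspace_ring_axioms N(1) vreg_linear[OF N(2) lin_snd] vreg_linear[OF N(2) lin_fst]])
  have op_T: "openin (ztop T.XY.XY) {z \<in> N. D' (\<sigma> z)}"
    if N: "openin (ztop T.XY.XY) N" "T.vreg2 N \<sigma>" "\<forall>z\<in>N. T.rep2 z (\<sigma> z)" for N \<sigma>
    unfolding D'_def base_def
    by (rule open_unparam_ok[OF T.XY.XY.fspace_ring_axioms N(1)])
      (use N(2) vreg_linear[OF _ \<kappa>] in \<open>auto simp: T.vreg2_def\<close>)
  have vreg_\<Psi>: "vreg T.XY.XY scale2 N (\<lambda>z. \<Psi> (\<sigma> z))"
    if N: "openin (ztop T.XY.XY) N" "T.vreg2 N \<sigma>" "\<forall>z\<in>N. T.rep2 z (\<sigma> z)" "\<forall>z\<in>N. D' (\<sigma> z)" for N \<sigma>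
  proof -
    have F: "vreg T.XY.XY scale N (\<lambda>z. fst (\<sigma> z))" and K: "vreg T.XY.XY coord_scale N (\<lambda>z. snd (\<sigma> z))"
      using N(2) by (simp_all add: T.vreg2_def)
    have gd: "good (fst (\<sigma> z))" "unparam_ok (fst (\<sigma> z)) (base (\<sigma> z))" if "z \<in> N" for z
      using good2(1) N(4) that by (auto simp: D'_def)
    have b: "vreg T.XY.XY scale N (\<lambda>z. base (\<sigma> z))"
      unfolding base_def by (rule vreg_A[OF T.XY.XY.fspace_ring_axioms N(1) F vreg_linear[OF K \<kappa>] gd(1)])
    have u: "vreg T.XY.XY scale N (\<lambda>z. unparam (fst (\<sigma> z)) (base (\<sigma> z)))"
      by (rule vreg_unparam[OF T.XY.XY.fspace_ring_axioms N(1) b F gd(2)])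
    have "vreg T.XY.XY scale2 N (\<lambda>z. (unparam (fst (\<sigma> z)) (base (\<sigma> z)), 0) + (0, base (\<sigma> z)))"
      by (rule T.XY.XY.vreg_add[OF vreg_linear[OF u lin_L1] vreg_linear[OF b lin_L2]])
    then show ?thesis by (simp add: \<Psi>_def)
  qed
  have D_inv: "D r'" if "S.rep_of x r" "S.rep_of x r'" "D r" for x r r'
    using S.rep_of_multiple[OF that(1,2)] D_scale that(3) by metis
  have mult2: "\<exists>a b. a \<noteq> 0 \<and> b \<noteq> 0 \<and> r' = (scale a (fst r), coord_scale b (snd r))"
    if "T.rep2 p r" "T.rep2 p r'" for p r r'
  proof -
    have R: "C.rep_of (fst p) (fst r)" "C.rep_of (fst p) (fst r')"
      "K.rep_of (snd p) (snd r)" "K.rep_of (snd p) (snd r')" using that by (simp_all add: T.rep2_def)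
    from R(1,2) obtain a where "a \<noteq> 0" "fst r' = scale a (fst r)" by (rule C.rep_of_multiple)
    moreover from R(3,4) obtain b where "b \<noteq> 0" "snd r' = coord_scale b (snd r)" by (rule K.rep_of_multiple)
    ultimately show ?thesis by (intro exI[of _ a] exI[of _ b]) (simp add: prod_eq_iff)
  qed
  have D'_inv: "D' r'" if "T.rep2 x r" "T.rep2 x r'" "D' r" for x r r'
    using mult2[OF that(1,2)] D'_scale[of _ _ "fst r" "snd r"] that(3) by auto
  have line1: "line scale (\<Phi>1 r) = line scale (\<Phi>1 r')"
    if "S.rep_of x r" "S.rep_of x r'" "D r" "D r'" for x r r'
  proof -
    from that(1,2) obtain a where "a \<noteq> 0" "r' = scale2 a r" by (rule S.rep_of_multiple)
    then show ?thesis using \<Phi>1_scale[of a r] line_scale[of "a\<^sup>2" "\<Phi>1 r"] by simp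
  qed
  have line2: "line ?ks (\<Phi>2 r) = line ?ks (\<Phi>2 r')"
    if "S.rep_of x r" "S.rep_of x r'" "D r" "D r'" for x r r'
  proof -
    from that(1,2) obtain a where "a \<noteq> 0" "r' = scale2 a r" by (rule S.rep_of_multiple)
    then show ?thesis using \<Phi>2_scale[of a r] that(3) K.line_scale[of a "\<Phi>2 r"] by simp
  qed
  have line_\<Psi>: "line scale2 (\<Psi> r) = line scale2 (\<Psi> r')"
    if "T.rep2 x r" "T.rep2 x r'" "D' r" "D' r'" for x r r'
  proof -
    from mult2[OF that(1,2)] obtain a b
      where "a \<noteq> 0" "b \<noteq> 0" "r' = (scale a (fst r), coord_scale b (snd r))" by blast
    then show ?thesis using \<Psi>_scale[of a b "fst r" "snd r"] that(3) V2.line_scale[of b "\<Psi> r"] by simp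
  qed
  have rep1: "C.rep_of (line scale (\<Phi>1 r)) (\<Phi>1 r)" if "D r" for r
    using param_nonzero[of "fst r" "snd r"] q_param[of "fst r" "snd r"] line_in_cone_lines that
    by (intro C.rep_of_lineI) (simp_all add: D_def \<Phi>1_def)
  have rep2: "K.rep_of (line ?ks (\<Phi>2 r)) (\<Phi>2 r)" if D: "D r" for r
  proof (rule K.rep_of_lineI)
    have "Ai (\<Phi>1 r) (snd r) \<noteq> 0"
    proof
      assume "Ai (\<Phi>1 r) (snd r) = 0"
      then have "snd r = A (\<Phi>1 r) 0" using A_Ai[OF good1(2)[OF D], of "snd r"] by simp
      then show False using good1(3)[OF D] linear_zeroD[OF linear_frame] by simp
    qed
    then show nz: "\<Phi>2 r \<noteq> 0" unfolding \<Phi>2_def by (rule \<pi>0)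
    then show "line ?ks (\<Phi>2 r) \<in> proj_points ?ks (coord_space n)"
      using \<pi>K by (intro line_in_proj_points) (simp_all add: \<Phi>2_def)
  qed
  have rep_\<Psi>: "S.rep_of (line scale2 (\<Psi> p)) (\<Psi> p)" if "D' p" for p
  proof (rule S.rep_of_lineI)
    show nz: "\<Psi> p \<noteq> 0" using good2(3)[OF that] by (auto simp: \<Psi>_def zero_prod_def)
    show "line scale2 (\<Psi> p) \<in> proj_points scale2 E"
      using nz unparam_in_C by (intro line_in_proj_points) (simp_all add: \<Psi>_def E_def)
  qed
  have img1: "\<Phi>1 r \<noteq> 0 \<and> line scale (\<Phi>1 r) \<in> cone_lines" if "S.rep_of x r" "D r" for x r
    using rep1[OF that(2)] unfolding C.rep_of_def by (elim conjE) (intro conjI)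
  have img2: "\<Phi>2 r \<noteq> 0 \<and> line ?ks (\<Phi>2 r) \<in> proj_points ?ks (coord_space n)" if "S.rep_of x r" "D r" for x r
    using rep2[OF that(2)] unfolding K.rep_of_def by (elim conjE) (intro conjI)
  have img_\<Psi>: "\<Psi> r \<noteq> 0 \<and> line scale2 (\<Psi> r) \<in> proj_points scale2 E" if "T.rep2 x r" "D' r" for x r
    using rep_\<Psi>[OF that(2)] unfolding S.rep_of_def by (elim conjE) (intro conjI)
  define \<phi>1 where "\<phi>1 l = line scale (\<Phi>1 (S.PZ.pick l))" for l
  define \<phi>2 where "\<phi>2 l = line ?ks (\<Phi>2 (S.PZ.pick l))" for l
  define \<psi> where "\<psi> p = line scale2 (\<Psi> (T.P2.pick p))" for p
  have \<phi>1: "regular_map S.PZ (S.PZ.dom D) C.PZ cone_lines \<phi>1" unfolding \<phi>1_def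
    by (rule S.PZ.regular_map_on_dom(1)[OF D_inv op_S C.subvariety_axioms vreg_\<Phi>1 line1 img1])
  have \<phi>1_val: "\<phi>1 l = line scale (\<Phi>1 r)" if "S.rep_of l r" "D r" for l r unfolding \<phi>1_def
    by (rule S.PZ.regular_map_on_dom(2)[where D = D, OF D_inv op_S C.subvariety_axioms vreg_\<Phi>1 line1 img1 that])
  have \<phi>2: "regular_map S.PZ (S.PZ.dom D) K.PZ (proj_points ?ks (coord_space n)) \<phi>2" unfolding \<phi>2_def
    by (rule S.PZ.regular_map_on_dom(1)[OF D_inv op_S K.subvariety_axioms vreg_\<Phi>2 line2 img2])
  have \<phi>2_val: "\<phi>2 l = line ?ks (\<Phi>2 r)" if "S.rep_of l r" "D r" for l r unfolding \<phi>2_def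
    by (rule S.PZ.regular_map_on_dom(2)[where D = D, OF D_inv op_S K.subvariety_axioms vreg_\<Phi>2 line2 img2 that])
  have \<psi>: "regular_map T.XY.XY (T.P2.dom D') S.PZ (proj_points scale2 E) \<psi>" unfolding \<psi>_def
    by (rule T.P2.regular_map_on_dom(1)[OF D'_inv op_T S.subvariety_axioms vreg_\<Psi> line_\<Psi> img_\<Psi>])
  have \<psi>_val: "\<psi> p = line scale2 (\<Psi> r)" if "T.rep2 p r" "D' r" for p r unfolding \<psi>_def
    by (rule T.P2.regular_map_on_dom(2)[where D = D', OF D'_inv op_T S.subvariety_axioms vreg_\<Psi> line_\<Psi> img_\<Psi> that])
  define \<phi> where "\<phi> l = (\<phi>1 l, \<phi>2 l)" for l
  have oS: "openin (ztop S.PZ) (S.PZ.dom D)" by (rule S.PZ.open_dom[OF D_inv op_S])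
  have oT: "openin (ztop T.XY.XY) (T.P2.dom D')" by (rule T.P2.open_dom[OF D'_inv op_T])
  have \<phi>: "regular_map S.PZ (S.PZ.dom D) T.XY.XY (points T.XY.XY) \<phi>"
    unfolding \<phi>_def
    by (rule T.XY.regular_map_pair[OF S.PZ.fspace_ring_axioms oS])
      (use \<phi>1 \<phi>2 in \<open>simp_all only: C.points_PZ K.points_PZ\<close>)
  have \<phi>_rep: "T.rep2 (\<phi> l) (\<Phi>1 r, \<Phi>2 r)" if "S.rep_of l r" "D r" for l r
    using rep1[OF that(2)] rep2[OF that(2)] by (simp add: T.rep2_def \<phi>_def \<phi>1_val[OF that] \<phi>2_val[OF that])
  have irr_K: "irreducible_top (ztop K.PZ)" by (rule irreducible_proj_space[OF vector_space_coord_scale subK])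
  have irr_T: "irreducible_top (ztop T.XY.XY)"
    by (rule T.XY.irreducible_product[OF irr[unfolded quadric_eq] irr_K])
  \<comment> \<open>All frames are the identity at \<open>v0\<close>, so the pair \<open>(v0, v0)\<close> lies in the domain.\<close>
  define p0 where "p0 = (v0, \<pi> v0)"
  have D'p0: "D' p0"
    using unparam_ok_v0 \<kappa>\<pi> by (simp add: D'_def p0_def base_def frame_v0)
  have "T.rep2 (line scale v0, line ?ks (\<pi> v0)) p0"
    unfolding T.rep2_def p0_def using v0_nonzero line_in_cone_lines[OF v0_nonzero] q_v0 \<pi>0[OF v0_nonzero] \<pi>K
    by (simp add: C.rep_of_lineI K.rep_of_lineI line_in_proj_points)
  then have "(line scale v0, line ?ks (\<pi> v0)) \<in> T.P2.dom D'" using D'p0 unfolding T.P2.dom_def by blast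
  then have dT: "dense_open T.XY.XY (T.P2.dom D')" by (intro dense_open_irreducible[OF irr_T oT]) blast
  have "q (fst p0) = 0" by (simp add: p0_def q_v0)
  then have "line scale2 (\<Psi> p0) \<in> S.PZ.dom D"
    using rep_\<Psi>[OF D'p0] D\<Psi>[OF D'p0] unfolding S.PZ.dom_def by blast
  then have dS: "dense_open S.PZ (S.PZ.dom D)"
    by (intro dense_open_irreducible[OF irreducible_proj_space[OF vs2 subE] oS]) blast
  let ?act = "\<lambda>g (x, y). (proj_action \<rho> g x, y)"
  have bir: "equivariantly_birational G (proj_action \<tau>) (proj_space scale2 E) ?act T.XY.XY"
    unfolding equivariantly_birational_def
  proof (rule exI[of _ "S.PZ.dom D"], rule exI[of _ "T.P2.dom D'"], rule exI[of _ \<phi>], rule exI[of _ \<psi>],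
      intro conjI dS dT ballI impI)
    have img\<phi>: "\<phi> l \<in> T.P2.dom D'" if "l \<in> S.PZ.dom D" for l
      using that
    proof (rule S.PZ.domE)
      fix r assume r: "S.rep_of l r" "D r"
      show ?thesis unfolding T.P2.dom_def using \<phi>_rep[OF r] D\<Phi>[OF r(2) S_C[OF r(1)]] by blast
    qed
    have img\<psi>: "\<psi> p \<in> S.PZ.dom D" if "p \<in> T.P2.dom D'" for p
      using that
    proof (rule T.P2.domE)
      fix r assume r: "T.rep2 p r" "D' r"
      have "q (fst r) = 0" using r(1) C_q unfolding T.rep2_def by blast
      then show ?thesis unfolding \<psi>_val[OF r] S.PZ.dom_def using rep_\<Psi>[OF r(2)] D\<Psi>[OF r(2)] by blast
    qed
    show "regular_map S.PZ (S.PZ.dom D) T.XY.XY (T.P2.dom D') \<phi>"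
      by (rule regular_map_codomain[OF \<phi> openin_subset[OF oT]]) (use img\<phi> in blast)
    show "regular_map T.XY.XY (T.P2.dom D') S.PZ (S.PZ.dom D) \<psi>"
      by (rule regular_map_codomain[OF \<psi>]) (use img\<psi> openin_subset[OF oS] S.points_PZ in auto)
    show "\<psi> (\<phi> l) = l" if "l \<in> S.PZ.dom D" for l
      using that
    proof (rule S.PZ.domE)
      fix r assume r: "S.rep_of l r" "D r"
      have "\<psi> (\<phi> l) = line scale2 (\<Psi> (\<Phi>1 r, \<Phi>2 r))"
        by (rule \<psi>_val[OF \<phi>_rep[OF r] D\<Phi>[OF r(2) S_C[OF r(1)]]])
      also have "\<dots> = l" using \<Psi>\<Phi>[OF r(2) S_C[OF r(1)]] S.rep_of_line[OF r(1)] by simp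
      finally show ?thesis .
    qed
    show "\<phi> (\<psi> p) = p" if "p \<in> T.P2.dom D'" for p
      using that
    proof (rule T.P2.domE)
      fix r assume r: "T.rep2 p r" "D' r"
      have qr: "q (fst r) = 0" and yr: "snd r \<in> coord_space n"
        using r(1) C_q K_coord unfolding T.rep2_def by blast+
      obtain a where a: "a \<noteq> 0" "\<Phi>1 (\<Psi> r) = scale a (fst r)" using \<Phi>\<Psi>(1)[OF r(2) qr yr] by blast
      note R = rep_\<Psi>[OF r(2)] D\<Psi>[OF r(2) qr]
      have "\<phi> (\<psi> p) = (line scale (\<Phi>1 (\<Psi> r)), line ?ks (\<Phi>2 (\<Psi> r)))"
        unfolding \<psi>_val[OF r] \<phi>_def by (simp only: \<phi>1_val[OF R] \<phi>2_val[OF R])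
      also have "\<dots> = (line scale (fst r), line ?ks (snd r))"
        unfolding a(2) line_scale[OF a(1)] \<Phi>\<Psi>(2)[OF r(2) qr yr] by (rule refl)
      also have "\<dots> = p" using C.rep_of_line[of "fst p" "fst r"] K.rep_of_line[of "snd p" "snd r"] r(1)
        by (simp add: T.rep2_def prod_eq_iff)
      finally show ?thesis .
    qed
    show "\<phi> (proj_action \<tau> g l) = ?act g (\<phi> l)"
      if g: "g \<in> carrier G" and l: "l \<in> S.PZ.dom D" "proj_action \<tau> g l \<in> S.PZ.dom D" for g l
      using l(1)
    proof (rule S.PZ.domE)
      fix r assume r: "S.rep_of l r" "D r"
      have D\<tau>: "D (\<tau> g r)" using r(2) D_equiv[OF g] by simp
      have "\<tau> g r \<in> proj_action \<tau> g l" using r(1) by (simp add: proj_action_def S.rep_of_def)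
      moreover have "proj_action \<tau> g l \<in> proj_points scale2 E" using openin_subset[OF oS] l(2) S.points_PZ by auto
      moreover have "\<tau> g r \<noteq> 0" using good1(3)[OF D\<tau>] by auto
      ultimately have R: "S.rep_of (proj_action \<tau> g l) (\<tau> g r)" by (simp add: S.rep_of_def)
      show ?thesis
        by (simp add: \<phi>_def \<phi>1_val[OF R D\<tau>] \<phi>2_val[OF R D\<tau>] \<phi>1_val[OF r] \<phi>2_val[OF r]
            equiv1[OF g] equiv2[OF g r(2)] proj_action_line[OF g])
    qed
  qed
  have act: "regular_action G ?act T.XY.XY"
    unfolding regular_action_def
  proof (intro conjI ballI)
    fix g assume g: "g \<in> carrier G"
    have "regular_map C.PZ (points C.PZ) C.PZ (points C.PZ) (proj_action \<rho> g)"
      by (rule bspec[OF regular_action_quadric[unfolded regular_action_def quadric_eq, THEN conjunct1] g])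
    from T.XY.regular_map_pair[OF T.XY.XY.fspace_ring_axioms openin_topspace
        regular_map_compose[OF T.XY.regular_map_fst this] T.XY.regular_map_snd]
    show "regular_map T.XY.XY (points T.XY.XY) T.XY.XY (points T.XY.XY) (?act g)"
      by (simp add: case_prod_beta')
  next
    fix p assume "p \<in> points T.XY.XY"
    show "?act \<one> p = p" by (cases p) (simp add: proj_action_def rho_one)
  next
    fix g h p assume "g \<in> carrier G" "h \<in> carrier G"
    then show "?act (g \<otimes> h) p = ?act g (?act h p)"
      by (cases p) (simp add: proj_action_def rho_mult image_image)
  qed
  have free: "generically_free G ?act T.XY.XY"
    unfolding generically_free_def
  proof (intro exI[of _ "T.P2.dom D'"] conjI dT ballI impI)
    fix p g assume p: "p \<in> T.P2.dom D'" and g: "g \<in> carrier G" and fix_p: "?act g p = p"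
    from p obtain r where r: "T.rep2 p r" "D' r" by (rule T.P2.domE)
    have rC: "C.rep_of (fst p) (fst r)" using r(1) by (simp add: T.rep2_def)
    then have nz: "fst r \<noteq> 0" by (simp add: C.rep_of_def)
    have "proj_action \<rho> g (line scale (fst r)) = line scale (fst r)"
      using fix_p C.rep_of_line[OF rC] by (cases p) simp
    then show "g = \<one>"
      using good_free[OF good2(1)[OF r(2)] nz] free_vec_iff[OF nz] g by blast
  qed
  have "\<Psi> p0 \<in> E" using unparam_in_C by (simp add: \<Psi>_def E_def)
  moreover have "\<Psi> p0 \<noteq> 0" using img_\<Psi> rep_\<Psi>[OF D'p0] by (simp add: S.rep_of_def)
  ultimately have "linearizable G ?act T.XY.XY"
    using linear_model[OF group_axioms vs2 finS E_span _ _ rep\<tau> bir] act free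
    unfolding linearizable_def by blast
  then show ?thesis unfolding stably_linearizable_def quadric_eq m by (rule exI[of _ m])
qed

end

section \<open>The theorem\<close>

text \<open>Nonvanishing of \<open>\<alpha>\<close> and freeness are both open conditions, and the second one is dense.\<close>

lemma (in finite_rep) exists_free_vector:
  assumes Z: "subvariety scale Z" and free: "generically_free G (proj_action \<rho>) (proj_subvariety scale Z)"
    and \<alpha>: "Vector_Spaces.linear scale (*) \<alpha>" and v: "v \<noteq> 0" "line scale v \<in> Z" "\<alpha> v \<noteq> 0"
  obtains v0 where "v0 \<noteq> 0" "line scale v0 \<in> Z" "\<alpha> v0 \<noteq> 0" "free_vec v0"
proof -
  interpret subvariety scale Z by fact
  obtain U where U: "dense_open PZ U" "\<forall>x\<in>U. \<forall>g\<in>carrier G. proj_action \<rho> g x = x \<longrightarrow> g = \<one>"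
    using free unfolding generically_free_def by (elim exE conjE)
  let ?O = "{l \<in> Z. \<exists>v\<in>l. \<alpha> v \<noteq> 0}"
  have "openin (ztop PZ) ?O" by (rule open_nonvanishing[OF homogeneous_poly.linear[OF \<alpha>]])
  moreover have "line scale v \<in> ?O" using v line_self by blast
  ultimately have "U \<inter> ?O \<noteq> {}" using dense_open_meets[OF U(1)] by blast
  then obtain l v0 where l: "l \<in> U" "l \<in> Z" "v0 \<in> l" "\<alpha> v0 \<noteq> 0" by blast
  have v0: "v0 \<noteq> 0" using l(4) linear_zeroD[OF \<alpha>] by auto
  have "l \<in> proj_points scale UNIV" using l(2) Z_points by blast
  then have lv: "l = line scale v0" using l(3) v0 by (rule proj_pointD)
  have "free_vec v0" unfolding free_vec_iff[OF v0] using U(2) l(1) lv by blast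
  then show ?thesis using l(2,4) lv v0 by (intro that[of v0]) simp_all
qed

theorem theorem3p5:
  fixes G :: "('g, 'm) monoid_scheme"
    and scale :: "'k::{alg_closed_field, field_char_0} \<Rightarrow> 'v::ab_group_add \<Rightarrow> 'v"
    and Basis :: "'v set"
    and \<rho> :: "'g \<Rightarrow> 'v \<Rightarrow> 'v"
    and q :: "'v \<Rightarrow> 'k"
    and W :: "'v set"
  assumes "group G" and "finite (carrier G)"
    and "finite_dimensional_vector_space scale Basis"
    and "linear_representation G scale UNIV \<rho>"
    and "quadratic_form scale q" and "nondegenerate q" and "invariant_form G \<rho> q"
    and "krull_dim (ztop (quadric scale q)) > 0"
    and "isotropic_subspace G scale \<rho> q W" and "W \<noteq> {0}"
  shows "(\<exists>W'. hyperbolic_pair G scale \<rho> q W W') \<and>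
    (\<forall>W'. hyperbolic_pair G scale \<rho> q W W' \<longrightarrow>
      generically_free G (proj_action \<rho>)
        (proj_space scale
          (sum_subspace W' (orthogonal_complement q (sum_subspace W W')))) \<longrightarrow>
      linearizable G (proj_action \<rho>) (quadric scale q)) \<and>
    (generically_free G (proj_action \<rho>) (quadric scale q) \<longrightarrow>
      stably_linearizable G (proj_action \<rho>) (quadric scale q))"
proof -
  interpret quadratic_rep G scale Basis \<rho> q
    using assms(1-7)
    by (intro quadratic_rep.intro finite_rep.intro finite_rep_axioms.intro quadratic_space.intro
        quadratic_space_axioms.intro quadratic_rep_axioms.intro)
  note iso = assms(9)
  obtain w0 where w0: "w0 \<in> W" "w0 \<noteq> 0"
    using assms(10) subspace_0[OF isotropicD(1)[OF iso]] by blast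
  have irr: "irreducible_top (ztop (quadric scale q))"
    by (rule irreducible_quadric[OF tangent_of_positive_dimension[OF assms(8)]])
  have q_w0: "q w0 = 0" and B_w0: "B w0 w0 = 0"
    using isotropicD(3)[OF iso w0(1) w0(1)] by (simp_all add: q_polar)
  \<comment> \<open>The base point of a frame must not be orthogonal to \<open>w0\<close>: \<open>z\<close> leads to vectors in \<open>U\<close> and in the quadric with this property.\<close>
  obtain z where z: "B w0 z \<noteq> 0" using w0(2) by (rule B_nonzero)
  have "linearizable G (proj_action \<rho>) (quadric scale q)"
    if hyp: "hyperbolic_pair G scale \<rho> q W W'"
      and free: "generically_free G (proj_action \<rho>)
        (proj_space scale (sum_subspace W' (orthogonal_complement q (sum_subspace W W'))))" for W'
  proof -
    let ?U = "sum_subspace W' (orthogonal_complement q (sum_subspace W W'))"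
    have subU: "subspace ?U"
      unfolding hyperbolic_complement(1)[OF hyp] by (rule subspace_orthogonal_complement)
    obtain w where w: "w \<in> W" "z - w \<in> ?U" using hyperbolic_complement(3)[OF hyp] by blast
    have Bu: "B w0 (z - w) \<noteq> 0" using z isotropicD(3)[OF iso w0(1) w(1)] by (simp add: B_simps)
    then have u: "z - w \<noteq> 0" by (auto simp: B_simps)
    obtain v0 where v0: "v0 \<noteq> 0" "line scale v0 \<in> proj_points scale ?U" "B w0 v0 \<noteq> 0" "free_vec v0"
      using subvariety_proj_space[OF vector_space_axioms] free linear_B u line_in_proj_points[OF w(2) u] Bu
      by (rule exists_free_vector)
    have v0U: "v0 \<in> ?U" using v0(2) line_in_subspace_points[OF subU v0(1)] by simp
    obtain d f where f: "homogeneous_poly scale d f" "avg f v0 = 1" "frame f v0 = (\<lambda>y. y)"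
      using v0(1,4) by (rule frame_exists)
    interpret framed_quadratic_rep G scale Basis \<rho> q f d v0
      using f v0 by unfold_locales
    show ?thesis by (rule linearizable_quadric[OF hyp w0(1) v0(3) v0U irr])
  qed
  moreover have "stably_linearizable G (proj_action \<rho>) (quadric scale q)"
    if free: "generically_free G (proj_action \<rho>) (quadric scale q)"
  proof -
    \<comment> \<open>A point of the quadric that is not orthogonal to \<open>w0\<close>; the line through \<open>w0\<close> and \<open>z\<close> is not tangent.\<close>
    let ?x = "second_point w0 z"
    have "B w0 ?x = - (2 * B w0 z * B w0 z)" by (rule B_second_point[OF B_w0])
    then have Bx: "B w0 ?x \<noteq> 0" using z by simp
    have x: "?x \<noteq> 0" by (rule second_point_nonzero[OF q_w0 z])
    have xC: "line scale ?x \<in> cone_lines" using line_in_cone_lines[OF x] q_second_point[OF q_w0] by simp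
    obtain v0 where v0: "v0 \<noteq> 0" "line scale v0 \<in> cone_lines" "B w0 v0 \<noteq> 0" "free_vec v0"
      using subvariety_quadric free[unfolded quadric_eq] linear_B x xC Bx by (rule exists_free_vector)
    have q_v0: "q v0 = 0" using v0(1,2) line_in_cone_lines by blast
    obtain d f where f: "homogeneous_poly scale d f" "avg f v0 = 1" "frame f v0 = (\<lambda>y. y)"
      using v0(1,4) by (rule frame_exists)
    interpret quadric_projection G scale Basis \<rho> q f d v0 W w0
      using f v0 iso w0(1) q_v0 by unfold_locales
    show ?thesis by (rule stably_linearizable_quadric[OF irr])
  qed
  ultimately show ?thesis using hyperbolic_pair_exists[OF iso] by blast
qed

end
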